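(* Let $R$ be a right (or left) artinian ring. If $R$ is left automorphism-invariant, then $R$ is quasi-Frobenius.
   Context: Rings are associative with identity and modules are unital. A module $M$ is automorphism-invariant if $\varphi(M)\subseteq M$ for every automorphism $\varphi$ of its injective envelope $E(M)$. A ring $R$ is left automorphism-invariant if the left module ${}_RR$ is automorphism-invariant. A ring $R$ is quasi-Frobenius if it is left and right artinian and left and right self-injective (i.e. ${}_RR$ and $R_R$ are injective modules). The hypothesis "right (or left) artinian" means that $R$ is artinian on at least one side. *)

theory Defs
  imports "HOL-Algebra.Module"
begin

section \<open>Left and right modules over a noncommutative ring\<close>

text \<open>The library locale \<open>module\<close> assumes a commutative ring of scalars. The following locale is
  the same except that \<open>cring\<close> is replaced by \<open>ring\<close>. As there, only the carrier, the additive
  structure and \<open>smult\<close> of the record \<open>M\<close> are meaningful.\<close>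

locale left_module = R?: ring R + M?: abelian_group M
  for R :: "('a, 'r) ring_scheme" (structure) and M :: "('a, 'b, 'm) module_scheme" (structure) +
  assumes smult_closed [simp, intro]:
      "\<lbrakk>a \<in> carrier R; x \<in> carrier M\<rbrakk> \<Longrightarrow> a \<odot>\<^bsub>M\<^esub> x \<in> carrier M"
    and smult_l_distr:
      "\<lbrakk>a \<in> carrier R; b \<in> carrier R; x \<in> carrier M\<rbrakk> \<Longrightarrow>
      (a \<oplus> b) \<odot>\<^bsub>M\<^esub> x = a \<odot>\<^bsub>M\<^esub> x \<oplus>\<^bsub>M\<^esub> b \<odot>\<^bsub>M\<^esub> x"
    and smult_r_distr:
      "\<lbrakk>a \<in> carrier R; x \<in> carrier M; y \<in> carrier M\<rbrakk> \<Longrightarrow>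
      a \<odot>\<^bsub>M\<^esub> (x \<oplus>\<^bsub>M\<^esub> y) = a \<odot>\<^bsub>M\<^esub> x \<oplus>\<^bsub>M\<^esub> a \<odot>\<^bsub>M\<^esub> y"
    and smult_assoc1:
      "\<lbrakk>a \<in> carrier R; b \<in> carrier R; x \<in> carrier M\<rbrakk> \<Longrightarrow>
      (a \<otimes> b) \<odot>\<^bsub>M\<^esub> x = a \<odot>\<^bsub>M\<^esub> (b \<odot>\<^bsub>M\<^esub> x)"
    and smult_one [simp]: "x \<in> carrier M \<Longrightarrow> \<one> \<odot>\<^bsub>M\<^esub> x = x"

text \<open>Right modules over \<open>R\<close> are treated as left modules over the opposite ring.\<close>

definition opposite_ring :: "('a, 'r) ring_scheme \<Rightarrow> 'a ring" where
  "opposite_ring R = \<lparr>carrier = carrier R, mult = (\<lambda>x y. y \<otimes>\<^bsub>R\<^esub> x), one = \<one>\<^bsub>R\<^esub>,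
     zero = \<zero>\<^bsub>R\<^esub>, add = (\<lambda>x y. x \<oplus>\<^bsub>R\<^esub> y)\<rparr>"

definition regular_module :: "('a, 'r) ring_scheme \<Rightarrow> ('a, 'a) module" where
  "regular_module R = \<lparr>carrier = carrier R, mult = (\<lambda>x y. x \<otimes>\<^bsub>R\<^esub> y), one = \<one>\<^bsub>R\<^esub>,
     zero = \<zero>\<^bsub>R\<^esub>, add = (\<lambda>x y. x \<oplus>\<^bsub>R\<^esub> y), smult = (\<lambda>x y. x \<otimes>\<^bsub>R\<^esub> y)\<rparr>"

definition module_hom ::
  "('a, 'r) ring_scheme \<Rightarrow> ('a, 'b, 'm) module_scheme \<Rightarrow> ('a, 'c, 'n) module_scheme \<Rightarrow> ('b \<Rightarrow> 'c) set"
  where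
  "module_hom R M N = {h. h \<in> carrier M \<rightarrow> carrier N \<and>
     (\<forall>x\<in>carrier M. \<forall>y\<in>carrier M. h (x \<oplus>\<^bsub>M\<^esub> y) = h x \<oplus>\<^bsub>N\<^esub> h y) \<and>
     (\<forall>a\<in>carrier R. \<forall>x\<in>carrier M. h (a \<odot>\<^bsub>M\<^esub> x) = a \<odot>\<^bsub>N\<^esub> h x)}"

definition module_mono ::
  "('a, 'r) ring_scheme \<Rightarrow> ('a, 'b, 'm) module_scheme \<Rightarrow> ('a, 'c, 'n) module_scheme \<Rightarrow> ('b \<Rightarrow> 'c) set"
  where "module_mono R M N = {h \<in> module_hom R M N. inj_on h (carrier M)}"

definition module_aut ::
  "('a, 'r) ring_scheme \<Rightarrow> ('a, 'b, 'm) module_scheme \<Rightarrow> ('b \<Rightarrow> 'b) set"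
  where "module_aut R M = {h \<in> module_hom R M M. bij_betw h (carrier M) (carrier M)}"


section \<open>Injective modules and injective envelopes\<close>

definition extension_property ::
  "('a, 'r) ring_scheme \<Rightarrow> ('a, 'b, 'm) module_scheme \<Rightarrow> ('a, 'c, 'n) module_scheme \<Rightarrow>
   ('a, 'q, 'k) module_scheme \<Rightarrow> bool"
  where
  "extension_property R A B Q \<longleftrightarrow>
     (\<forall>i \<in> module_mono R A B. \<forall>f \<in> module_hom R A Q.
       \<exists>g \<in> module_hom R B Q. \<forall>x \<in> carrier A. g (i x) = f x)"

text \<open>A definition in HOL cannot quantify over types, so the test modules \<open>A\<close> and \<open>B\<close> below
  range over all modules whose elements have the type of the elements of \<open>R\<close>. This loses nothing:
  by \<open>injective_module_extension\<close> below, an injective module has the extension property for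
  modules over arbitrary types.\<close>

definition injective_module ::
  "('a, 'r) ring_scheme \<Rightarrow> ('a, 'q, 'k) module_scheme \<Rightarrow> bool"
  where
  "injective_module R Q \<longleftrightarrow> left_module R Q \<and>
     (\<forall>(A :: ('a, 'a) module) (B :: ('a, 'a) module).
        left_module R A \<longrightarrow> left_module R B \<longrightarrow> extension_property R A B Q)"

definition essential_submodule ::
  "'b set \<Rightarrow> ('a, 'r) ring_scheme \<Rightarrow> ('a, 'b, 'm) module_scheme \<Rightarrow> bool"
  where
  "essential_submodule N R M \<longleftrightarrow> submodule N R M \<and>
     (\<forall>K. submodule K R M \<longrightarrow> K \<inter> N = {\<zero>\<^bsub>M\<^esub>} \<longrightarrow> K = {\<zero>\<^bsub>M\<^esub>})"

text \<open>The module \<open>E\<close> together with the embedding \<open>i\<close> is an injective envelope of \<open>M\<close>.\<close>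

definition injective_envelope ::
  "('a, 'r) ring_scheme \<Rightarrow> ('a, 'b, 'm) module_scheme \<Rightarrow> ('a, 'e) module \<Rightarrow> ('b \<Rightarrow> 'e) \<Rightarrow> bool"
  where
  "injective_envelope R M E i \<longleftrightarrow> injective_module R E \<and> i \<in> module_mono R M E \<and>
     essential_submodule (i ` carrier M) R E"

text \<open>The type argument is the type of the elements of \<open>E(M)\<close>. Envelopes are unique up to
  isomorphism over \<open>M\<close>, hence the choice of \<open>E\<close>, \<open>i\<close> and of the type is irrelevant (see
  \<open>automorphism_invariant_envelope\<close> below). The existential quantifier prevents the
  condition from being vacuously true for a type too small to carry an envelope.\<close>

definition automorphism_invariant ::
  "'e itself \<Rightarrow> ('a, 'r) ring_scheme \<Rightarrow> ('a, 'b, 'm) module_scheme \<Rightarrow> bool"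
  where
  "automorphism_invariant (_ :: 'e itself) R M \<longleftrightarrow>
     (\<exists>(E :: ('a, 'e) module) i. injective_envelope R M E i \<and>
        (\<forall>\<phi> \<in> module_aut R E. \<phi> ` (i ` carrier M) \<subseteq> i ` carrier M))"


section \<open>The ring-theoretic notions\<close>

definition artinian_module :: "('a, 'r) ring_scheme \<Rightarrow> ('a, 'b, 'm) module_scheme \<Rightarrow> bool" where
  "artinian_module R M \<longleftrightarrow> left_module R M \<and>
     (\<forall>N :: nat \<Rightarrow> 'b set. (\<forall>n. submodule (N n) R M) \<and> (\<forall>n. N (Suc n) \<subseteq> N n) \<longrightarrow>
        (\<exists>m. \<forall>n\<ge>m. N n = N m))"

definition left_artinian :: "('a, 'r) ring_scheme \<Rightarrow> bool" where
  "left_artinian R \<longleftrightarrow> artinian_module R (regular_module R)"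

definition right_artinian :: "('a, 'r) ring_scheme \<Rightarrow> bool" where
  "right_artinian R \<longleftrightarrow> artinian_module (opposite_ring R) (regular_module (opposite_ring R))"

definition left_self_injective :: "('a, 'r) ring_scheme \<Rightarrow> bool" where
  "left_self_injective R \<longleftrightarrow> injective_module R (regular_module R)"

definition right_self_injective :: "('a, 'r) ring_scheme \<Rightarrow> bool" where
  "right_self_injective R \<longleftrightarrow>
     injective_module (opposite_ring R) (regular_module (opposite_ring R))"

definition left_automorphism_invariant :: "'e itself \<Rightarrow> ('a, 'r) ring_scheme \<Rightarrow> bool" where
  "left_automorphism_invariant t R \<longleftrightarrow> automorphism_invariant t R (regular_module R)"

definition quasi_frobenius :: "('a, 'r) ring_scheme \<Rightarrow> bool" where
  "quasi_frobenius R \<longleftrightarrow> ring R \<and> left_artinian R \<and> right_artinian R \<and>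
     left_self_injective R \<and> right_self_injective R"


section \<open>Independence of the types\<close>

context left_module
begin

lemma smult_l_null [simp]: "x \<in> carrier M \<Longrightarrow> \<zero> \<odot>\<^bsub>M\<^esub> x = \<zero>\<^bsub>M\<^esub>"
  by (metis M.add.r_cancel_one' R.l_zero R.zero_closed smult_closed smult_l_distr)

lemma smult_r_null [simp]: "a \<in> carrier R \<Longrightarrow> a \<odot>\<^bsub>M\<^esub> \<zero>\<^bsub>M\<^esub> = \<zero>\<^bsub>M\<^esub>"
  by (metis M.add.r_cancel_one' M.l_zero M.zero_closed smult_closed smult_r_distr)

lemma smult_minus_one:
  assumes "x \<in> carrier M"
  shows "(\<ominus> \<one>) \<odot>\<^bsub>M\<^esub> x = \<ominus>\<^bsub>M\<^esub> x"
proof -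
  have "(\<ominus> \<one>) \<odot>\<^bsub>M\<^esub> x \<oplus>\<^bsub>M\<^esub> x = (\<ominus> \<one> \<oplus> \<one>) \<odot>\<^bsub>M\<^esub> x"
    using assms by (simp add: smult_l_distr)
  also have "\<dots> = \<zero>\<^bsub>M\<^esub>"
    using assms by (simp add: R.l_neg)
  finally show ?thesis
    using assms by (metis M.minus_equality R.a_inv_closed R.one_closed smult_closed)
qed

lemma left_submoduleI:
  assumes "H \<subseteq> carrier M" "\<zero>\<^bsub>M\<^esub> \<in> H"
    and add: "\<And>a b. \<lbrakk>a \<in> H; b \<in> H\<rbrakk> \<Longrightarrow> a \<oplus>\<^bsub>M\<^esub> b \<in> H"
    and smult: "\<And>a x. \<lbrakk>a \<in> carrier R; x \<in> H\<rbrakk> \<Longrightarrow> a \<odot>\<^bsub>M\<^esub> x \<in> H"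
  shows "submodule H R M"
proof -
  have "\<ominus>\<^bsub>M\<^esub> x \<in> H" if "x \<in> H" for x
    using smult[OF R.a_inv_closed[OF R.one_closed] that] assms(1) that
    by (metis smult_minus_one subsetD)
  then show ?thesis
    using assms by (intro submodule.intro subgroup.intro submodule_axioms.intro)
      (auto simp: a_inv_def)
qed

lemma left_module_submodule:
  assumes "submodule H R M"
  shows "left_module R (M\<lparr>carrier := H\<rparr>)"
proof -
  interpret H: submodule H R M by fact
  have sub: "x \<in> H \<Longrightarrow> x \<in> carrier M" for x using H.subset by auto
  have inv: "\<exists>y\<in>H. y \<oplus>\<^bsub>M\<^esub> x = \<zero>\<^bsub>M\<^esub>" if "x \<in> H" for x
    using H.m_inv_closed[OF that] sub[OF that]
    by (metis M.l_neg a_inv_def)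
  have "abelian_group (M\<lparr>carrier := H\<rparr>)"
  proof (rule abelian_groupI)
    fix x assume "x \<in> carrier (M\<lparr>carrier := H\<rparr>)"
    then show "\<exists>y\<in>carrier (M\<lparr>carrier := H\<rparr>). y \<oplus>\<^bsub>M\<lparr>carrier := H\<rparr>\<^esub> x = \<zero>\<^bsub>M\<lparr>carrier := H\<rparr>\<^esub>"
      using inv by simp
  qed (use H.m_closed H.one_closed in \<open>simp_all add: sub M.a_ac\<close>)
  then show ?thesis
    by (intro left_module.intro left_module_axioms.intro R.ring_axioms)
      (auto simp: sub smult_l_distr smult_r_distr smult_assoc1)
qed

end

lemma left_module_regular:
  assumes "ring R" shows "left_module R (regular_module R)"
proof -
  interpret ring R by fact
  have "abelian_group (regular_module R)"
    by (intro abelian_groupI)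
      (auto simp: regular_module_def a_ac intro!: bexI[of _ "\<ominus>\<^bsub>R\<^esub> _"] l_neg)
  then show ?thesis
    by (intro left_module.intro left_module_axioms.intro ring_axioms)
      (auto simp: regular_module_def l_distr r_distr m_assoc)
qed

lemma module_homD:
  assumes "h \<in> module_hom R M N"
  shows "x \<in> carrier M \<Longrightarrow> h x \<in> carrier N"
    and "\<lbrakk>x \<in> carrier M; y \<in> carrier M\<rbrakk> \<Longrightarrow> h (x \<oplus>\<^bsub>M\<^esub> y) = h x \<oplus>\<^bsub>N\<^esub> h y"
    and "\<lbrakk>a \<in> carrier R; x \<in> carrier M\<rbrakk> \<Longrightarrow> h (a \<odot>\<^bsub>M\<^esub> x) = a \<odot>\<^bsub>N\<^esub> h x"
  using assms by (auto simp: module_hom_def)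

lemma module_hom_zero:
  assumes "left_module R M" "left_module R N" "h \<in> module_hom R M N"
  shows "h \<zero>\<^bsub>M\<^esub> = \<zero>\<^bsub>N\<^esub>"
proof -
  interpret M: left_module R M by fact
  interpret N: left_module R N by fact
  have "h (\<zero>\<^bsub>R\<^esub> \<odot>\<^bsub>M\<^esub> \<zero>\<^bsub>M\<^esub>) = \<zero>\<^bsub>R\<^esub> \<odot>\<^bsub>N\<^esub> h \<zero>\<^bsub>M\<^esub>"
    using module_homD(3)[OF assms(3)] by blast
  then show ?thesis
    using module_homD(1)[OF assms(3)] by simp
qed

lemma module_hom_inj:
  assumes "left_module R M" "left_module R N" "h \<in> module_hom R M N"
    and ker: "\<And>x. \<lbrakk>x \<in> carrier M; h x = \<zero>\<^bsub>N\<^esub>\<rbrakk> \<Longrightarrow> x = \<zero>\<^bsub>M\<^esub>"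
  shows "inj_on h (carrier M)"
proof (rule inj_onI)
  interpret M: left_module R M by fact
  interpret N: left_module R N by fact
  fix x y assume xy: "x \<in> carrier M" "y \<in> carrier M" "h x = h y"
  let ?m = "\<ominus>\<^bsub>R\<^esub> \<one>\<^bsub>R\<^esub>"
  have m: "?m \<in> carrier R" by simp
  have "h (x \<oplus>\<^bsub>M\<^esub> ?m \<odot>\<^bsub>M\<^esub> y) = h x \<oplus>\<^bsub>N\<^esub> ?m \<odot>\<^bsub>N\<^esub> h y"
    using xy m module_homD[OF assms(3)] by simp
  also have "\<dots> = \<zero>\<^bsub>N\<^esub>"
    using xy module_homD(1)[OF assms(3)] by (simp add: N.smult_minus_one N.M.r_neg)
  finally have "x \<oplus>\<^bsub>M\<^esub> ?m \<odot>\<^bsub>M\<^esub> y = \<zero>\<^bsub>M\<^esub>"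
    using ker xy m by simp
  then show "x = y"
    using xy by (simp add: M.smult_minus_one M.M.minus_equality M.M.add.inv_solve_right')
qed

text \<open>Baer's criterion, in the form: an injective module has the extension property for modules
  over arbitrary types.\<close>

theorem injective_module_extension:
  fixes R :: "('a, 'r) ring_scheme"
    and A :: "('a, 'b, 'm) module_scheme" and B :: "('a, 'c, 'n) module_scheme"
    and Q :: "('a, 'q, 'k) module_scheme"
  assumes inj: "injective_module R Q" and A: "left_module R A" and B: "left_module R B"
  shows "extension_property R A B Q"
  unfolding extension_property_def
proof (intro ballI)
  fix i f assume i: "i \<in> module_mono R A B" and f: "f \<in> module_hom R A Q"
  have Q: "left_module R Q" using inj by (simp add: injective_module_def)
  interpret A: left_module R A by fact
  interpret B: left_module R B by fact
  interpret Q: left_module R Q by fact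
  have ih: "i \<in> module_hom R A B" and ii: "inj_on i (carrier A)"
    using i by (auto simp: module_mono_def)
  note iD = module_homD[OF ih] and fD = module_homD[OF f]
  have i0: "i \<zero>\<^bsub>A\<^esub> = \<zero>\<^bsub>B\<^esub>" and f0: "f \<zero>\<^bsub>A\<^esub> = \<zero>\<^bsub>Q\<^esub>"
    using module_hom_zero A B Q ih f by blast+
  define P where "P = {G. G \<subseteq> carrier B \<times> carrier Q \<and>
     (\<forall>x y x' y'. (x, y) \<in> G \<longrightarrow> (x', y') \<in> G \<longrightarrow> (x \<oplus>\<^bsub>B\<^esub> x', y \<oplus>\<^bsub>Q\<^esub> y') \<in> G) \<and>
     (\<forall>a x y. a \<in> carrier R \<longrightarrow> (x, y) \<in> G \<longrightarrow> (a \<odot>\<^bsub>B\<^esub> x, a \<odot>\<^bsub>Q\<^esub> y) \<in> G) \<and>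
     (\<forall>y. (\<zero>\<^bsub>B\<^esub>, y) \<in> G \<longrightarrow> y = \<zero>\<^bsub>Q\<^esub>) \<and>
     (\<forall>x\<in>carrier A. (i x, f x) \<in> G)}"
  define G0 where "G0 = (\<lambda>x. (i x, f x)) ` carrier A"
  have "G0 \<in> P"
    unfolding P_def G0_def
  proof (intro CollectI conjI allI impI ballI)
    show "(\<lambda>x. (i x, f x)) ` carrier A \<subseteq> carrier B \<times> carrier Q"
      using iD(1) fD(1) by auto
  next
    fix x y x' y'
    assume "(x, y) \<in> (\<lambda>x. (i x, f x)) ` carrier A" "(x', y') \<in> (\<lambda>x. (i x, f x)) ` carrier A"
    then obtain u v where "u \<in> carrier A" "v \<in> carrier A" "x = i u" "y = f u" "x' = i v" "y' = f v"
      by auto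
    then show "(x \<oplus>\<^bsub>B\<^esub> x', y \<oplus>\<^bsub>Q\<^esub> y') \<in> (\<lambda>x. (i x, f x)) ` carrier A"
      by (intro image_eqI[of _ _ "u \<oplus>\<^bsub>A\<^esub> v"]) (auto simp: iD fD)
  next
    fix a x y assume "a \<in> carrier R" "(x, y) \<in> (\<lambda>x. (i x, f x)) ` carrier A"
    then show "(a \<odot>\<^bsub>B\<^esub> x, a \<odot>\<^bsub>Q\<^esub> y) \<in> (\<lambda>x. (i x, f x)) ` carrier A"
      by (auto simp: iD fD intro!: image_eqI[of _ _ "a \<odot>\<^bsub>A\<^esub> _"])
  next
    fix y assume "(\<zero>\<^bsub>B\<^esub>, y) \<in> (\<lambda>x. (i x, f x)) ` carrier A"
    then obtain u where u: "u \<in> carrier A" "i u = \<zero>\<^bsub>B\<^esub>" "y = f u" by auto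
    then have "u = \<zero>\<^bsub>A\<^esub>" using ii i0 by (metis A.M.zero_closed inj_onD)
    then show "y = \<zero>\<^bsub>Q\<^esub>" using u f0 by simp
  qed auto
  have "\<Union>C \<in> P" if C: "subset.chain P C" "C \<noteq> {}" for C
  proof -
    have CP: "C \<subseteq> P" using C by (simp add: subset.chain_def)
    have lin: "X \<subseteq> Y \<or> Y \<subseteq> X" if "X \<in> C" "Y \<in> C" for X Y
      using C(1) that by (auto simp: subset_chain_def)
    show ?thesis
      unfolding P_def
    proof (intro CollectI conjI allI impI ballI)
      show "\<Union>C \<subseteq> carrier B \<times> carrier Q" using CP unfolding P_def by blast
    next
      fix x y x' y' assume "(x, y) \<in> \<Union>C" "(x', y') \<in> \<Union>C"
      then obtain X Y where XY: "X \<in> C" "Y \<in> C" "(x, y) \<in> X" "(x', y') \<in> Y" by auto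
      then obtain Z where Z: "Z \<in> C" "(x, y) \<in> Z" "(x', y') \<in> Z" using lin[of X Y] by blast
      then have "Z \<in> P" using CP by auto
      then have "(x \<oplus>\<^bsub>B\<^esub> x', y \<oplus>\<^bsub>Q\<^esub> y') \<in> Z" using Z unfolding P_def by blast
      then show "(x \<oplus>\<^bsub>B\<^esub> x', y \<oplus>\<^bsub>Q\<^esub> y') \<in> \<Union>C" using Z by auto
    next
      fix a x y assume a: "a \<in> carrier R" "(x, y) \<in> \<Union>C"
      then obtain X where X: "X \<in> C" "(x, y) \<in> X" by auto
      then have "X \<in> P" using CP by auto
      then have "(a \<odot>\<^bsub>B\<^esub> x, a \<odot>\<^bsub>Q\<^esub> y) \<in> X" using X a unfolding P_def by blast
      then show "(a \<odot>\<^bsub>B\<^esub> x, a \<odot>\<^bsub>Q\<^esub> y) \<in> \<Union>C" using X by auto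
    next
      fix y assume "(\<zero>\<^bsub>B\<^esub>, y) \<in> \<Union>C"
      then obtain X where X: "X \<in> C" "(\<zero>\<^bsub>B\<^esub>, y) \<in> X" by auto
      then have "X \<in> P" using CP by auto
      then show "y = \<zero>\<^bsub>Q\<^esub>" using X unfolding P_def by blast
    next
      fix x assume x: "x \<in> carrier A"
      obtain X where X: "X \<in> C" using C by auto
      then have "X \<in> P" using CP by auto
      then show "(i x, f x) \<in> \<Union>C" using X x unfolding P_def by blast
    qed
  qed
  then obtain G where GP: "G \<in> P" and Gmax: "\<And>X. X \<in> P \<Longrightarrow> G \<subseteq> X \<Longrightarrow> X = G"
    using subset_Zorn_nonempty[of P] \<open>G0 \<in> P\<close> by blast
  have Gc: "x \<in> carrier B" "y \<in> carrier Q" if "(x, y) \<in> G" for x y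
    using GP that unfolding P_def by blast+
  have Gadd: "(x \<oplus>\<^bsub>B\<^esub> x', y \<oplus>\<^bsub>Q\<^esub> y') \<in> G" if "(x, y) \<in> G" "(x', y') \<in> G" for x y x' y'
    using GP that unfolding P_def by blast
  have Gsm: "(a \<odot>\<^bsub>B\<^esub> x, a \<odot>\<^bsub>Q\<^esub> y) \<in> G" if "a \<in> carrier R" "(x, y) \<in> G" for a x y
    using GP that unfolding P_def by blast
  have Gz: "y = \<zero>\<^bsub>Q\<^esub>" if "(\<zero>\<^bsub>B\<^esub>, y) \<in> G" for y
    using GP that unfolding P_def by blast
  have GA: "(i x, f x) \<in> G" if "x \<in> carrier A" for x
    using GP that unfolding P_def by blast
  have G0: "(\<zero>\<^bsub>B\<^esub>, \<zero>\<^bsub>Q\<^esub>) \<in> G"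
    using GA[OF A.M.zero_closed] i0 f0 by simp
  have Gneg: "(\<ominus>\<^bsub>B\<^esub> x, \<ominus>\<^bsub>Q\<^esub> y) \<in> G" if "(x, y) \<in> G" for x y
    using Gsm[of "\<ominus>\<^bsub>R\<^esub> \<one>\<^bsub>R\<^esub>", OF _ that] Gc[OF that]
    by (simp add: B.smult_minus_one Q.smult_minus_one)
  have Gfun: "y = y'" if "(x, y) \<in> G" "(x, y') \<in> G" for x y y'
  proof -
    have "(x \<oplus>\<^bsub>B\<^esub> \<ominus>\<^bsub>B\<^esub> x, y \<oplus>\<^bsub>Q\<^esub> \<ominus>\<^bsub>Q\<^esub> y') \<in> G" using Gadd Gneg that by blast
    then have "y \<oplus>\<^bsub>Q\<^esub> \<ominus>\<^bsub>Q\<^esub> y' = \<zero>\<^bsub>Q\<^esub>" using Gz Gc[OF that(1)] by (simp add: B.M.r_neg)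
    then show ?thesis using Gc[OF that(1)] Gc[OF that(2)]
      by (simp add: Q.M.add.inv_solve_right')
  qed
  define g where "g x = (THE y. (x, y) \<in> G)" for x
  have gI: "g x = y" if "(x, y) \<in> G" for x y
    unfolding g_def using that Gfun by blast
  have dom: "\<exists>y. (b, y) \<in> G" if b: "b \<in> carrier B" for b
  proof -
    define I where "I = {r \<in> carrier R. \<exists>y. (r \<odot>\<^bsub>B\<^esub> b, y) \<in> G}"
    let ?RR = "regular_module R"
    have RR: "left_module R ?RR" by (rule left_module_regular) (rule A.R.ring_axioms)
    interpret RR: left_module R ?RR by fact
    have sub: "submodule I R ?RR"
    proof (rule RR.left_submoduleI)
      show "I \<subseteq> carrier ?RR" by (auto simp: I_def regular_module_def)
      show "\<zero>\<^bsub>?RR\<^esub> \<in> I" using G0 b by (auto simp: I_def regular_module_def)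
      fix r s assume "r \<in> I" "s \<in> I"
      then obtain y z where "r \<in> carrier R" "s \<in> carrier R"
        "(r \<odot>\<^bsub>B\<^esub> b, y) \<in> G" "(s \<odot>\<^bsub>B\<^esub> b, z) \<in> G"
        by (auto simp: I_def)
      then show "r \<oplus>\<^bsub>?RR\<^esub> s \<in> I"
        using Gadd[of "r \<odot>\<^bsub>B\<^esub> b" y "s \<odot>\<^bsub>B\<^esub> b" z] b
        by (auto simp: I_def regular_module_def B.smult_l_distr)
    next
      fix a r assume "a \<in> carrier R" "r \<in> I"
      then obtain y where "r \<in> carrier R" "a \<in> carrier R" "(r \<odot>\<^bsub>B\<^esub> b, y) \<in> G"
        by (auto simp: I_def)
      then show "a \<odot>\<^bsub>?RR\<^esub> r \<in> I"
        using Gsm[of a "r \<odot>\<^bsub>B\<^esub> b" y] b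
        by (auto simp: I_def regular_module_def B.smult_assoc1)
    qed
    let ?I = "?RR\<lparr>carrier := I\<rparr>"
    have I: "left_module R ?I" using RR.left_module_submodule[OF sub] .
    have incl: "(\<lambda>x. x) \<in> module_mono R ?I ?RR"
      by (auto simp: module_mono_def module_hom_def I_def regular_module_def)
    have hom: "(\<lambda>r. g (r \<odot>\<^bsub>B\<^esub> b)) \<in> module_hom R ?I Q"
      unfolding module_hom_def
    proof (intro CollectI conjI ballI)
      show "(\<lambda>r. g (r \<odot>\<^bsub>B\<^esub> b)) \<in> carrier ?I \<rightarrow> carrier Q"
        using Gc gI by (auto simp: I_def)
    next
      fix r s assume "r \<in> carrier ?I" "s \<in> carrier ?I"
      then obtain y z where *: "r \<in> carrier R" "s \<in> carrier R"
        "(r \<odot>\<^bsub>B\<^esub> b, y) \<in> G" "(s \<odot>\<^bsub>B\<^esub> b, z) \<in> G"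
        by (auto simp: I_def)
      then have "(r \<odot>\<^bsub>B\<^esub> b \<oplus>\<^bsub>B\<^esub> s \<odot>\<^bsub>B\<^esub> b, y \<oplus>\<^bsub>Q\<^esub> z) \<in> G" using Gadd by blast
      then show "g ((r \<oplus>\<^bsub>?I\<^esub> s) \<odot>\<^bsub>B\<^esub> b) = g (r \<odot>\<^bsub>B\<^esub> b) \<oplus>\<^bsub>Q\<^esub> g (s \<odot>\<^bsub>B\<^esub> b)"
        using * b by (simp add: gI regular_module_def B.smult_l_distr)
    next
      fix a r assume "a \<in> carrier R" "r \<in> carrier ?I"
      then obtain y where *: "r \<in> carrier R" "a \<in> carrier R" "(r \<odot>\<^bsub>B\<^esub> b, y) \<in> G"
        by (auto simp: I_def)
      then have "(a \<odot>\<^bsub>B\<^esub> (r \<odot>\<^bsub>B\<^esub> b), a \<odot>\<^bsub>Q\<^esub> y) \<in> G" using Gsm by blast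
      then show "g ((a \<odot>\<^bsub>?I\<^esub> r) \<odot>\<^bsub>B\<^esub> b) = a \<odot>\<^bsub>Q\<^esub> g (r \<odot>\<^bsub>B\<^esub> b)"
        using * b by (simp add: gI regular_module_def B.smult_assoc1)
    qed
    have "extension_property R ?I ?RR Q"
      using inj I RR by (simp add: injective_module_def)
    then obtain h where h: "h \<in> module_hom R ?RR Q"
      and hI: "\<And>r. r \<in> I \<Longrightarrow> h r = g (r \<odot>\<^bsub>B\<^esub> b)"
      using incl hom unfolding extension_property_def by force
    define q where "q = h \<one>\<^bsub>R\<^esub>"
    have q: "q \<in> carrier Q"
      using module_homD(1)[OF h, of "\<one>\<^bsub>R\<^esub>"] by (simp add: q_def regular_module_def)
    have hq: "h r = r \<odot>\<^bsub>Q\<^esub> q" if "r \<in> carrier R" for r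
      using module_homD(3)[OF h, of r "\<one>\<^bsub>R\<^esub>"] that by (simp add: q_def regular_module_def)
    define G' where "G' = {(x \<oplus>\<^bsub>B\<^esub> r \<odot>\<^bsub>B\<^esub> b, y \<oplus>\<^bsub>Q\<^esub> r \<odot>\<^bsub>Q\<^esub> q) | x y r. (x, y) \<in> G \<and> r \<in> carrier R}"
    have G'I: "(x', y') \<in> G'" if "(x, y) \<in> G" "r \<in> carrier R" "x' = x \<oplus>\<^bsub>B\<^esub> r \<odot>\<^bsub>B\<^esub> b"
      "y' = y \<oplus>\<^bsub>Q\<^esub> r \<odot>\<^bsub>Q\<^esub> q" for x y r x' y'
      using that unfolding G'_def by blast
    have GG': "G \<subseteq> G'"
    proof (rule subrelI)
      fix x y assume "(x, y) \<in> G"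
      then show "(x, y) \<in> G'" using Gc[of x y] b q
        by (intro G'I[of x y "\<zero>\<^bsub>R\<^esub>"]) auto
    qed
    have "G' \<in> P"
      unfolding P_def
    proof (intro CollectI conjI allI impI ballI)
      show "G' \<subseteq> carrier B \<times> carrier Q" unfolding G'_def using Gc b q by auto
    next
      fix x y x' y' assume "(x, y) \<in> G'" "(x', y') \<in> G'"
      then obtain u v r u' v' r' where *: "(u, v) \<in> G" "(u', v') \<in> G" "r \<in> carrier R" "r' \<in> carrier R"
        "x = u \<oplus>\<^bsub>B\<^esub> r \<odot>\<^bsub>B\<^esub> b" "y = v \<oplus>\<^bsub>Q\<^esub> r \<odot>\<^bsub>Q\<^esub> q"
        "x' = u' \<oplus>\<^bsub>B\<^esub> r' \<odot>\<^bsub>B\<^esub> b" "y' = v' \<oplus>\<^bsub>Q\<^esub> r' \<odot>\<^bsub>Q\<^esub> q"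
        unfolding G'_def by blast
      show "(x \<oplus>\<^bsub>B\<^esub> x', y \<oplus>\<^bsub>Q\<^esub> y') \<in> G'"
        by (rule G'I[of "u \<oplus>\<^bsub>B\<^esub> u'" "v \<oplus>\<^bsub>Q\<^esub> v'" "r \<oplus>\<^bsub>R\<^esub> r'"])
          (use * Gc[OF *(1)] Gc[OF *(2)] b q Gadd in
            \<open>auto simp: B.smult_l_distr Q.smult_l_distr B.M.a_ac Q.M.a_ac\<close>)
    next
      fix a x y assume a: "a \<in> carrier R" and "(x, y) \<in> G'"
      then obtain u v r where *: "(u, v) \<in> G" "r \<in> carrier R"
        "x = u \<oplus>\<^bsub>B\<^esub> r \<odot>\<^bsub>B\<^esub> b" "y = v \<oplus>\<^bsub>Q\<^esub> r \<odot>\<^bsub>Q\<^esub> q"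
        unfolding G'_def by blast
      show "(a \<odot>\<^bsub>B\<^esub> x, a \<odot>\<^bsub>Q\<^esub> y) \<in> G'"
        by (rule G'I[of "a \<odot>\<^bsub>B\<^esub> u" "a \<odot>\<^bsub>Q\<^esub> v" "a \<otimes>\<^bsub>R\<^esub> r"])
          (use * a Gc[OF *(1)] b q Gsm in
            \<open>auto simp: B.smult_r_distr Q.smult_r_distr B.smult_assoc1 Q.smult_assoc1\<close>)
    next
      fix y assume "(\<zero>\<^bsub>B\<^esub>, y) \<in> G'"
      then obtain u v r where *: "(u, v) \<in> G" "r \<in> carrier R"
        "\<zero>\<^bsub>B\<^esub> = u \<oplus>\<^bsub>B\<^esub> r \<odot>\<^bsub>B\<^esub> b" "y = v \<oplus>\<^bsub>Q\<^esub> r \<odot>\<^bsub>Q\<^esub> q"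
        unfolding G'_def by blast
      have uv: "u \<in> carrier B" "v \<in> carrier Q" using Gc[OF *(1)] by auto
      have "r \<odot>\<^bsub>B\<^esub> b = \<ominus>\<^bsub>B\<^esub> u"
        using *(2,3) uv b by (metis B.M.a_comm B.M.minus_equality B.smult_closed)
      then have G1: "(r \<odot>\<^bsub>B\<^esub> b, \<ominus>\<^bsub>Q\<^esub> v) \<in> G" using Gneg[OF *(1)] by simp
      then have "r \<in> I" using *(2) by (auto simp: I_def)
      then have "r \<odot>\<^bsub>Q\<^esub> q = \<ominus>\<^bsub>Q\<^esub> v" using hI hq *(2) gI[OF G1] by metis
      then show "y = \<zero>\<^bsub>Q\<^esub>" using *(4) uv by (simp add: Q.M.r_neg)
    next
      fix x assume "x \<in> carrier A"
      then show "(i x, f x) \<in> G'" using GA GG' by blast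
    qed
    then have "G' = G" using Gmax GG' by blast
    moreover have "(b, q) \<in> G'"
      by (rule G'I[OF G0 A.R.one_closed]) (use b q in auto)
    ultimately show ?thesis by blast
  qed
  have gG: "(x, g x) \<in> G" if "x \<in> carrier B" for x
    using dom[OF that] gI by blast
  have "g \<in> module_hom R B Q"
    unfolding module_hom_def
    by (auto intro!: gI Gadd Gsm gG intro: Gc(2)[OF gG])
  moreover have "\<forall>x\<in>carrier A. g (i x) = f x"
    using gI GA by blast
  ultimately show "\<exists>g\<in>module_hom R B Q. \<forall>x\<in>carrier A. g (i x) = f x"
    by blast
qed

text \<open>Extending a monomorphism on an essential submodule yields a monomorphism.\<close>

lemma essential_inj:
  assumes M: "left_module R M" and E: "left_module R E" and F: "left_module R F"
    and i: "i \<in> module_mono R M E" and ess: "essential_submodule (i ` carrier M) R E"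
    and h: "h \<in> module_hom R E F"
    and ker: "\<And>x. \<lbrakk>x \<in> carrier M; h (i x) = \<zero>\<^bsub>F\<^esub>\<rbrakk> \<Longrightarrow> x = \<zero>\<^bsub>M\<^esub>"
  shows "inj_on h (carrier E)"
proof (rule module_hom_inj[OF E F h])
  interpret M: left_module R M by fact
  interpret E: left_module R E by fact
  interpret F: left_module R F by fact
  have ih: "i \<in> module_hom R M E" using i by (simp add: module_mono_def)
  have i0: "i \<zero>\<^bsub>M\<^esub> = \<zero>\<^bsub>E\<^esub>" and h0: "h \<zero>\<^bsub>E\<^esub> = \<zero>\<^bsub>F\<^esub>"
    using module_hom_zero M E F ih h by blast+
  let ?K = "{x \<in> carrier E. h x = \<zero>\<^bsub>F\<^esub>}"
  have "submodule ?K R E"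
    by (rule E.left_submoduleI) (auto simp: h0 module_homD[OF h])
  moreover have "?K \<inter> i ` carrier M = {\<zero>\<^bsub>E\<^esub>}"
    using ker i0 h0 by (auto intro!: image_eqI[of _ i "\<zero>\<^bsub>M\<^esub>"])
  ultimately have "?K = {\<zero>\<^bsub>E\<^esub>}" using ess by (auto simp: essential_submodule_def)
  then show "x = \<zero>\<^bsub>E\<^esub>" if "x \<in> carrier E" "h x = \<zero>\<^bsub>F\<^esub>" for x
    using that by blast
qed

lemma injective_envelope_unique:
  fixes E :: "('a, 'e) module" and F :: "('a, 'f) module"
  assumes M: "left_module R M" and E: "injective_envelope R M E i" and F: "injective_envelope R M F j"
  obtains h r where "h \<in> module_hom R E F" "r \<in> module_hom R F E"
    "\<And>x. x \<in> carrier E \<Longrightarrow> r (h x) = x" "\<And>y. y \<in> carrier F \<Longrightarrow> h (r y) = y"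
    "\<And>x. x \<in> carrier M \<Longrightarrow> h (i x) = j x"
proof -
  have Em: "left_module R E" "injective_module R E" "i \<in> module_mono R M E"
      "i \<in> module_hom R M E" "inj_on i (carrier M)" "essential_submodule (i ` carrier M) R E"
    and Fm: "left_module R F" "injective_module R F" "j \<in> module_mono R M F"
      "j \<in> module_hom R M F" "inj_on j (carrier M)" "essential_submodule (j ` carrier M) R F"
    using E F by (auto simp: injective_envelope_def injective_module_def module_mono_def)
  interpret M: left_module R M by fact
  interpret E: left_module R E by fact
  interpret F: left_module R F by fact
  have i0: "i \<zero>\<^bsub>M\<^esub> = \<zero>\<^bsub>E\<^esub>" and j0: "j \<zero>\<^bsub>M\<^esub> = \<zero>\<^bsub>F\<^esub>"
    using module_hom_zero M Em Fm by blast+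
  obtain h where h: "h \<in> module_hom R E F" and hi: "\<And>x. x \<in> carrier M \<Longrightarrow> h (i x) = j x"
    using injective_module_extension[OF Fm(2) M Em(1)] Em(3) Fm(4)
    unfolding extension_property_def by blast
  have "inj_on h (carrier E)"
    by (rule essential_inj[OF M Em(1) Fm(1) Em(3) Em(6) h])
      (use hi j0 Fm(5) in \<open>metis M.M.zero_closed inj_onD\<close>)
  then have hm: "h \<in> module_mono R E F" using h by (simp add: module_mono_def)
  have "(\<lambda>x. x) \<in> module_hom R E E" by (auto simp: module_hom_def)
  from bspec[OF bspec[OF injective_module_extension[OF Em(2) Em(1) Fm(1),
    unfolded extension_property_def] hm] this]
  obtain r where r: "r \<in> module_hom R F E" and rh: "\<And>x. x \<in> carrier E \<Longrightarrow> r (h x) = x"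
    by blast
  have rj: "r (j x) = i x" if "x \<in> carrier M" for x
    using rh[of "i x"] hi that module_homD(1)[OF Em(4)] by simp
  have "inj_on r (carrier F)"
    by (rule essential_inj[OF M Fm(1) Em(1) Fm(3) Fm(6) r])
      (use rj i0 Em(5) in \<open>metis M.M.zero_closed inj_onD\<close>)
  then have "h (r y) = y" if "y \<in> carrier F" for y
    using that rh module_homD(1)[OF r] module_homD(1)[OF h] by (metis inj_onD)
  then show thesis using that h r rh hi by blast
qed

theorem automorphism_invariant_envelope:
  fixes E :: "('a, 'e) module" and F :: "('a, 'f) module"
  assumes M: "left_module R M" and inv: "automorphism_invariant TYPE('e) R M"
    and F: "injective_envelope R M F j" and \<phi>: "\<phi> \<in> module_aut R F"
  shows "\<phi> ` (j ` carrier M) \<subseteq> j ` carrier M"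
proof -
  obtain E :: "('a, 'e) module" and i where E: "injective_envelope R M E i"
    and Einv: "\<forall>\<psi> \<in> module_aut R E. \<psi> ` (i ` carrier M) \<subseteq> i ` carrier M"
    using inv unfolding automorphism_invariant_def by (elim exE conjE)
  have i: "i \<in> module_hom R M E" using E by (simp add: injective_envelope_def module_mono_def)
  obtain h r where h: "h \<in> module_hom R E F" and r: "r \<in> module_hom R F E"
    and rh: "\<And>x. x \<in> carrier E \<Longrightarrow> r (h x) = x" and hr: "\<And>y. y \<in> carrier F \<Longrightarrow> h (r y) = y"
    and hi: "\<And>x. x \<in> carrier M \<Longrightarrow> h (i x) = j x"
    using injective_envelope_unique[OF M E F] by blast
  have \<phi>h: "\<phi> \<in> module_hom R F F" and \<phi>b: "bij_betw \<phi> (carrier F) (carrier F)"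
    using \<phi> by (auto simp: module_aut_def)
  let ?\<psi> = "\<lambda>x. r (\<phi> (h x))"
  have bh: "bij_betw h (carrier E) (carrier F)"
    by (rule bij_betw_byWitness[of _ r]) (use rh hr module_homD(1)[OF h] module_homD(1)[OF r] in auto)
  have br: "bij_betw r (carrier F) (carrier E)"
    by (rule bij_betw_byWitness[of _ h]) (use rh hr module_homD(1)[OF h] module_homD(1)[OF r] in auto)
  have "bij_betw ?\<psi> (carrier E) (carrier E)"
    using bij_betw_trans[OF bij_betw_trans[OF bh \<phi>b] br] by (simp add: comp_def)
  moreover have "?\<psi> \<in> module_hom R E E"
    unfolding module_hom_def
    by (auto simp: module_homD[OF h] module_homD[OF r] module_homD[OF \<phi>h])
  ultimately have \<psi>: "?\<psi> \<in> module_aut R E" by (simp add: module_aut_def)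
  show ?thesis
  proof clarify
    fix x assume x: "x \<in> carrier M"
    then obtain y where y: "y \<in> carrier M" "?\<psi> (i x) = i y" using bspec[OF Einv \<psi>] by blast
    have "\<phi> (j x) \<in> carrier F"
      using x hi module_homD(1)[OF i] module_homD(1)[OF h] module_homD(1)[OF \<phi>h] by metis
    then have "\<phi> (j x) = h (?\<psi> (i x))" using x hi hr by simp
    also have "\<dots> = j y" using y hi by simp
    finally show "\<phi> (j x) \<in> j ` carrier M" using y by blast
  qed
qed

end

theory Submission
  imports Defs
begin

text \<open>A ring that is artinian on one side is semiprimary: its radical \<open>J\<close> is nilpotent and \<open>1\<close> is
  a sum of orthogonal local idempotents. Let \<open>S\<close> be its left socle. An automorphism of a left ideal
  extends to the injective envelope \<open>E\<close> of \<open>R\<close>, so automorphism-invariance makes it a right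
  multiplication. Applied to semisimple left ideals with two generators, this shows that \<open>eS\<close> is a
  simple right module or zero for every local idempotent \<open>e\<close>, and that the left module \<open>Sf\<close> is simple
  for every local idempotent \<open>f\<close>; counting isomorphism classes, every simple left module embeds in
  \<open>R\<close>. Hence every endomorphism of the left module \<open>S\<close> is a right multiplication. For \<open>v \<in> E\<close>
  there is therefore \<open>r \<in> R\<close> such that \<open>w = v - r\<close> satisfies \<open>Sw = 0\<close>. Then \<open>x \<mapsto> x + xw\<close> is an
  essential embedding of \<open>R\<close> into \<open>E\<close>, which extends to an automorphism of \<open>E\<close>, so \<open>w \<in> R\<close>. Thus
  \<open>E = R\<close>, that is, \<open>R\<close> is left self-injective. The annihilator maps are then inverse
  antiisomorphisms between the lattices of left and of right ideals, which transfers the chain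
  condition to the other side and turns homomorphisms from right ideals into left multiplications.\<close>

text \<open>Automorphism-invariance controls automorphisms only, while injectivity concerns all
  homomorphisms, and an endomorphism of a semisimple module need not be a sum of automorphisms when
  residue division rings have two elements. This obstacle dictates the choice of automorphisms: two
  isomorphic simple left ideals \<open>Rx\<close> and \<open>Ry\<close> can always be swapped, and
  the two automorphisms of \<open>Rx + Ry\<close> used for \<open>Sf\<close> differ by the
  projection onto \<open>Ry\<close>, whatever the residue division ring is. A local corner ring
  cannot induce such a projection. Until self-injectivity is known, left ideals may lack a chain
  condition, because the given one may be on the right. Complements of left ideals therefore come
  from Zorn's lemma. Quotient modules are replaced by membership conditions: the simple module
  belonging to a local idempotent \<open>e\<close> is \<open>Re/Je\<close>, and it appears as the
  condition \<open>a \<otimes> e \<in> J\<close>. Homomorphisms defined on left ideals are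
  represented by their graphs.\<close>

lemma opposite_ring_simps [simp]:
  "carrier (opposite_ring R) = carrier R"
  "x \<otimes>\<^bsub>opposite_ring R\<^esub> y = y \<otimes>\<^bsub>R\<^esub> x"
  "\<one>\<^bsub>opposite_ring R\<^esub> = \<one>\<^bsub>R\<^esub>"
  "\<zero>\<^bsub>opposite_ring R\<^esub> = \<zero>\<^bsub>R\<^esub>"
  "x \<oplus>\<^bsub>opposite_ring R\<^esub> y = x \<oplus>\<^bsub>R\<^esub> y"
  by (simp_all add: opposite_ring_def)

lemma regular_module_simps [simp]:
  "carrier (regular_module R) = carrier R"
  "\<zero>\<^bsub>regular_module R\<^esub> = \<zero>\<^bsub>R\<^esub>"
  "x \<oplus>\<^bsub>regular_module R\<^esub> y = x \<oplus>\<^bsub>R\<^esub> y"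
  "a \<odot>\<^bsub>regular_module R\<^esub> x = a \<otimes>\<^bsub>R\<^esub> x"
  by (simp_all add: regular_module_def)

lemma ring_opposite:
  assumes "ring R"
  shows "ring (opposite_ring R)"
proof -
  interpret ring R by fact
  have "abelian_group (opposite_ring R)"
    by (intro abelian_groupI) (auto simp: a_ac intro!: bexI[of _ "\<ominus>\<^bsub>R\<^esub> _"] l_neg)
  moreover have "Group.monoid (opposite_ring R)"
    by (intro monoidI) (simp_all add: m_assoc)
  ultimately show ?thesis
    by (rule ringI) (simp_all add: l_distr r_distr)
qed

section \<open>One-sided ideals and the Jacobson radical\<close>

text \<open>Negatives come from multiplication by \<open>\<ominus> \<one>\<close>. Right ideals are
  left ideals of the opposite ring, so that lemmas about left ideals serve both sides.\<close>

definition left_ideal :: "('a, 'r) ring_scheme \<Rightarrow> 'a set \<Rightarrow> bool" where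
  "left_ideal R L \<longleftrightarrow> L \<subseteq> carrier R \<and> \<zero>\<^bsub>R\<^esub> \<in> L \<and> (\<forall>x\<in>L. \<forall>y\<in>L. x \<oplus>\<^bsub>R\<^esub> y \<in> L) \<and>
     (\<forall>a\<in>carrier R. \<forall>x\<in>L. a \<otimes>\<^bsub>R\<^esub> x \<in> L)"

abbreviation right_ideal :: "('a, 'r) ring_scheme \<Rightarrow> 'a set \<Rightarrow> bool" where
  "right_ideal R K \<equiv> left_ideal (opposite_ring R) K"

definition left_dcc :: "('a, 'r) ring_scheme \<Rightarrow> bool" where
  "left_dcc R \<longleftrightarrow> (\<forall>N :: nat \<Rightarrow> 'a set. (\<forall>n. left_ideal R (N n)) \<and> (\<forall>n. N (Suc n) \<subseteq> N n) \<longrightarrow>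
        (\<exists>m. \<forall>n\<ge>m. N n = N m))"

lemma left_idealI:
  assumes "L \<subseteq> carrier R" "\<zero>\<^bsub>R\<^esub> \<in> L" "\<And>x y. x \<in> L \<Longrightarrow> y \<in> L \<Longrightarrow> x \<oplus>\<^bsub>R\<^esub> y \<in> L"
    "\<And>a x. a \<in> carrier R \<Longrightarrow> x \<in> L \<Longrightarrow> a \<otimes>\<^bsub>R\<^esub> x \<in> L"
  shows "left_ideal R L"
  using assms by (auto simp: left_ideal_def)

lemma left_idealD:
  assumes "left_ideal R L"
  shows "x \<in> L \<Longrightarrow> x \<in> carrier R" "\<zero>\<^bsub>R\<^esub> \<in> L" "x \<in> L \<Longrightarrow> y \<in> L \<Longrightarrow> x \<oplus>\<^bsub>R\<^esub> y \<in> L"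
    "a \<in> carrier R \<Longrightarrow> x \<in> L \<Longrightarrow> a \<otimes>\<^bsub>R\<^esub> x \<in> L"
  using assms by (auto simp: left_ideal_def)

lemma left_ideal_submodule:
  assumes "ring R"
  shows "submodule L R (regular_module R) \<longleftrightarrow> left_ideal R L"
proof -
  interpret left_module R "regular_module R" by (rule left_module_regular) fact
  show ?thesis
  proof
    assume "submodule L R (regular_module R)"
    then interpret submodule L R "regular_module R" .
    show "left_ideal R L"
      using subset smult_closed m_closed one_closed by (auto simp: left_ideal_def)
  next
    assume "left_ideal R L"
    then show "submodule L R (regular_module R)"
      by (intro left_submoduleI) (auto simp: left_ideal_def)
  qed
qed

lemma left_artinian_iff_dcc:
  assumes "ring R"
  shows "left_artinian R \<longleftrightarrow> left_dcc R"
  using assms left_module_regular[OF assms]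
  by (simp add: left_artinian_def artinian_module_def left_dcc_def left_ideal_submodule)

text \<open>The chain condition makes strict inclusion of left ideals well-founded. In the
  applications \<open>P\<close> often describes a left ideal through an auxiliary idempotent or
  right ideal.\<close>

lemma left_dcc_minimal:
  assumes dcc: "left_dcc R" and P: "P L0" "left_ideal R L0"
  obtains L where "left_ideal R L" "P L" "\<And>L'. left_ideal R L' \<Longrightarrow> P L' \<Longrightarrow> L' \<subseteq> L \<Longrightarrow> L' = L"
proof -
  let ?r = "{(L', L). left_ideal R L' \<and> left_ideal R L \<and> L' \<subset> L}"
  have "wf ?r"
    unfolding wf_iff_no_infinite_down_chain
  proof
    assume "\<exists>f. \<forall>i. (f (Suc i), f i) \<in> ?r"
    then obtain f where f: "\<And>i. (f (Suc i), f i) \<in> ?r" by blast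
    then have "(\<forall>n. left_ideal R (f n)) \<and> (\<forall>n. f (Suc n) \<subseteq> f n)" by blast
    then obtain m where "\<forall>n\<ge>m. f n = f m" using dcc unfolding left_dcc_def by blast
    then have "f (Suc m) = f m" using le_SucI by blast
    then show False using f[of m] by blast
  qed
  then obtain L where "L \<in> {L. left_ideal R L \<and> P L}"
    "\<And>L'. (L', L) \<in> ?r \<Longrightarrow> L' \<notin> {L. left_ideal R L \<and> P L}"
    using wfE_min[of ?r L0 "{L. left_ideal R L \<and> P L}"] P by blast
  then show thesis by (intro that[of L]) blast+
qed

context ring
begin

lemma r_distr_minus:
  "\<lbrakk>x \<in> carrier R; y \<in> carrier R; z \<in> carrier R\<rbrakk> \<Longrightarrow> x \<otimes> (y \<ominus> z) = x \<otimes> y \<ominus> x \<otimes> z"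
  by (simp add: a_minus_def r_distr r_minus)

lemma l_distr_minus:
  "\<lbrakk>x \<in> carrier R; y \<in> carrier R; z \<in> carrier R\<rbrakk> \<Longrightarrow> (x \<ominus> y) \<otimes> z = x \<otimes> z \<ominus> y \<otimes> z"
  by (simp add: a_minus_def l_distr l_minus)

lemma minus_self [simp]: "x \<in> carrier R \<Longrightarrow> x \<ominus> x = \<zero>"
  by (simp add: a_minus_def r_neg)

lemma minus_zero_right [simp]: "x \<in> carrier R \<Longrightarrow> x \<ominus> \<zero> = x"
  by (simp add: a_minus_def)

lemma minus_eq_zeroD: "\<lbrakk>x \<in> carrier R; y \<in> carrier R; x \<ominus> y = \<zero>\<rbrakk> \<Longrightarrow> x = y"
  by (simp add: a_minus_def add.inv_solve_right')

lemma left_ideal_neg: "\<lbrakk>left_ideal R L; x \<in> L\<rbrakk> \<Longrightarrow> \<ominus> x \<in> L"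
  using left_idealD(4)[of R L "\<ominus> \<one>" x] left_idealD(1)[of R L x] by (simp add: l_minus)

lemma left_ideal_minus: "\<lbrakk>left_ideal R L; x \<in> L; y \<in> L\<rbrakk> \<Longrightarrow> x \<ominus> y \<in> L"
  unfolding a_minus_def by (intro left_idealD(3) left_ideal_neg)

lemma left_ideal_carrier: "left_ideal R (carrier R)"
  by (rule left_idealI) auto

lemma left_ideal_zero: "left_ideal R {\<zero>}"
  by (rule left_idealI) auto

lemma left_ideal_Int: "\<lbrakk>left_ideal R L; left_ideal R L'\<rbrakk> \<Longrightarrow> left_ideal R (L \<inter> L')"
  by (auto simp: left_ideal_def)

lemma left_ideal_mult_right:
  assumes "left_ideal R L" "x \<in> carrier R"
  shows "left_ideal R ((\<lambda>a. a \<otimes> x) ` L)"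
proof (rule left_idealI)
  have L: "\<And>y. y \<in> L \<Longrightarrow> y \<in> carrier R" using left_idealD(1)[OF assms(1)] .
  then show "(\<lambda>a. a \<otimes> x) ` L \<subseteq> carrier R" using assms by auto
  show "\<zero> \<in> (\<lambda>a. a \<otimes> x) ` L"
    using left_idealD(2)[OF assms(1)] assms(2) by (force intro: image_eqI[of _ _ \<zero>])
  fix y z assume "y \<in> (\<lambda>a. a \<otimes> x) ` L" "z \<in> (\<lambda>a. a \<otimes> x) ` L"
  then obtain u v where uv: "u \<in> L" "v \<in> L" "y = u \<otimes> x" "z = v \<otimes> x" by blast
  then show "y \<oplus> z \<in> (\<lambda>a. a \<otimes> x) ` L"
    using left_idealD(3)[OF assms(1) uv(1,2)] L assms(2)
    by (intro image_eqI[of _ _ "u \<oplus> v"]) (auto simp: l_distr)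
next
  have L: "\<And>y. y \<in> L \<Longrightarrow> y \<in> carrier R" using left_idealD(1)[OF assms(1)] .
  fix a y assume a: "a \<in> carrier R" "y \<in> (\<lambda>a. a \<otimes> x) ` L"
  then obtain u where u: "u \<in> L" "y = u \<otimes> x" by blast
  then show "a \<otimes> y \<in> (\<lambda>a. a \<otimes> x) ` L"
    using left_idealD(4)[OF assms(1) a(1) u(1)] L assms(2) a
    by (intro image_eqI[of _ _ "a \<otimes> u"]) (auto simp: m_assoc)
qed

lemma left_ideal_sum:
  assumes A: "left_ideal R A" and B: "left_ideal R B"
  shows "left_ideal R {a \<oplus> b | a b. a \<in> A \<and> b \<in> B}"
proof (rule left_idealI)
  let ?S = "{a \<oplus> b | a b. a \<in> A \<and> b \<in> B}"
  note C = left_idealD(1)[OF A] left_idealD(1)[OF B]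
  show "?S \<subseteq> carrier R" using C by auto
  show "\<zero> \<in> ?S" using left_idealD(2)[OF A] left_idealD(2)[OF B]
    by (intro CollectI exI[of _ \<zero>]) auto
  show "y \<oplus> z \<in> ?S" if yz: "y \<in> ?S" "z \<in> ?S" for y z
  proof -
    obtain a b a' b' where *: "a \<in> A" "b \<in> B" "a' \<in> A" "b' \<in> B" "y = a \<oplus> b" "z = a' \<oplus> b'"
      using yz by blast
    then have "y \<oplus> z = (a \<oplus> a') \<oplus> (b \<oplus> b')" using C by (simp add: a_ac)
    then show ?thesis using * left_idealD(3)[OF A] left_idealD(3)[OF B] by blast
  qed
  show "c \<otimes> y \<in> ?S" if cy: "c \<in> carrier R" "y \<in> ?S" for c y
  proof -
    obtain a b where *: "a \<in> A" "b \<in> B" "y = a \<oplus> b" using cy by blast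
    then have "c \<otimes> y = c \<otimes> a \<oplus> c \<otimes> b" using C cy by (simp add: r_distr)
    then show ?thesis using * cy left_idealD(4)[OF A] left_idealD(4)[OF B] by blast
  qed
qed

lemma left_ideal_add_principal:
  assumes "left_ideal R L" "x \<in> carrier R"
  shows "left_ideal R {a \<otimes> x \<oplus> l | a l. a \<in> carrier R \<and> l \<in> L}"
proof -
  have "{a \<otimes> x \<oplus> l | a l. a \<in> carrier R \<and> l \<in> L} =
      {u \<oplus> l | u l. u \<in> (\<lambda>a. a \<otimes> x) ` carrier R \<and> l \<in> L}" by blast
  then show ?thesis
    using left_ideal_sum[OF left_ideal_mult_right[OF left_ideal_carrier assms(2)] assms(1)] by simp
qed

text \<open>Zorn's lemma serves two purposes here: with the nonzero elements of a left ideal as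
  \<open>X\<close> it yields a complement of that ideal, and with a singleton a left ideal maximal
  among those missing one element.\<close>

lemma maximal_left_ideal_disjoint:
  assumes A: "left_ideal R A" "A \<inter> X = {}"
  obtains B where "left_ideal R B" "A \<subseteq> B" "B \<inter> X = {}"
    "\<And>C. left_ideal R C \<Longrightarrow> B \<subseteq> C \<Longrightarrow> C \<inter> X = {} \<Longrightarrow> C = B"
proof -
  let ?F = "{B. left_ideal R B \<and> A \<subseteq> B \<and> B \<inter> X = {}}"
  have "\<exists>M\<in>?F. \<forall>Y\<in>?F. M \<subseteq> Y \<longrightarrow> Y = M"
  proof (rule subset_Zorn_nonempty)
    show "?F \<noteq> {}" using A by blast
    fix C assume C: "C \<noteq> {}" "subset.chain ?F C"
    have CF: "C \<subseteq> ?F" using C by (simp add: subset.chain_def)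
    have lin: "Y \<subseteq> Z \<or> Z \<subseteq> Y" if "Y \<in> C" "Z \<in> C" for Y Z
      using C(2) that by (auto simp: subset_chain_def)
    have CI: "left_ideal R Y" if "Y \<in> C" for Y using CF that by blast
    have "left_ideal R (\<Union>C)"
    proof (rule left_idealI)
      show "\<Union>C \<subseteq> carrier R" using left_idealD(1)[OF CI] by blast
      show "\<zero> \<in> \<Union>C" using left_idealD(2)[OF CI] C(1) by blast
      fix x y assume "x \<in> \<Union>C" "y \<in> \<Union>C"
      then obtain Z where "Z \<in> C" "x \<in> Z" "y \<in> Z" using lin by (metis UnionE subsetD)
      then show "x \<oplus> y \<in> \<Union>C" using left_idealD(3)[OF CI] by blast
    next
      fix a x assume "a \<in> carrier R" "x \<in> \<Union>C"
      then show "a \<otimes> x \<in> \<Union>C" using left_idealD(4)[OF CI] by blast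
    qed
    then show "\<Union>C \<in> ?F" using CF C(1) by blast
  qed
  then obtain M where M: "M \<in> ?F" "\<forall>Y\<in>?F. M \<subseteq> Y \<longrightarrow> Y = M" ..
  show thesis
  proof (rule that[of M])
    fix C assume "left_ideal R C" "M \<subseteq> C" "C \<inter> X = {}"
    then have "C \<in> ?F" using M(1) by auto
    then show "C = M" using M(2) \<open>M \<subseteq> C\<close> by simp
  qed (use M(1) in simp_all)
qed

end

text \<open>This elementwise form of the intersection of the maximal left ideals asks for left
  inverses only; closure under right multiplication is \<open>jacobson_right\<close>.\<close>

definition jacobson_radical :: "('a, 'r) ring_scheme \<Rightarrow> 'a set" where
  "jacobson_radical R = {x \<in> carrier R. \<forall>a\<in>carrier R. \<exists>b\<in>carrier R.
     b \<otimes>\<^bsub>R\<^esub> (\<one>\<^bsub>R\<^esub> \<ominus>\<^bsub>R\<^esub> a \<otimes>\<^bsub>R\<^esub> x) = \<one>\<^bsub>R\<^esub>}"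

context ring
begin

abbreviation "JR \<equiv> jacobson_radical R"

lemma jacobson_carrier: "x \<in> JR \<Longrightarrow> x \<in> carrier R"
  by (simp add: jacobson_radical_def)

lemma jacobson_quasi_regular:
  assumes "x \<in> JR" "y \<in> carrier R" "y = x \<otimes> y"
  shows "y = \<zero>"
proof -
  have x: "x \<in> carrier R" using assms jacobson_carrier by blast
  obtain b where b: "b \<in> carrier R" "b \<otimes> (\<one> \<ominus> \<one> \<otimes> x) = \<one>"
    using assms(1) unfolding jacobson_radical_def by blast
  have "(\<one> \<ominus> \<one> \<otimes> x) \<otimes> y = y \<ominus> x \<otimes> y" using x assms(2) by algebra
  also have "\<dots> = \<zero>" using assms x by (simp add: a_minus_def r_neg flip: assms(3))
  finally have z: "(\<one> \<ominus> \<one> \<otimes> x) \<otimes> y = \<zero>" .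
  have "y = b \<otimes> (\<one> \<ominus> \<one> \<otimes> x) \<otimes> y" unfolding b using assms(2) by simp
  also have "\<dots> = b \<otimes> ((\<one> \<ominus> \<one> \<otimes> x) \<otimes> y)" using b(1) x assms(2) by (intro m_assoc) auto
  finally show ?thesis unfolding z using b(1) by simp
qed

lemma left_ideal_jacobson: "left_ideal R JR"
proof (rule left_idealI)
  show "JR \<subseteq> carrier R" using jacobson_carrier by blast
  show "\<zero> \<in> JR" by (auto simp: jacobson_radical_def a_minus_def intro!: bexI[of _ \<one>])
next
  fix x y assume xy: "x \<in> JR" "y \<in> JR"
  note [simp] = jacobson_carrier[OF xy(1)] jacobson_carrier[OF xy(2)]
  have "\<exists>d\<in>carrier R. d \<otimes> (\<one> \<ominus> a \<otimes> (x \<oplus> y)) = \<one>" if a [simp]: "a \<in> carrier R" for a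
  proof -
    obtain b where [simp]: "b \<in> carrier R" and b: "b \<otimes> (\<one> \<ominus> a \<otimes> x) = \<one>"
      using xy(1) a unfolding jacobson_radical_def by blast
    have "b \<otimes> a \<in> carrier R" by simp
    then obtain c where [simp]: "c \<in> carrier R" and c: "c \<otimes> (\<one> \<ominus> b \<otimes> a \<otimes> y) = \<one>"
      using xy(2) unfolding jacobson_radical_def by blast
    \<comment> \<open>Multiplying by \<open>b\<close> turns \<open>1 - ax\<close> into
      \<open>1\<close> and leaves \<open>1 - bay\<close>, which \<open>c\<close> inverts.\<close>
    have "b \<otimes> (\<one> \<ominus> a \<otimes> (x \<oplus> y)) = b \<otimes> (\<one> \<ominus> a \<otimes> x) \<ominus> b \<otimes> a \<otimes> y"
      by (simp add: a_minus_def r_distr m_assoc r_minus minus_add a_ac)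
    then have "c \<otimes> b \<otimes> (\<one> \<ominus> a \<otimes> (x \<oplus> y)) = \<one>" using b c by (simp add: m_assoc)
    then show ?thesis by (intro bexI[of _ "c \<otimes> b"]) auto
  qed
  then show "x \<oplus> y \<in> JR" by (simp add: jacobson_radical_def)
next
  fix c x assume "c \<in> carrier R" "x \<in> JR"
  then show "c \<otimes> x \<in> JR"
    unfolding jacobson_radical_def by (auto simp: m_assoc[symmetric])
qed

text \<open>If \<open>b\<close> is a left inverse of \<open>1 - ru\<close>, then
  \<open>1 + ubr\<close> is one of \<open>1 - ur\<close>. Here \<open>u = ax\<close>, and
  \<open>1 - ru = 1 - (ra)x\<close> has a left inverse because \<open>x\<close> is in the
  radical.\<close>

lemma jacobson_right:
  assumes x: "x \<in> JR" and [simp]: "r \<in> carrier R"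
  shows "x \<otimes> r \<in> JR"
proof -
  note [simp] = jacobson_carrier[OF x]
  have "\<exists>d\<in>carrier R. d \<otimes> (\<one> \<ominus> a \<otimes> (x \<otimes> r)) = \<one>" if a [simp]: "a \<in> carrier R" for a
  proof -
    define u where "u = a \<otimes> x"
    have [simp]: "u \<in> carrier R" by (simp add: u_def)
    obtain b where [simp]: "b \<in> carrier R" and "b \<otimes> (\<one> \<ominus> (r \<otimes> a) \<otimes> x) = \<one>"
      using x m_closed[OF assms(2) a] unfolding jacobson_radical_def by blast
    then have b: "b \<otimes> (\<one> \<ominus> r \<otimes> u) = \<one>" by (simp add: u_def m_assoc)
    have "(\<one> \<oplus> u \<otimes> b \<otimes> r) \<otimes> (\<one> \<ominus> u \<otimes> r) = \<one> \<ominus> u \<otimes> r \<oplus> u \<otimes> (b \<otimes> (\<one> \<ominus> r \<otimes> u)) \<otimes> r"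
      by (simp add: a_minus_def r_distr l_distr m_assoc r_minus l_minus minus_add a_ac)
    also have "\<dots> = \<one>" unfolding b by (simp add: a_minus_def a_assoc l_neg)
    finally show ?thesis
      by (intro bexI[of _ "\<one> \<oplus> u \<otimes> b \<otimes> r"]) (auto simp: u_def m_assoc)
  qed
  then show ?thesis by (simp add: jacobson_radical_def)
qed

text \<open>For \<open>y = ax\<close> the square of \<open>y\<close> is \<open>a(xax)\<close>, so
  \<open>1 - yy = (1 + y)(1 - y)\<close> has a left inverse, and then so has \<open>1 - y\<close>.
  In other words, \<open>R/J\<close> is semiprime.\<close>

lemma jacobson_semiprime:
  assumes [simp]: "x \<in> carrier R" and sq: "\<And>a. a \<in> carrier R \<Longrightarrow> x \<otimes> a \<otimes> x \<in> JR"
  shows "x \<in> JR"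
proof -
  have "\<exists>d\<in>carrier R. d \<otimes> (\<one> \<ominus> a \<otimes> x) = \<one>" if a [simp]: "a \<in> carrier R" for a
  proof -
    define y where "y = a \<otimes> x"
    have [simp]: "y \<in> carrier R" by (simp add: y_def)
    obtain b where [simp]: "b \<in> carrier R" and b: "b \<otimes> (\<one> \<ominus> a \<otimes> (x \<otimes> a \<otimes> x)) = \<one>"
      using sq[OF a] a unfolding jacobson_radical_def by blast
    have "(\<one> \<oplus> y) \<otimes> (\<one> \<ominus> y) = \<one> \<ominus> y \<otimes> y"
      by (simp add: l_distr r_distr_minus) (simp add: a_minus_def minus_add a_assoc r_neg1 r_neg2)
    then have "b \<otimes> (\<one> \<oplus> y) \<otimes> (\<one> \<ominus> y) = \<one>" using b by (simp add: y_def m_assoc)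
    then show ?thesis by (intro bexI[of _ "b \<otimes> (\<one> \<oplus> y)"]) (auto simp: y_def)
  qed
  then show ?thesis by (simp add: jacobson_radical_def)
qed

end

text \<open>Nilpotency of \<open>J\<close> only asks that long products vanish, so products are
  recorded without their additive closure. This makes the passage to the opposite ring a mere
  reversal of factors.\<close>

primrec products :: "('a, 'r) ring_scheme \<Rightarrow> 'a set \<Rightarrow> nat \<Rightarrow> 'a set" where
  "products R J 0 = {\<one>\<^bsub>R\<^esub>}"
| "products R J (Suc k) = {p \<otimes>\<^bsub>R\<^esub> j | p j. p \<in> products R J k \<and> j \<in> J}"

context ring
begin

lemma products_carrier: "J \<subseteq> carrier R \<Longrightarrow> p \<in> products R J k \<Longrightarrow> p \<in> carrier R"
  by (induction k arbitrary: p) auto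

lemma products_Suc_left:
  assumes "J \<subseteq> carrier R"
  shows "products R J (Suc k) = {j \<otimes> p | p j. p \<in> products R J k \<and> j \<in> J}"
proof (induction k)
  case 0
  show ?case using assms by (force simp: subset_iff)
next
  case (Suc k)
  have C: "\<And>j. j \<in> J \<Longrightarrow> j \<in> carrier R" "\<And>p k. p \<in> products R J k \<Longrightarrow> p \<in> carrier R"
    using assms products_carrier by auto
  have "products R J (Suc (Suc k)) = {p \<otimes> j | p j. p \<in> products R J (Suc k) \<and> j \<in> J}" by simp
  also have "\<dots> = {(i \<otimes> p) \<otimes> j | p i j. p \<in> products R J k \<and> i \<in> J \<and> j \<in> J}"
    unfolding Suc.IH by blast
  also have "\<dots> = {i \<otimes> (p \<otimes> j) | p i j. p \<in> products R J k \<and> i \<in> J \<and> j \<in> J}"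
    by (rule Collect_cong) (metis (no_types, lifting) C m_assoc)
  also have "\<dots> = {i \<otimes> p | p i. p \<in> products R J (Suc k) \<and> i \<in> J}"
    by auto
  finally show ?case .
qed

lemma products_opposite:
  assumes "J \<subseteq> carrier R"
  shows "products (opposite_ring R) J k = products R J k"
proof (induction k)
  case (Suc k)
  then show ?case by (auto simp: products_Suc_left[OF assms] simp del: products.simps(2) simp: products.simps(2)[of "opposite_ring R"])
qed simp

lemma products_add:
  assumes "J \<subseteq> carrier R" "p \<in> products R J (m + n)"
  shows "\<exists>q\<in>products R J m. \<exists>r\<in>products R J n. p = q \<otimes> r"
  using assms(2)
proof (induction n arbitrary: p)
  case 0
  then show ?case using products_carrier[OF assms(1)] by force
next
  case (Suc n)
  then obtain p' j where *: "p = p' \<otimes> j" "p' \<in> products R J (m + n)" "j \<in> J" by auto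
  from Suc.IH[OF this(2)] obtain q r where "q \<in> products R J m" "r \<in> products R J n" "p' = q \<otimes> r"
    by blast
  then show ?case using * assms(1) products_carrier[OF assms(1)]
    by (intro bexI[of _ q] bexI[of _ "r \<otimes> j"]) (auto intro!: m_assoc)
qed

text \<open>\<open>B k\<close> is the left ideal generated by the \<open>k\<close>-fold products. If
  these never vanish, a left ideal \<open>L\<close> minimal among those not killed by the
  \<open>m\<close>-fold products has the form \<open>(B m)l\<close> with \<open>l\<close> in
  \<open>L\<close>. Then \<open>l = bl\<close> for some \<open>b\<close> in the radical, and
  \<open>l = 0\<close>.\<close>

lemma jacobson_nilpotent:
  assumes dcc: "left_dcc R"
  shows "\<exists>k. products R JR k \<subseteq> {\<zero>}"
proof (rule ccontr)
  assume non: "\<nexists>k. products R JR k \<subseteq> {\<zero>}"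
  have J: "JR \<subseteq> carrier R" using jacobson_carrier by blast
  note PC = products_carrier[OF J]
  define B where "B k = \<Inter>{L. left_ideal R L \<and> products R JR k \<subseteq> L}" for k
  have BP: "products R JR k \<subseteq> B k" for k by (auto simp: B_def)
  have Bleast: "left_ideal R L \<Longrightarrow> products R JR k \<subseteq> L \<Longrightarrow> B k \<subseteq> L" for L k
    by (auto simp: B_def)
  have BI: "left_ideal R (B k)" for k
  proof (rule left_idealI)
    show "B k \<subseteq> carrier R" using PC left_ideal_carrier by (intro Bleast) auto
  qed (auto simp: B_def dest: left_idealD)
  have "B (Suc k) \<subseteq> B k" for k
  proof (rule Bleast[OF BI])
    show "products R JR (Suc k) \<subseteq> B k"
      using BP[of k] J left_idealD(4)[OF BI[of k]] by (auto simp: products_Suc_left[OF J] simp del: products.simps)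
  qed
  then obtain m0 where m0: "\<forall>n\<ge>m0. B n = B m0" using dcc BI unfolding left_dcc_def by blast
  \<comment> \<open>The successor makes \<open>m\<close> positive, so that \<open>B m\<close> lies
    in the radical, while \<open>B (m + m) = B m\<close> still holds.\<close>
  define m where "m = Suc m0"
  have Bm: "B (m + m) = B m" using m0[rule_format, of m] m0[rule_format, of "m + m"] by (simp add: m_def)
  have BJ: "B m \<subseteq> JR"
    by (rule Bleast[OF left_ideal_jacobson])
      (use PC left_idealD(4)[OF left_ideal_jacobson] in \<open>auto simp: m_def\<close>)
  have BC: "\<And>b. b \<in> B m \<Longrightarrow> b \<in> carrier R" using BJ J by blast
  let ?P = "\<lambda>L. \<exists>p\<in>products R JR m. \<exists>l\<in>L. p \<otimes> l \<noteq> \<zero>"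
  have "?P (B m)"
  proof -
    obtain p where p: "p \<in> products R JR (m + m)" "p \<noteq> \<zero>" using non by blast
    from products_add[OF J p(1)] show ?thesis using p(2) BP by blast
  qed
  from left_dcc_minimal[where P = ?P, OF dcc this BI] obtain L where L: "left_ideal R L" "?P L"
    and Lmin: "\<And>L'. left_ideal R L' \<Longrightarrow> ?P L' \<Longrightarrow> L' \<subseteq> L \<Longrightarrow> L' = L"
    by blast
  from L(2) obtain p l where p: "p \<in> products R JR m" and l: "l \<in> L" and pl: "p \<otimes> l \<noteq> \<zero>" by blast
  have lc: "l \<in> carrier R" using left_idealD(1)[OF L(1) l] .
  let ?Bl = "(\<lambda>b. b \<otimes> l) ` B m"
  have "?P ?Bl"
  proof (rule ccontr)
    assume n: "\<not> ?P ?Bl"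
    have "left_ideal R {b \<in> carrier R. b \<otimes> l = \<zero>}"
      by (rule left_idealI) (auto simp: lc l_distr m_assoc)
    moreover have "products R JR (m + m) \<subseteq> {b \<in> carrier R. b \<otimes> l = \<zero>}"
    proof
      fix b assume b: "b \<in> products R JR (m + m)"
      from products_add[OF J b] obtain q r where "q \<in> products R JR m" "r \<in> products R JR m" "b = q \<otimes> r"
        by blast
      then show "b \<in> {b \<in> carrier R. b \<otimes> l = \<zero>}" using n BP PC lc by (auto simp: m_assoc)
    qed
    ultimately have "B (m + m) \<subseteq> {b \<in> carrier R. b \<otimes> l = \<zero>}" by (rule Bleast)
    then show False using Bm BP p pl by blast
  qed
  moreover have "?Bl \<subseteq> L" using left_idealD(4)[OF L(1) BC l] by blast
  ultimately have "?Bl = L" using Lmin left_ideal_mult_right[OF BI lc] by blast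
  then obtain b where "b \<in> B m" "l = b \<otimes> l" using l by blast
  then have "l = \<zero>" using jacobson_quasi_regular lc BJ by blast
  then show False using pl PC[OF p] by simp
qed

end

section \<open>Semiprimary rings\<close>

text \<open>The last two clauses say that a submodule of \<open>Re\<close> not inside
  \<open>J\<close> is all of \<open>Re\<close>, and likewise for \<open>eR\<close>; so
  \<open>Re/Je\<close> and \<open>eR/eJ\<close> are simple. For the Jacobson radical these are the
  idempotents with a local corner ring \<open>eRe\<close>.\<close>

definition local_idempotent :: "('a, 'r) ring_scheme \<Rightarrow> 'a set \<Rightarrow> 'a \<Rightarrow> bool" where
  "local_idempotent R J e \<longleftrightarrow> e \<in> carrier R \<and> e \<otimes>\<^bsub>R\<^esub> e = e \<and> e \<notin> J \<and>
     (\<forall>x\<in>carrier R. x \<otimes>\<^bsub>R\<^esub> e \<notin> J \<longrightarrow> (\<exists>b\<in>carrier R. b \<otimes>\<^bsub>R\<^esub> (x \<otimes>\<^bsub>R\<^esub> e) = e)) \<and>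
     (\<forall>x\<in>carrier R. e \<otimes>\<^bsub>R\<^esub> x \<notin> J \<longrightarrow> (\<exists>b\<in>carrier R. e \<otimes>\<^bsub>R\<^esub> x \<otimes>\<^bsub>R\<^esub> b = e))"

text \<open>All conditions are left-right symmetric, so the chain condition on either side provides them.\<close>

locale semiprimary = ring R for R :: "('a, 'r) ring_scheme" (structure) +
  fixes J :: "'a set" and es :: "'a set"
  assumes left_ideal_J: "left_ideal R J"
    and J_right: "\<lbrakk>x \<in> J; r \<in> carrier R\<rbrakk> \<Longrightarrow> x \<otimes> r \<in> J"
    and nilpotent: "\<exists>k. products R J k \<subseteq> {\<zero>}"
    and finite_es: "finite es"
    and local_es: "e \<in> es \<Longrightarrow> local_idempotent R J e"
    and orthogonal: "\<lbrakk>e \<in> es; f \<in> es; e \<noteq> f\<rbrakk> \<Longrightarrow> e \<otimes> f = \<zero>"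
    and sum_es: "(\<Oplus>e\<in>es. e) = \<one>"

lemma finsum_opposite:
  assumes "ring R" "A \<subseteq> carrier R" "finite A"
  shows "finsum (opposite_ring R) (\<lambda>x. x) A = finsum R (\<lambda>x. x) A"
proof -
  interpret R: ring R by fact
  interpret O: ring "opposite_ring R" by (rule ring_opposite) fact
  show ?thesis using assms(3,2)
  proof (induction A)
    case (insert a A)
    then have "(\<lambda>x. x) \<in> A \<rightarrow> carrier R" by blast
    then show ?case using insert by simp
  qed simp
qed

lemma semiprimary_opposite:
  assumes R: "ring R" and "semiprimary (opposite_ring R) J es"
  shows "semiprimary R J es"
proof -
  interpret ring R by fact
  interpret S: semiprimary "opposite_ring R" J es by fact
  have J: "J \<subseteq> carrier R" and es: "es \<subseteq> carrier R"
    using S.left_ideal_J S.local_es by (auto simp: left_ideal_def local_idempotent_def)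
  show ?thesis
  proof (intro semiprimary.intro semiprimary_axioms.intro R)
    show "left_ideal R J"
      using S.left_ideal_J S.J_right by (simp add: left_ideal_def)
    show "\<exists>k. products R J k \<subseteq> {\<zero>\<^bsub>R\<^esub>}" using S.nilpotent products_opposite[OF J] by simp
    show "local_idempotent R J e" if "e \<in> es" for e
      using S.local_es[OF that] by (simp add: local_idempotent_def)
    show "x \<otimes>\<^bsub>R\<^esub> r \<in> J" if "x \<in> J" "r \<in> carrier R" for x r
      using left_idealD(4)[OF S.left_ideal_J] that by simp
    show "finsum R (\<lambda>e. e) es = \<one>\<^bsub>R\<^esub>"
      using S.sum_es finsum_opposite[OF R es S.finite_es] by simp
    show "e \<otimes>\<^bsub>R\<^esub> f = \<zero>\<^bsub>R\<^esub>" if "e \<in> es" "f \<in> es" "e \<noteq> f" for e f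
      using S.orthogonal[of f e] that by auto
  qed (rule S.finite_es)
qed

lemma (in semiprimary) semiprimary_opposite_ring: "semiprimary (opposite_ring R) J es"
proof -
  interpret O: ring "opposite_ring R" by (rule ring_opposite) (rule ring_axioms)
  have J: "J \<subseteq> carrier R" and es: "es \<subseteq> carrier R"
    using left_ideal_J local_es by (auto simp: left_ideal_def local_idempotent_def)
  show ?thesis
  proof (intro semiprimary.intro semiprimary_axioms.intro O.ring_axioms)
    show "left_ideal (opposite_ring R) J"
      using left_ideal_J J_right by (simp add: left_ideal_def)
    show "\<exists>k. products (opposite_ring R) J k \<subseteq> {\<zero>\<^bsub>opposite_ring R\<^esub>}"
      using nilpotent products_opposite[OF J] by simp
    show "local_idempotent (opposite_ring R) J e" if "e \<in> es" for e
      using local_es[OF that] by (simp add: local_idempotent_def)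
    show "x \<otimes>\<^bsub>opposite_ring R\<^esub> r \<in> J" if "x \<in> J" "r \<in> carrier (opposite_ring R)" for x r
      using left_idealD(4)[OF left_ideal_J] that by simp
    show "finsum (opposite_ring R) (\<lambda>e. e) es = \<one>\<^bsub>opposite_ring R\<^esub>"
      using sum_es finsum_opposite[OF ring_axioms es finite_es] by simp
    show "e \<otimes>\<^bsub>opposite_ring R\<^esub> f = \<zero>\<^bsub>opposite_ring R\<^esub>" if "e \<in> es" "f \<in> es" "e \<noteq> f" for e f
      using orthogonal[of f e] that by auto
  qed (rule finite_es)
qed

section \<open>Decomposition of the identity into orthogonal local idempotents\<close>

context ring
begin

text \<open>The right-hand clause of locality comes from semiprimeness: if \<open>ex\<close> is
  outside \<open>J\<close>, so is some \<open>exaex\<close>, hence so is the corner element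
  \<open>y = exae\<close>. Its left inverse \<open>b'\<close> in \<open>eRe\<close> is outside
  \<open>J\<close> as well and has a left inverse of its own, so \<open>b'\<close> is a two-sided
  inverse of \<open>y\<close>.\<close>

lemma local_idempotentI:
  assumes J: "J = JR" and e: "e \<in> carrier R" "e \<otimes> e = e" "e \<notin> J"
    and loc: "\<And>x. \<lbrakk>x \<in> carrier R; x \<otimes> e \<notin> J\<rbrakk> \<Longrightarrow> \<exists>b\<in>carrier R. b \<otimes> (x \<otimes> e) = e"
  shows "local_idempotent R J e"
proof -
  have "\<exists>b\<in>carrier R. e \<otimes> x \<otimes> b = e" if x: "x \<in> carrier R" "e \<otimes> x \<notin> J" for x
  proof -
    have "e \<otimes> x \<in> carrier R" using e x by simp
    then obtain a where a: "a \<in> carrier R" "(e \<otimes> x) \<otimes> a \<otimes> (e \<otimes> x) \<notin> JR"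
      using jacobson_semiprime[of "e \<otimes> x"] x(2) J by blast
    define y where "y = e \<otimes> x \<otimes> a \<otimes> e"
    have y: "y \<in> carrier R" using e x a by (simp add: y_def)
    have "(e \<otimes> x) \<otimes> a \<otimes> (e \<otimes> x) = y \<otimes> x" using e x a by (simp add: y_def m_assoc)
    then have "y \<notin> J" using a(2) jacobson_right x(1) J by metis
    then obtain b where b: "b \<in> carrier R" "b \<otimes> y = e"
      using loc[of "e \<otimes> x \<otimes> a"] e x a by (auto simp: y_def)
    define b' where "b' = e \<otimes> b \<otimes> e"
    have b': "b' \<in> carrier R" "e \<otimes> b' = b'" using e b by (simp_all add: b'_def m_assoc[symmetric])
    have ey: "e \<otimes> y = y" using e x a by (simp add: y_def m_assoc[symmetric])
    have b'y: "b' \<otimes> y = e" using e b y ey by (simp add: b'_def m_assoc)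
    have "b' \<notin> J"
      using b'y e(3) y jacobson_right J by metis
    then obtain c where c: "c \<in> carrier R" "c \<otimes> b' = e"
      using loc[of "e \<otimes> b"] e b by (auto simp: b'_def)
    have "y = c \<otimes> e" using ey c b' y b'y by (metis m_assoc)
    then have "y \<otimes> b' = e" using c b' e by (simp add: m_assoc)
    then have "e \<otimes> x \<otimes> (a \<otimes> e \<otimes> b') = e" using e x a b' by (simp add: y_def m_assoc)
    then show ?thesis using e a b' by blast
  qed
  then show ?thesis using e loc by (simp add: local_idempotent_def)
qed

lemma nat_pow_products: "\<lbrakk>J \<subseteq> carrier R; x \<in> J\<rbrakk> \<Longrightarrow> x [^] (k::nat) \<in> products R J k"
  by (induction k) auto

text \<open>Choose \<open>a\<close> and \<open>c\<close> in \<open>L\<close> with \<open>La = L\<close> and \<open>ca = a\<close>. Since \<open>c(1 - c)\<close> annihilates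
  \<open>a\<close>, it is nilpotent, so right multiplication by \<open>c\<close> is bijective on \<open>L\<close>, and the \<open>e\<close> with
  \<open>ec = c\<close> is idempotent.\<close>

lemma minimal_nonradical_idempotent:
  assumes dcc: "left_dcc R" and L: "left_ideal R L" "\<not> L \<subseteq> JR"
    and min: "\<And>L'. \<lbrakk>left_ideal R L'; L' \<subseteq> L; \<not> L' \<subseteq> JR\<rbrakk> \<Longrightarrow> L' = L"
  shows "\<exists>e\<in>L. e \<otimes> e = e \<and> e \<notin> JR"
proof -
  note LC = left_idealD(1)[OF L(1)]
  have J0: "\<zero> \<in> JR" using left_idealD(2)[OF left_ideal_jacobson] .
  obtain a x where a: "a \<in> L" "x \<in> L" "x \<otimes> a \<notin> JR"
  proof -
    obtain a where a: "a \<in> L" "a \<notin> JR" using L by blast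
    have "\<exists>x\<in>L. a \<otimes> x \<notin> JR"
    proof (rule ccontr)
      assume *: "\<not> ?thesis"
      have "a \<otimes> r \<otimes> a \<in> JR" if "r \<in> carrier R" for r
        using * left_idealD(4)[OF L(1) that a(1)] LC[OF a(1)] that by (simp add: m_assoc)
      then show False using jacobson_semiprime a LC by blast
    qed
    then show thesis using that a by blast
  qed
  note [simp] = LC[OF a(1)] LC[OF a(2)]
  have aJ: "a \<notin> JR" using a left_idealD(4)[OF left_ideal_jacobson] LC by blast
  have "(\<lambda>y. y \<otimes> a) ` L = L"
    using a left_idealD(4)[OF L(1)] LC by (intro min left_ideal_mult_right L) auto
  then obtain c where c: "c \<in> L" "a = c \<otimes> a" using a(1) by blast
  note [simp] = LC[OF c(1)]
  have ca: "c \<otimes> a = a" using c by simp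
  have "{y \<in> L. y \<otimes> a = \<zero>} \<subseteq> JR"
  proof (rule ccontr)
    assume "\<not> {y \<in> L. y \<otimes> a = \<zero>} \<subseteq> JR"
    moreover have "left_ideal R {y \<in> L. y \<otimes> a = \<zero>}"
      by (rule left_idealI) (use LC left_idealD[OF L(1)] in \<open>auto simp: l_distr m_assoc\<close>)
    ultimately have "{y \<in> L. y \<otimes> a = \<zero>} = L" by (intro min) auto
    then show False using a J0 by force
  qed
  moreover have "c \<otimes> (\<one> \<ominus> c) \<in> L"
    using left_ideal_minus[OF L(1) c(1) left_idealD(4)[OF L(1) _ c(1), of c]]
    by (simp add: r_distr_minus)
  moreover have "c \<otimes> (\<one> \<ominus> c) \<otimes> a = \<zero>"
    by (simp add: m_assoc l_distr_minus ca)
  ultimately have nJ: "c \<otimes> (\<one> \<ominus> c) \<in> JR" by blast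
  define v where "v = \<one> \<ominus> c"
  have v[simp]: "v \<in> carrier R" by (simp add: v_def)
  obtain k where k: "products R JR k \<subseteq> {\<zero>}" using jacobson_nilpotent[OF dcc] by blast
  have "(c \<otimes> v) [^] k = \<zero>"
    using k nat_pow_products[of JR "c \<otimes> v" k] nJ jacobson_carrier by (auto simp: v_def)
  moreover have "c \<otimes> v = v \<otimes> c" by (simp add: v_def r_distr_minus l_distr_minus)
  ultimately have cv: "c [^] k \<otimes> v [^] k = \<zero>" using pow_mult_distrib[of c v k] by simp
  have Lc: "(\<lambda>y. y \<otimes> c) ` L = L"
  proof (intro min left_ideal_mult_right L)
    show "(\<lambda>y. y \<otimes> c) ` L \<subseteq> L" using left_idealD(4)[OF L(1) LC c(1)] by blast
    show "\<not> (\<lambda>y. y \<otimes> c) ` L \<subseteq> JR"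
    proof
      assume "(\<lambda>y. y \<otimes> c) ` L \<subseteq> JR"
      then have "c \<otimes> c \<otimes> a \<in> JR" using imageI[OF c(1), of "\<lambda>y. y \<otimes> c"]
        by (intro jacobson_right[of "c \<otimes> c"]) auto
      then show False using aJ by (simp add: m_assoc ca)
    qed
  qed simp
  have Lck: "\<exists>z\<in>L. y = z \<otimes> c [^] i" if "y \<in> L" for y and i :: nat
    using that
  proof (induction i arbitrary: y)
    case 0
    then show ?case using LC by force
  next
    case (Suc i)
    then obtain z where z: "z \<in> L" "y = z \<otimes> c" using Lc by blast
    from Suc.IH[OF z(1)] obtain w where "w \<in> L" "z = w \<otimes> c [^] i" by blast
    then show ?case using z LC by (intro bexI[of _ w]) (auto simp: m_assoc)
  qed
  \<comment> \<open>From \<open>yc = 0\<close> follows \<open>yv = y\<close>, so \<open>y\<close>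
    survives every power of \<open>v\<close>. But \<open>y\<close> is also some \<open>zc^k\<close>,
    and \<open>c^k v^k = (cv)^k = 0\<close>.\<close>
  have inj: "y = \<zero>" if y: "y \<in> L" "y \<otimes> c = \<zero>" for y
  proof -
    have [simp]: "y \<in> carrier R" using LC y by blast
    have yv: "y \<otimes> v = y" by (simp add: v_def r_distr_minus y)
    have "y \<otimes> v [^] i = y" for i :: nat
      by (induction i) (simp_all add: yv m_assoc[symmetric])
    then have "y = y \<otimes> v [^] k" by simp
    moreover obtain z where z: "z \<in> L" "y = z \<otimes> c [^] k" using Lck[OF y(1)] by blast
    ultimately have "y = z \<otimes> c [^] k \<otimes> v [^] k" by simp
    then show ?thesis using LC[OF z(1)] cv by (simp add: m_assoc)
  qed
  obtain e where e: "e \<in> L" "c = e \<otimes> c" using Lc c(1) by blast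
  note [simp] = LC[OF e(1)]
  have "e \<otimes> e \<ominus> e = \<zero>"
  proof (rule inj)
    show "e \<otimes> e \<ominus> e \<in> L"
      by (intro left_ideal_minus L e(1) left_idealD(4)[OF L(1)]) simp
    have "(e \<otimes> e \<ominus> e) \<otimes> c = e \<otimes> (e \<otimes> c) \<ominus> e \<otimes> c" by (simp add: l_distr_minus m_assoc)
    then show "(e \<otimes> e \<ominus> e) \<otimes> c = \<zero>" using e(2) by simp
  qed
  then have "e \<otimes> e = e" using minus_eq_zeroD[of "e \<otimes> e" e] by simp
  moreover have "e \<notin> JR"
    using aJ ca e(2) jacobson_right[of e c] jacobson_right[of c a] by auto
  ultimately show ?thesis using e by blast
qed

text \<open>A left ideal \<open>L\<close> minimal among those inside \<open>Rg\<close> but not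
  inside the radical contains an idempotent, and by minimality each of its nonradical elements
  generates it, which is locality.\<close>

lemma local_idempotent_below:
  assumes dcc: "left_dcc R" and g: "g \<in> carrier R" "g \<otimes> g = g" "g \<noteq> \<zero>"
  shows "\<exists>f. local_idempotent R JR f \<and> f \<otimes> g = f \<and> g \<otimes> f = f"
proof -
  let ?Rg = "(\<lambda>y. y \<otimes> g) ` carrier R"
  have "g \<notin> JR" using jacobson_quasi_regular[of g g] g by auto
  moreover have "g \<in> ?Rg" using g by force
  ultimately have "\<not> ?Rg \<subseteq> JR" by blast
  define P where "P L \<longleftrightarrow> L \<subseteq> ?Rg \<and> \<not> L \<subseteq> JR" for L
  have "P ?Rg" using \<open>\<not> ?Rg \<subseteq> JR\<close> by (simp add: P_def)
  from left_dcc_minimal[where P = P, OF dcc this left_ideal_mult_right[OF left_ideal_carrier g(1)]]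
  obtain L where L0: "left_ideal R L" "P L"
    and min: "\<And>L'. \<lbrakk>left_ideal R L'; P L'; L' \<subseteq> L\<rbrakk> \<Longrightarrow> L' = L"
    by blast
  then have L: "left_ideal R L" "L \<subseteq> ?Rg" "\<not> L \<subseteq> JR" by (simp_all add: P_def)
  have min': "L' = L" if "left_ideal R L'" "L' \<subseteq> L" "\<not> L' \<subseteq> JR" for L'
  proof (rule min[OF that(1) _ that(2)])
    show "P L'" using that(2,3) L(2) by (auto simp: P_def)
  qed
  obtain f' where f': "f' \<in> L" "f' \<otimes> f' = f'" "f' \<notin> JR"
    using minimal_nonradical_idempotent[OF dcc L(1,3) min'] by blast
  have fc[simp]: "f' \<in> carrier R" using left_idealD(1)[OF L(1) f'(1)] .
  have f'g: "f' \<otimes> g = f'"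
  proof -
    obtain y where "y \<in> carrier R" "f' = y \<otimes> g" using f'(1) L(2) by blast
    then show ?thesis using g by (simp add: m_assoc)
  qed
  \<comment> \<open>\<open>g\<close> fixes \<open>f'\<close> only from the right; multiplication by
    \<open>g\<close> from the left moves the idempotent into \<open>gRg\<close>. It stays outside
    the radical because \<open>f' \<otimes> f = f'\<close>.\<close>
  define f where "f = g \<otimes> f'"
  have fcarr[simp]: "f \<in> carrier R" using g by (simp add: f_def)
  have ff: "f \<otimes> f = f"
    using g f'(2) f'g by (metis f_def fc m_assoc m_closed)
  have fg: "f \<otimes> g = f" "g \<otimes> f = f"
    using g f'g by (simp_all add: f_def m_assoc) (simp add: g m_assoc[symmetric])
  have fL: "f \<in> L" unfolding f_def by (rule left_idealD(4)[OF L(1) g(1) f'(1)])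
  have "f' \<otimes> f = f'" using f'g f'(2) g by (simp add: f_def m_assoc[symmetric])
  then have fJ: "f \<notin> JR" using f'(3) left_idealD(4)[OF left_ideal_jacobson fc] by metis
  have "local_idempotent R JR f"
  proof (rule local_idempotentI[OF refl fcarr ff fJ])
    fix x assume x: "x \<in> carrier R" "x \<otimes> f \<notin> JR"
    have "(\<lambda>y. y \<otimes> (x \<otimes> f)) ` carrier R = L"
    proof (rule min')
      show "(\<lambda>y. y \<otimes> (x \<otimes> f)) ` carrier R \<subseteq> L"
        using left_idealD(4)[OF L(1) _ fL] x by (auto simp: m_assoc[symmetric])
      have "x \<otimes> f \<in> (\<lambda>y. y \<otimes> (x \<otimes> f)) ` carrier R"
        using x by (intro image_eqI[of _ _ \<one>]) auto
      then show "\<not> (\<lambda>y. y \<otimes> (x \<otimes> f)) ` carrier R \<subseteq> JR" using x by blast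
    qed (use x in \<open>simp add: left_ideal_mult_right left_ideal_carrier\<close>)
    then show "\<exists>b\<in>carrier R. b \<otimes> (x \<otimes> f) = f" using fL by force
  qed
  then show ?thesis using fg by blast
qed

text \<open>Split a local idempotent \<open>f\<close> off \<open>g\<close>, leaving
  \<open>h = g - f\<close>. For a counterexample with \<open>Rg\<close> minimal, \<open>Rh\<close>
  is strictly smaller since it misses \<open>f\<close>, and a decomposition of \<open>h\<close>
  together with \<open>f\<close> decomposes \<open>g\<close>.\<close>

lemma idempotent_decomposition:
  assumes dcc: "left_dcc R" and g: "g \<in> carrier R" "g \<otimes> g = g"
  shows "\<exists>es. finite es \<and> (\<forall>e\<in>es. local_idempotent R JR e \<and> e \<otimes> g = e \<and> g \<otimes> e = e) \<and>
     (\<forall>e\<in>es. \<forall>f\<in>es. e \<noteq> f \<longrightarrow> e \<otimes> f = \<zero>) \<and> (\<Oplus>e\<in>es. e) = g"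
    (is "?Q g")
proof (rule ccontr)
  define P where "P L \<longleftrightarrow> (\<exists>g\<in>carrier R. g \<otimes> g = g \<and> \<not> ?Q g \<and> L = (\<lambda>y. y \<otimes> g) ` carrier R)" for L
  assume "\<not> ?Q g"
  then have "P ((\<lambda>y. y \<otimes> g) ` carrier R)" unfolding P_def using g by (intro bexI[of _ g]) simp_all
  from left_dcc_minimal[where P = P, OF dcc this left_ideal_mult_right[OF left_ideal_carrier g(1)]]
  obtain L where "P L" and min: "\<And>L'. \<lbrakk>left_ideal R L'; P L'; L' \<subseteq> L\<rbrakk> \<Longrightarrow> L' = L"
    by blast
  then obtain g where g[simp]: "g \<in> carrier R" and gg: "g \<otimes> g = g" and nQ: "\<not> ?Q g"
    and L: "L = (\<lambda>y. y \<otimes> g) ` carrier R" unfolding P_def by (elim bexE conjE)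
  have "?Q \<zero>" by (rule exI[of _ "{}"]) simp
  then have "g \<noteq> \<zero>" using nQ by blast
  then obtain f where f: "local_idempotent R JR f" and fg: "f \<otimes> g = f" "g \<otimes> f = f"
    using local_idempotent_below[OF dcc g gg] by blast
  have fc[simp]: "f \<in> carrier R" and ff: "f \<otimes> f = f" and fJ: "f \<notin> JR"
    using f by (auto simp: local_idempotent_def)
  have f0: "f \<noteq> \<zero>" using fJ left_idealD(2)[OF left_ideal_jacobson] by blast
  define h where "h = g \<ominus> f"
  have hc[simp]: "h \<in> carrier R" by (simp add: h_def)
  have fh: "f \<otimes> h = \<zero>" "h \<otimes> f = \<zero>"
    by (simp_all add: h_def r_distr_minus l_distr_minus fg ff)
  have hg: "h \<otimes> g = h" "g \<otimes> h = h"
    by (simp_all add: h_def r_distr_minus l_distr_minus fg gg)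
  have hh: "h \<otimes> h = h"
  proof -
    have "h \<otimes> h = g \<otimes> h \<ominus> f \<otimes> h" by (simp add: h_def l_distr_minus)
    then show ?thesis by (simp add: hg fh)
  qed
  have "?Q h"
  proof (rule ccontr)
    assume "\<not> ?Q h"
    then have "P ((\<lambda>y. y \<otimes> h) ` carrier R)" unfolding P_def using hc hh by (intro bexI[of _ h]) simp_all
    moreover have "(\<lambda>y. y \<otimes> h) ` carrier R \<subseteq> L"
    proof
      fix z assume "z \<in> (\<lambda>y. y \<otimes> h) ` carrier R"
      then obtain y where "y \<in> carrier R" "z = y \<otimes> h" by blast
      then show "z \<in> L" unfolding L using hg
        by (intro image_eqI[of _ _ "y \<otimes> h"]) (auto simp: m_assoc)
    qed
    ultimately have "(\<lambda>y. y \<otimes> h) ` carrier R = L"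
      by (intro min left_ideal_mult_right left_ideal_carrier hc)
    moreover have "f \<in> L" unfolding L by (rule image_eqI[of _ _ f]) (simp_all add: fg)
    ultimately have "f \<in> (\<lambda>y. y \<otimes> h) ` carrier R" by simp
    then obtain r where r: "r \<in> carrier R" "f = r \<otimes> h" by blast
    then have "f = f \<otimes> h" using hh by (simp add: m_assoc)
    then show False using fh f0 by simp
  qed
  then obtain es where es: "finite es"
    "\<And>e. e \<in> es \<Longrightarrow> local_idempotent R JR e" "\<And>e. e \<in> es \<Longrightarrow> e \<otimes> h = e"
    "\<And>e. e \<in> es \<Longrightarrow> h \<otimes> e = e"
    "\<And>e e'. e \<in> es \<Longrightarrow> e' \<in> es \<Longrightarrow> e \<noteq> e' \<Longrightarrow> e \<otimes> e' = \<zero>" "(\<Oplus>e\<in>es. e) = h" by blast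
  have ec: "\<And>e. e \<in> es \<Longrightarrow> e \<in> carrier R" using es(2) by (simp add: local_idempotent_def)
  have ef: "e \<otimes> f = \<zero>" if "e \<in> es" for e
  proof -
    have "e \<otimes> f = e \<otimes> h \<otimes> f" using es(3)[OF that] by simp
    also have "\<dots> = \<zero>" using ec[OF that] by (simp add: m_assoc fh)
    finally show ?thesis .
  qed
  have fe: "f \<otimes> e = \<zero>" if "e \<in> es" for e
  proof -
    have "f \<otimes> e = f \<otimes> (h \<otimes> e)" using es(4)[OF that] by simp
    also have "\<dots> = \<zero>" using ec[OF that] by (simp add: m_assoc[symmetric] fh)
    finally show ?thesis .
  qed
  have eg: "e \<otimes> g = e" if "e \<in> es" for e
    using ec[OF that] es(3)[OF that] hg(1) by (metis g hc m_assoc)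
  have ge: "g \<otimes> e = e" if "e \<in> es" for e
    using ec[OF that] es(4)[OF that] hg(2) by (metis g hc m_assoc)
  have "f \<notin> es" using es(3) fh f0 by auto
  moreover have "(\<lambda>x. x) \<in> es \<rightarrow> carrier R" using ec by blast
  ultimately have "(\<Oplus>e\<in>insert f es. e) = f \<oplus> h" using es(1,6) by simp
  also have "\<dots> = g" using a_lcomm[of f g "\<ominus> f"] by (simp add: h_def a_minus_def r_neg)
  finally have "?Q g"
    using es f fg ef fe eg ge by (intro exI[of _ "insert f es"]) auto
  then show False using nQ by blast
qed

lemma semiprimary_if_left_dcc:
  assumes "left_dcc R"
  shows "\<exists>es. semiprimary R JR es"
proof -
  obtain es where es: "finite es" "\<forall>e\<in>es. local_idempotent R JR e"
    "\<forall>e\<in>es. \<forall>f\<in>es. e \<noteq> f \<longrightarrow> e \<otimes> f = \<zero>" "(\<Oplus>e\<in>es. e) = \<one>"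
    using idempotent_decomposition[OF assms one_closed] by auto
  have "semiprimary R JR es"
    by (intro semiprimary.intro semiprimary_axioms.intro ring_axioms)
      (use es left_ideal_jacobson jacobson_right jacobson_nilpotent[OF assms] in auto)
  then show ?thesis by blast
qed

end

lemma semiprimary_if_artinian:
  assumes R: "ring R" and "right_artinian R \<or> left_artinian R"
  obtains J es where "semiprimary R J es"
proof (cases "left_artinian R")
  case True
  then show thesis
    using that ring.semiprimary_if_left_dcc[OF R] left_artinian_iff_dcc[OF R] by blast
next
  case False
  then have "left_dcc (opposite_ring R)"
    using assms left_artinian_iff_dcc[OF ring_opposite[OF R]]
    by (simp add: right_artinian_def left_artinian_def)
  then show thesis
    using that ring.semiprimary_if_left_dcc[OF ring_opposite[OF R]] semiprimary_opposite[OF R] by blast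
qed

section \<open>Partial homomorphisms and Baer's criterion\<close>

text \<open>The graph of a homomorphism into \<open>Q\<close> from a submodule of \<open>B\<close>.
  Single-valuedness is stated at zero and spreads by subtraction. Inclusion of graphs is extension
  of homomorphisms, as Zorn's lemma requires.\<close>

definition partial_hom ::
  "('a, 'r) ring_scheme \<Rightarrow> ('a, 'b, 'm) module_scheme \<Rightarrow> ('a, 'c, 'n) module_scheme \<Rightarrow> ('b \<times> 'c) set \<Rightarrow> bool"
  where
  "partial_hom R B Q G \<longleftrightarrow> G \<subseteq> carrier B \<times> carrier Q \<and> (\<zero>\<^bsub>B\<^esub>, \<zero>\<^bsub>Q\<^esub>) \<in> G \<and>
     (\<forall>x y x' y'. (x, y) \<in> G \<longrightarrow> (x', y') \<in> G \<longrightarrow> (x \<oplus>\<^bsub>B\<^esub> x', y \<oplus>\<^bsub>Q\<^esub> y') \<in> G) \<and>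
     (\<forall>a\<in>carrier R. \<forall>x y. (x, y) \<in> G \<longrightarrow> (a \<odot>\<^bsub>B\<^esub> x, a \<odot>\<^bsub>Q\<^esub> y) \<in> G) \<and>
     (\<forall>y. (\<zero>\<^bsub>B\<^esub>, y) \<in> G \<longrightarrow> y = \<zero>\<^bsub>Q\<^esub>)"

lemma partial_homI:
  assumes "G \<subseteq> carrier B \<times> carrier Q" "(\<zero>\<^bsub>B\<^esub>, \<zero>\<^bsub>Q\<^esub>) \<in> G"
    "\<And>x y x' y'. \<lbrakk>(x, y) \<in> G; (x', y') \<in> G\<rbrakk> \<Longrightarrow> (x \<oplus>\<^bsub>B\<^esub> x', y \<oplus>\<^bsub>Q\<^esub> y') \<in> G"
    "\<And>a x y. \<lbrakk>a \<in> carrier R; (x, y) \<in> G\<rbrakk> \<Longrightarrow> (a \<odot>\<^bsub>B\<^esub> x, a \<odot>\<^bsub>Q\<^esub> y) \<in> G"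
    "\<And>y. (\<zero>\<^bsub>B\<^esub>, y) \<in> G \<Longrightarrow> y = \<zero>\<^bsub>Q\<^esub>"
  shows "partial_hom R B Q G"
  using assms unfolding partial_hom_def by blast

lemma partial_homD:
  assumes "partial_hom R B Q G"
  shows "(x, y) \<in> G \<Longrightarrow> x \<in> carrier B" "(x, y) \<in> G \<Longrightarrow> y \<in> carrier Q"
    "(\<zero>\<^bsub>B\<^esub>, \<zero>\<^bsub>Q\<^esub>) \<in> G"
    "\<lbrakk>(x, y) \<in> G; (x', y') \<in> G\<rbrakk> \<Longrightarrow> (x \<oplus>\<^bsub>B\<^esub> x', y \<oplus>\<^bsub>Q\<^esub> y') \<in> G"
    "\<lbrakk>a \<in> carrier R; (x, y) \<in> G\<rbrakk> \<Longrightarrow> (a \<odot>\<^bsub>B\<^esub> x, a \<odot>\<^bsub>Q\<^esub> y) \<in> G"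
    "(\<zero>\<^bsub>B\<^esub>, y) \<in> G \<Longrightarrow> y = \<zero>\<^bsub>Q\<^esub>"
  using assms unfolding partial_hom_def by blast+

lemma partial_hom_uminus:
  assumes B: "left_module R B" and Q: "left_module R Q" and G: "partial_hom R B Q G" "(x, y) \<in> G"
  shows "(\<ominus>\<^bsub>B\<^esub> x, \<ominus>\<^bsub>Q\<^esub> y) \<in> G"
proof -
  interpret B: left_module R B by fact
  interpret Q: left_module R Q by fact
  show ?thesis
    using partial_homD(5)[OF G(1), of "\<ominus>\<^bsub>R\<^esub> \<one>\<^bsub>R\<^esub>", OF _ G(2)] partial_homD(1,2)[OF G]
    by (simp add: B.smult_minus_one Q.smult_minus_one)
qed

lemma partial_hom_unique:
  assumes B: "left_module R B" and Q: "left_module R Q" and G: "partial_hom R B Q G"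
    and xy: "(x, y) \<in> G" "(x, y') \<in> G"
  shows "y = y'"
proof -
  interpret B: left_module R B by fact
  interpret Q: left_module R Q by fact
  have "(x \<oplus>\<^bsub>B\<^esub> \<ominus>\<^bsub>B\<^esub> x, y \<oplus>\<^bsub>Q\<^esub> \<ominus>\<^bsub>Q\<^esub> y') \<in> G"
    by (intro partial_homD(4)[OF G] xy partial_hom_uminus[OF B Q G])
  then have "y \<oplus>\<^bsub>Q\<^esub> \<ominus>\<^bsub>Q\<^esub> y' = \<zero>\<^bsub>Q\<^esub>"
    using partial_homD(6)[OF G] partial_homD(1)[OF G xy(1)] by (simp add: B.M.r_neg)
  then show ?thesis
    using partial_homD(2)[OF G] xy by (simp add: Q.M.add.inv_solve_right')
qed

lemma partial_hom_function:
  assumes B: "left_module R B" and Q: "left_module R Q" and G: "partial_hom R B Q G"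
  obtains f where "left_module R (B\<lparr>carrier := Domain G\<rparr>)"
    "f \<in> module_hom R (B\<lparr>carrier := Domain G\<rparr>) Q" "\<And>x y. (x, y) \<in> G \<Longrightarrow> f x = y"
proof -
  interpret B: left_module R B by fact
  note D = partial_homD[OF G]
  have "submodule (Domain G) R B"
    by (rule B.left_submoduleI) (use D in blast)+
  then have dom: "left_module R (B\<lparr>carrier := Domain G\<rparr>)" by (rule B.left_module_submodule)
  define f where "f x = (THE y. (x, y) \<in> G)" for x
  have f: "f x = y" if "(x, y) \<in> G" for x y
    unfolding f_def using that partial_hom_unique[OF B Q G] by blast
  have "f \<in> module_hom R (B\<lparr>carrier := Domain G\<rparr>) Q"
    unfolding module_hom_def
  proof (intro CollectI conjI ballI)
    show "f \<in> carrier (B\<lparr>carrier := Domain G\<rparr>) \<rightarrow> carrier Q" using f D(2) by auto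
  next
    fix x x' assume "x \<in> carrier (B\<lparr>carrier := Domain G\<rparr>)" "x' \<in> carrier (B\<lparr>carrier := Domain G\<rparr>)"
    then obtain y y' where "(x, y) \<in> G" "(x', y') \<in> G" by auto
    then show "f (x \<oplus>\<^bsub>B\<lparr>carrier := Domain G\<rparr>\<^esub> x') = f x \<oplus>\<^bsub>Q\<^esub> f x'"
      using f D(4) by simp
  next
    fix a x assume "a \<in> carrier R" "x \<in> carrier (B\<lparr>carrier := Domain G\<rparr>)"
    then obtain y where "a \<in> carrier R" "(x, y) \<in> G" by auto
    then show "f (a \<odot>\<^bsub>B\<lparr>carrier := Domain G\<rparr>\<^esub> x) = a \<odot>\<^bsub>Q\<^esub> f x"
      using f D(5) by simp
  qed
  then show thesis using that dom f by blast
qed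

lemma injective_partial_hom:
  assumes inj: "injective_module R Q" and B: "left_module R B" and G: "partial_hom R B Q G"
  shows "\<exists>g\<in>module_hom R B Q. \<forall>x y. (x, y) \<in> G \<longrightarrow> g x = y"
proof -
  have Q: "left_module R Q" using inj by (simp add: injective_module_def)
  obtain f where dom: "left_module R (B\<lparr>carrier := Domain G\<rparr>)"
    and f: "f \<in> module_hom R (B\<lparr>carrier := Domain G\<rparr>) Q" "\<And>x y. (x, y) \<in> G \<Longrightarrow> f x = y"
    using partial_hom_function[OF B Q G] by blast
  have "(\<lambda>x. x) \<in> module_mono R (B\<lparr>carrier := Domain G\<rparr>) B"
    using partial_homD(1)[OF G] by (auto simp: module_mono_def module_hom_def)
  from bspec[OF bspec[OF injective_module_extension[OF inj dom B, unfolded extension_property_def]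
    this] f(1)]
  obtain g where "g \<in> module_hom R B Q" "\<forall>x\<in>carrier (B\<lparr>carrier := Domain G\<rparr>). g x = f x"
    by blast
  then show ?thesis using f(2) by (intro bexI[of _ g]) auto
qed

lemma partial_hom_maximal:
  assumes G: "partial_hom R B Q G"
  obtains H where "partial_hom R B Q H" "G \<subseteq> H"
    "\<And>H'. \<lbrakk>partial_hom R B Q H'; H \<subseteq> H'\<rbrakk> \<Longrightarrow> H' = H"
proof -
  let ?F = "{H. partial_hom R B Q H \<and> G \<subseteq> H}"
  have "\<exists>M\<in>?F. \<forall>X\<in>?F. M \<subseteq> X \<longrightarrow> X = M"
  proof (rule subset_Zorn_nonempty)
    show "?F \<noteq> {}" using G by blast
    fix C assume C: "C \<noteq> {}" "subset.chain ?F C"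
    have CF: "C \<subseteq> ?F" using C by (simp add: subset.chain_def)
    have lin: "Y \<subseteq> Z \<or> Z \<subseteq> Y" if "Y \<in> C" "Z \<in> C" for Y Z
      using C(2) that by (auto simp: subset_chain_def)
    have CP: "partial_hom R B Q Y" if "Y \<in> C" for Y using CF that by blast
    obtain X where X: "X \<in> C" using C(1) by blast
    have "partial_hom R B Q (\<Union>C)"
    proof (rule partial_homI)
      show "\<Union>C \<subseteq> carrier B \<times> carrier Q" using partial_homD(1,2)[OF CP] by auto
      show "(\<zero>\<^bsub>B\<^esub>, \<zero>\<^bsub>Q\<^esub>) \<in> \<Union>C" using partial_homD(3)[OF CP[OF X]] X by blast
      fix x y x' y' assume "(x, y) \<in> \<Union>C" "(x', y') \<in> \<Union>C"
      then obtain Y Z where "Y \<in> C" "Z \<in> C" "(x, y) \<in> Y" "(x', y') \<in> Z" by blast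
      then obtain Z where "Z \<in> C" "(x, y) \<in> Z" "(x', y') \<in> Z" using lin[of Y Z] by blast
      then show "(x \<oplus>\<^bsub>B\<^esub> x', y \<oplus>\<^bsub>Q\<^esub> y') \<in> \<Union>C" using partial_homD(4)[OF CP] by blast
    next
      fix a x y assume "a \<in> carrier R" "(x, y) \<in> \<Union>C"
      then show "(a \<odot>\<^bsub>B\<^esub> x, a \<odot>\<^bsub>Q\<^esub> y) \<in> \<Union>C" using partial_homD(5)[OF CP] by blast
    next
      fix y assume "(\<zero>\<^bsub>B\<^esub>, y) \<in> \<Union>C"
      then show "y = \<zero>\<^bsub>Q\<^esub>" using partial_homD(6)[OF CP] by blast
    qed
    then show "\<Union>C \<in> ?F" using CF X by blast
  qed
  then obtain M where M: "M \<in> ?F" "\<forall>Y\<in>?F. M \<subseteq> Y \<longrightarrow> Y = M" ..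
  show thesis
  proof (rule that[of M])
    fix H' assume "partial_hom R B Q H'" "M \<subseteq> H'"
    then have "H' \<in> ?F" using M(1) by auto
    then show "H' = M" using M(2) \<open>M \<subseteq> H'\<close> by simp
  qed (use M(1) in simp_all)
qed

text \<open>For a maximal partial extension \<open>H\<close> and \<open>b\<close> in
  \<open>B\<close>, the elements \<open>r\<close> with \<open>rb\<close> in the domain of
  \<open>H\<close> form a left ideal. The homomorphism \<open>r \<mapsto> H(rb)\<close> on it is
  given by some \<open>q\<close>, and \<open>b \<mapsto> q\<close> extends \<open>H\<close>
  consistently, so \<open>b\<close> was in the domain already.\<close>

lemma baer_criterion:
  fixes R :: "('a, 'r) ring_scheme" and Q :: "('a, 'q, 'k) module_scheme"
  assumes Q: "left_module R Q"
    and ideals: "\<And>G. partial_hom R (regular_module R) Q G \<Longrightarrow>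
      \<exists>q\<in>carrier Q. \<forall>r y. (r, y) \<in> G \<longrightarrow> y = r \<odot>\<^bsub>Q\<^esub> q"
  shows "injective_module R Q"
  unfolding injective_module_def extension_property_def
proof (intro conjI allI impI ballI Q)
  fix A B :: "('a, 'a) module" and i f
  assume A: "left_module R A" and B: "left_module R B" and i: "i \<in> module_mono R A B"
    and f: "f \<in> module_hom R A Q"
  interpret A: left_module R A by fact
  interpret B: left_module R B by fact
  interpret Q: left_module R Q by fact
  have ih: "i \<in> module_hom R A B" and ii: "inj_on i (carrier A)"
    using i by (auto simp: module_mono_def)
  note iD = module_homD[OF ih] and fD = module_homD[OF f]
  note z = module_hom_zero[OF A B ih] module_hom_zero[OF A Q f]
  have "partial_hom R B Q {(i x, f x) | x. x \<in> carrier A}"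
  proof (rule partial_homI)
    show "(\<zero>\<^bsub>B\<^esub>, \<zero>\<^bsub>Q\<^esub>) \<in> {(i x, f x) | x. x \<in> carrier A}" using z by force
  next
    fix x y x' y' assume "(x, y) \<in> {(i x, f x) | x. x \<in> carrier A}" "(x', y') \<in> {(i x, f x) | x. x \<in> carrier A}"
    then obtain u v where "u \<in> carrier A" "v \<in> carrier A" "x = i u" "y = f u" "x' = i v" "y' = f v"
      by blast
    then show "(x \<oplus>\<^bsub>B\<^esub> x', y \<oplus>\<^bsub>Q\<^esub> y') \<in> {(i x, f x) | x. x \<in> carrier A}"
      by (intro CollectI exI[of _ "u \<oplus>\<^bsub>A\<^esub> v"]) (simp add: iD fD)
  next
    fix a x y assume "a \<in> carrier R" "(x, y) \<in> {(i x, f x) | x. x \<in> carrier A}"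
    then obtain u where "u \<in> carrier A" "x = i u" "y = f u" by blast
    then show "(a \<odot>\<^bsub>B\<^esub> x, a \<odot>\<^bsub>Q\<^esub> y) \<in> {(i x, f x) | x. x \<in> carrier A}"
      using \<open>a \<in> carrier R\<close> by (intro CollectI exI[of _ "a \<odot>\<^bsub>A\<^esub> u"]) (simp add: iD fD)
  next
    fix y assume "(\<zero>\<^bsub>B\<^esub>, y) \<in> {(i x, f x) | x. x \<in> carrier A}"
    then obtain u where "u \<in> carrier A" "i u = \<zero>\<^bsub>B\<^esub>" "y = f u" by auto
    then show "y = \<zero>\<^bsub>Q\<^esub>" using ii z by (metis A.M.zero_closed inj_onD)
  qed (use iD fD in auto)
  then obtain H where H: "partial_hom R B Q H" and GH: "{(i x, f x) | x. x \<in> carrier A} \<subseteq> H"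
    and max: "\<And>H'. \<lbrakk>partial_hom R B Q H'; H \<subseteq> H'\<rbrakk> \<Longrightarrow> H' = H"
    using partial_hom_maximal by blast
  note HD = partial_homD[OF H]
  have dom: "b \<in> Domain H" if b: "b \<in> carrier B" for b
  proof -
    define I where "I = {(r, y). r \<in> carrier R \<and> (r \<odot>\<^bsub>B\<^esub> b, y) \<in> H}"
    have "partial_hom R (regular_module R) Q I"
    proof (rule partial_homI)
      fix r y s y' assume "(r, y) \<in> I" "(s, y') \<in> I"
      then show "(r \<oplus>\<^bsub>regular_module R\<^esub> s, y \<oplus>\<^bsub>Q\<^esub> y') \<in> I"
        using HD(4)[of "r \<odot>\<^bsub>B\<^esub> b" y "s \<odot>\<^bsub>B\<^esub> b" y'] b by (simp add: I_def B.smult_l_distr)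
    next
      fix a r y assume "a \<in> carrier R" "(r, y) \<in> I"
      then show "(a \<odot>\<^bsub>regular_module R\<^esub> r, a \<odot>\<^bsub>Q\<^esub> y) \<in> I"
        using HD(5)[of a "r \<odot>\<^bsub>B\<^esub> b" y] b by (simp add: I_def B.smult_assoc1)
    next
      show "I \<subseteq> carrier (regular_module R) \<times> carrier Q" using HD(2) by (auto simp: I_def)
      show "(\<zero>\<^bsub>regular_module R\<^esub>, \<zero>\<^bsub>Q\<^esub>) \<in> I" using HD(3) b by (simp add: I_def)
      show "y = \<zero>\<^bsub>Q\<^esub>" if "(\<zero>\<^bsub>regular_module R\<^esub>, y) \<in> I" for y
        using HD(6)[of y] that b by (simp add: I_def)
    qed
    then obtain q where q: "q \<in> carrier Q" and Iq: "\<And>r y. (r, y) \<in> I \<Longrightarrow> y = r \<odot>\<^bsub>Q\<^esub> q"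
      using ideals by blast
    define H' where "H' = {(x \<oplus>\<^bsub>B\<^esub> r \<odot>\<^bsub>B\<^esub> b, y \<oplus>\<^bsub>Q\<^esub> r \<odot>\<^bsub>Q\<^esub> q) | x y r. (x, y) \<in> H \<and> r \<in> carrier R}"
    have H'I: "(x', y') \<in> H'" if "(x, y) \<in> H" "r \<in> carrier R" "x' = x \<oplus>\<^bsub>B\<^esub> r \<odot>\<^bsub>B\<^esub> b"
      "y' = y \<oplus>\<^bsub>Q\<^esub> r \<odot>\<^bsub>Q\<^esub> q" for x y r x' y'
      using that unfolding H'_def by blast
    have "H \<subseteq> H'"
      using HD(1,2) b q by (auto intro!: H'I[of _ _ "\<zero>\<^bsub>R\<^esub>"])
    moreover have "partial_hom R B Q H'"
    proof (rule partial_homI)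
      show "H' \<subseteq> carrier B \<times> carrier Q" unfolding H'_def using HD(1,2) b q by auto
      show "(\<zero>\<^bsub>B\<^esub>, \<zero>\<^bsub>Q\<^esub>) \<in> H'" using HD(3) \<open>H \<subseteq> H'\<close> by blast
    next
      fix x y x' y' assume "(x, y) \<in> H'" "(x', y') \<in> H'"
      then obtain u v r u' v' r' where *: "(u, v) \<in> H" "(u', v') \<in> H" "r \<in> carrier R" "r' \<in> carrier R"
        "x = u \<oplus>\<^bsub>B\<^esub> r \<odot>\<^bsub>B\<^esub> b" "y = v \<oplus>\<^bsub>Q\<^esub> r \<odot>\<^bsub>Q\<^esub> q"
        "x' = u' \<oplus>\<^bsub>B\<^esub> r' \<odot>\<^bsub>B\<^esub> b" "y' = v' \<oplus>\<^bsub>Q\<^esub> r' \<odot>\<^bsub>Q\<^esub> q"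
        unfolding H'_def by blast
      show "(x \<oplus>\<^bsub>B\<^esub> x', y \<oplus>\<^bsub>Q\<^esub> y') \<in> H'"
        by (rule H'I[OF HD(4)[OF *(1,2)], of "r \<oplus>\<^bsub>R\<^esub> r'"])
          (use * HD(1,2)[OF *(1)] HD(1,2)[OF *(2)] b q in
            \<open>auto simp: B.smult_l_distr Q.smult_l_distr B.M.a_ac Q.M.a_ac\<close>)
    next
      fix a x y assume a: "a \<in> carrier R" and "(x, y) \<in> H'"
      then obtain u v r where *: "(u, v) \<in> H" "r \<in> carrier R"
        "x = u \<oplus>\<^bsub>B\<^esub> r \<odot>\<^bsub>B\<^esub> b" "y = v \<oplus>\<^bsub>Q\<^esub> r \<odot>\<^bsub>Q\<^esub> q"
        unfolding H'_def by blast
      show "(a \<odot>\<^bsub>B\<^esub> x, a \<odot>\<^bsub>Q\<^esub> y) \<in> H'"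
        by (rule H'I[OF HD(5)[OF a *(1)], of "a \<otimes>\<^bsub>R\<^esub> r"])
          (use * a HD(1,2)[OF *(1)] b q in
            \<open>auto simp: B.smult_r_distr Q.smult_r_distr B.smult_assoc1 Q.smult_assoc1\<close>)
    next
      fix y assume "(\<zero>\<^bsub>B\<^esub>, y) \<in> H'"
      then obtain u v r where *: "(u, v) \<in> H" "r \<in> carrier R"
        "\<zero>\<^bsub>B\<^esub> = u \<oplus>\<^bsub>B\<^esub> r \<odot>\<^bsub>B\<^esub> b" "y = v \<oplus>\<^bsub>Q\<^esub> r \<odot>\<^bsub>Q\<^esub> q"
        unfolding H'_def by blast
      have uv: "u \<in> carrier B" "v \<in> carrier Q" using HD(1,2)[OF *(1)] by auto
      have "r \<odot>\<^bsub>B\<^esub> b = \<ominus>\<^bsub>B\<^esub> u"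
        using *(2,3) uv b by (metis B.M.a_comm B.M.minus_equality B.smult_closed)
      then have "(r \<odot>\<^bsub>B\<^esub> b, \<ominus>\<^bsub>Q\<^esub> v) \<in> H" using partial_hom_uminus[OF B Q H *(1)] by simp
      then have "\<ominus>\<^bsub>Q\<^esub> v = r \<odot>\<^bsub>Q\<^esub> q" using Iq *(2) by (simp add: I_def)
      then show "y = \<zero>\<^bsub>Q\<^esub>" using *(4) uv by (metis Q.M.r_neg)
    qed
    ultimately have "H' = H" using max by blast
    moreover have "(b, q) \<in> H'"
      by (rule H'I[OF HD(3) A.R.one_closed]) (use b q in auto)
    ultimately show ?thesis by blast
  qed
  have "Domain H = carrier B" using dom HD(1) by blast
  moreover obtain g where "g \<in> module_hom R (B\<lparr>carrier := Domain H\<rparr>) Q" "\<And>x y. (x, y) \<in> H \<Longrightarrow> g x = y"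
    using partial_hom_function[OF B Q H] by blast
  ultimately show "\<exists>g\<in>module_hom R B Q. \<forall>x\<in>carrier A. g (i x) = f x"
    using GH by (intro bexI[of _ g]) auto
qed

lemma partial_hom_regularD:
  assumes "partial_hom R (regular_module R) (regular_module R) G"
  shows "(x, y) \<in> G \<Longrightarrow> x \<in> carrier R" "(x, y) \<in> G \<Longrightarrow> y \<in> carrier R"
    "(\<zero>\<^bsub>R\<^esub>, \<zero>\<^bsub>R\<^esub>) \<in> G" "\<lbrakk>(x, y) \<in> G; (x', y') \<in> G\<rbrakk> \<Longrightarrow> (x \<oplus>\<^bsub>R\<^esub> x', y \<oplus>\<^bsub>R\<^esub> y') \<in> G"
    "\<lbrakk>a \<in> carrier R; (x, y) \<in> G\<rbrakk> \<Longrightarrow> (a \<otimes>\<^bsub>R\<^esub> x, a \<otimes>\<^bsub>R\<^esub> y) \<in> G" "(\<zero>\<^bsub>R\<^esub>, y) \<in> G \<Longrightarrow> y = \<zero>\<^bsub>R\<^esub>"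
  using partial_homD[OF assms] by simp_all

lemma partial_hom_regularI:
  assumes "\<And>x y. (x, y) \<in> G \<Longrightarrow> x \<in> carrier R \<and> y \<in> carrier R" "(\<zero>\<^bsub>R\<^esub>, \<zero>\<^bsub>R\<^esub>) \<in> G"
    "\<And>x y x' y'. \<lbrakk>(x, y) \<in> G; (x', y') \<in> G\<rbrakk> \<Longrightarrow> (x \<oplus>\<^bsub>R\<^esub> x', y \<oplus>\<^bsub>R\<^esub> y') \<in> G"
    "\<And>a x y. \<lbrakk>a \<in> carrier R; (x, y) \<in> G\<rbrakk> \<Longrightarrow> (a \<otimes>\<^bsub>R\<^esub> x, a \<otimes>\<^bsub>R\<^esub> y) \<in> G"
    "\<And>y. (\<zero>\<^bsub>R\<^esub>, y) \<in> G \<Longrightarrow> y = \<zero>\<^bsub>R\<^esub>"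
  shows "partial_hom R (regular_module R) (regular_module R) G"
  by (rule partial_homI) (use assms in auto)

section \<open>Automorphism-invariance of the regular module\<close>

definition essential_left_ideal :: "('a, 'r) ring_scheme \<Rightarrow> 'a set \<Rightarrow> bool" where
  "essential_left_ideal R D \<longleftrightarrow> left_ideal R D \<and>
     (\<forall>L. left_ideal R L \<longrightarrow> L \<inter> D = {\<zero>\<^bsub>R\<^esub>} \<longrightarrow> L = {\<zero>\<^bsub>R\<^esub>})"

context ring
begin

abbreviation span2 :: "'a \<Rightarrow> 'a \<Rightarrow> 'a set" where
  "span2 x y \<equiv> {a \<otimes> x \<oplus> b \<otimes> y | a b. a \<in> carrier R \<and> b \<in> carrier R}"

lemma span2_subset:
  assumes L: "left_ideal R L" "x \<in> L" "y \<in> L"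
  shows "span2 x y \<subseteq> L"
  using left_idealD(3,4)[OF L(1)] L by blast

lemma left_ideal_span2:
  assumes "x \<in> carrier R" "y \<in> carrier R"
  shows "left_ideal R (span2 x y)"
proof -
  have "span2 x y = {a \<otimes> x \<oplus> l | a l. a \<in> carrier R \<and> l \<in> (\<lambda>b. b \<otimes> y) ` carrier R}" by blast
  then show ?thesis
    using left_ideal_add_principal[OF left_ideal_mult_right[OF left_ideal_carrier assms(2)] assms(1)]
    by simp
qed

lemma span2I:
  assumes "x \<in> carrier R" "y \<in> carrier R" "a \<in> carrier R" "b \<in> carrier R" "z = a \<otimes> x \<oplus> b \<otimes> y"
  shows "z \<in> span2 x y"
  using assms by blast

end

locale automorphism_invariant_ring = ring R for R :: "('a, 'r) ring_scheme" (structure) +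
  fixes E :: "('a, 'e) module" and i :: "'a \<Rightarrow> 'e"
  assumes envelope: "injective_envelope R (regular_module R) E i"
    and invariant: "\<phi> \<in> module_aut R E \<Longrightarrow> \<phi> ` (i ` carrier R) \<subseteq> i ` carrier R"
begin

lemma E: "left_module R E" "injective_module R E"
  using envelope by (simp_all add: injective_envelope_def injective_module_def)

sublocale E: left_module R E by (rule E)

lemma i_hom: "i \<in> module_hom R (regular_module R) E"
  using envelope by (simp add: injective_envelope_def module_mono_def)

lemma i_inj: "\<lbrakk>i x = i y; x \<in> carrier R; y \<in> carrier R\<rbrakk> \<Longrightarrow> x = y"
  using envelope by (simp add: injective_envelope_def module_mono_def inj_on_def)

lemma i_closed [simp]: "x \<in> carrier R \<Longrightarrow> i x \<in> carrier E"
  and i_add: "\<lbrakk>x \<in> carrier R; y \<in> carrier R\<rbrakk> \<Longrightarrow> i (x \<oplus> y) = i x \<oplus>\<^bsub>E\<^esub> i y"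
  and i_mult: "\<lbrakk>a \<in> carrier R; x \<in> carrier R\<rbrakk> \<Longrightarrow> i (a \<otimes> x) = a \<odot>\<^bsub>E\<^esub> i x"
  using module_homD[OF i_hom] by simp_all

lemma i_zero [simp]: "i \<zero> = \<zero>\<^bsub>E\<^esub>"
  using module_hom_zero[OF left_module_regular[OF ring_axioms] E(1) i_hom] by simp

lemma i_essential:
  assumes "submodule K R E" "K \<noteq> {\<zero>\<^bsub>E\<^esub>}"
  shows "\<exists>x\<in>carrier R. x \<noteq> \<zero> \<and> i x \<in> K"
proof (rule ccontr)
  assume n: "\<not> ?thesis"
  interpret K: submodule K R E by fact
  have "\<zero>\<^bsub>E\<^esub> \<in> K" using K.one_closed by simp
  moreover have "\<zero>\<^bsub>E\<^esub> \<in> i ` carrier R" by (rule image_eqI[of _ _ \<zero>]) auto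
  moreover have "z = \<zero>\<^bsub>E\<^esub>" if "z \<in> K" "z \<in> i ` carrier R" for z
  proof -
    from that(2) obtain x where "x \<in> carrier R" "z = i x" by blast
    moreover from this have "x = \<zero>" using n that(1) by blast
    ultimately show ?thesis by simp
  qed
  ultimately have "K \<inter> i ` carrier R = {\<zero>\<^bsub>E\<^esub>}" by blast
  then show False
    using assms envelope by (simp add: injective_envelope_def essential_submodule_def)
qed

text \<open>Essentiality is transitive: a submodule of \<open>E\<close> that meets the image of
  \<open>D\<close> trivially pulls back along \<open>i\<close> to a left ideal that meets
  \<open>D\<close> trivially, hence to zero, and the image of \<open>R\<close> is essential in
  \<open>E\<close>.\<close>

lemma essential_submodule_image:
  assumes D: "essential_left_ideal R D"
  shows "essential_submodule (i ` D) R E"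
  unfolding essential_submodule_def
proof (intro conjI allI impI)
  have DI: "left_ideal R D" using D by (simp add: essential_left_ideal_def)
  note DD = left_idealD[OF DI]
  show "submodule (i ` D) R E"
  proof (rule E.left_submoduleI)
    show "\<zero>\<^bsub>E\<^esub> \<in> i ` D" using DD(2) by (metis i_zero imageI)
    show "x \<oplus>\<^bsub>E\<^esub> y \<in> i ` D" if "x \<in> i ` D" "y \<in> i ` D" for x y
    proof -
      have "\<exists>u\<in>D. \<exists>v\<in>D. x = i u \<and> y = i v" using that by blast
      then show ?thesis using DD(1,3) by (auto simp flip: i_add)
    qed
    show "a \<odot>\<^bsub>E\<^esub> x \<in> i ` D" if "a \<in> carrier R" "x \<in> i ` D" for a x
      using that DD(1,4) by (auto simp flip: i_mult)
  qed (use DD(1) in auto)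
  fix K assume K: "submodule K R E" "K \<inter> i ` D = {\<zero>\<^bsub>E\<^esub>}"
  interpret K: submodule K R E by (rule K)
  have K0: "\<zero>\<^bsub>E\<^esub> \<in> K" using K.one_closed by simp
  let ?L = "{x \<in> carrier R. i x \<in> K}"
  have "left_ideal R ?L"
    using K.m_closed K.smult_closed K0 by (intro left_idealI) (auto simp: i_add i_mult)
  moreover have "?L \<inter> D = {\<zero>}"
  proof
    show "?L \<inter> D \<subseteq> {\<zero>}"
    proof
      fix x assume x: "x \<in> ?L \<inter> D"
      then have "i x = i \<zero>" using K(2) by auto
      then show "x \<in> {\<zero>}" using x i_inj[of x \<zero>] by simp
    qed
  qed (use K0 DD(2) in auto)
  ultimately have "?L = {\<zero>}" using D by (simp add: essential_left_ideal_def)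
  then show "K = {\<zero>\<^bsub>E\<^esub>}" using i_essential[OF K(1)] by blast
qed

text \<open>Both \<open>i\<close> and \<open>k\<close> make \<open>E\<close> an injective envelope
  of \<open>D\<close>, so an automorphism \<open>h\<close> of \<open>E\<close> carries one embedding
  to the other. Invariance puts \<open>h (i \<one>)\<close> into the image of \<open>R\<close>, and
  linearity spreads this value over \<open>D\<close>.\<close>

lemma monomorphism_right_mult:
  assumes D: "essential_left_ideal R D"
    and k: "k \<in> module_mono R ((regular_module R)\<lparr>carrier := D\<rparr>) E"
    and ess: "essential_submodule (k ` D) R E"
  shows "\<exists>r\<in>carrier R. \<forall>d\<in>D. k d = d \<odot>\<^bsub>E\<^esub> i r"
proof -
  let ?M = "(regular_module R)\<lparr>carrier := D\<rparr>"
  interpret RR: left_module R "regular_module R" by (rule left_module_regular) (rule ring_axioms)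
  have DI: "left_ideal R D" using D by (simp add: essential_left_ideal_def)
  note DC = left_idealD(1)[OF DI]
  have M: "left_module R ?M"
    using RR.left_module_submodule left_ideal_submodule[OF ring_axioms] DI by blast
  have "i \<in> module_mono R ?M E"
    using DC i_inj by (auto simp: module_mono_def module_hom_def i_add i_mult inj_on_def)
  then have env: "injective_envelope R ?M E i"
    using E essential_submodule_image[OF D] by (simp add: injective_envelope_def)
  have env': "injective_envelope R ?M E k"
    using E k ess by (simp add: injective_envelope_def)
  obtain h r where h: "h \<in> module_hom R E E" "r \<in> module_hom R E E"
    "\<And>x. x \<in> carrier E \<Longrightarrow> r (h x) = x" "\<And>y. y \<in> carrier E \<Longrightarrow> h (r y) = y"
    and hi: "\<And>x. x \<in> carrier ?M \<Longrightarrow> h (i x) = k x"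
    by (rule injective_envelope_unique[OF M env env']) (rule that; assumption)
  have "bij_betw h (carrier E) (carrier E)"
    by (rule bij_betw_byWitness[of _ r]) (use h module_homD(1)[OF h(1)] module_homD(1)[OF h(2)] in auto)
  then have "h ` (i ` carrier R) \<subseteq> i ` carrier R"
    using h(1) by (intro invariant) (simp add: module_aut_def)
  then obtain s where s: "s \<in> carrier R" "h (i \<one>) = i s" by blast
  have "k d = d \<odot>\<^bsub>E\<^esub> i s" if "d \<in> D" for d
  proof -
    have "k d = h (i (d \<otimes> \<one>))" using hi DC that by simp
    also have "\<dots> = d \<odot>\<^bsub>E\<^esub> h (i \<one>)"
      using DC[OF that] module_homD(3)[OF h(1)] by (subst i_mult) auto
    finally show ?thesis using s by simp
  qed
  then show ?thesis using s(1) by blast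
qed

text \<open>The relation \<open>G\<close> is the graph of an automorphism of a left ideal \<open>A\<close>. Adding the identity
  of a complement of \<open>A\<close> makes its domain essential.\<close>

lemma left_ideal_automorphism_right_mult:
  assumes G: "partial_hom R (regular_module R) (regular_module R) G"
    and inj: "\<And>x. (x, \<zero>) \<in> G \<Longrightarrow> x = \<zero>" and range: "Range G = Domain G"
  shows "\<exists>r\<in>carrier R. \<forall>x y. (x, y) \<in> G \<longrightarrow> y = x \<otimes> r"
proof -
  note GD = partial_hom_regularD[OF G]
  have RM: "left_module R (regular_module R)" by (rule left_module_regular) (rule ring_axioms)
  define A where "A = Domain G"
  have A: "left_ideal R A"
    unfolding A_def by (rule left_idealI) (use GD in blast)+
  have "{\<zero>} \<inter> (A - {\<zero>}) = {}" by blast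
  then obtain B where B: "left_ideal R B" "B \<inter> (A - {\<zero>}) = {}"
    and max: "\<And>C. \<lbrakk>left_ideal R C; B \<subseteq> C; C \<inter> (A - {\<zero>}) = {}\<rbrakk> \<Longrightarrow> C = B"
    using maximal_left_ideal_disjoint[OF left_ideal_zero] by metis
  note AC = left_idealD(1)[OF A] and BC = left_idealD(1)[OF B(1)]
  have AB: "x = \<zero> \<and> b = \<zero>" if "x \<in> A" "b \<in> B" "x \<oplus> b = \<zero>" for x b
  proof -
    have "x = \<ominus> b" using that AC BC by (metis minus_equality)
    then have "x \<in> B" using left_ideal_neg[OF B(1)] that by simp
    then have "x = \<zero>" using B(2) that by blast
    then show ?thesis using that AC BC by auto
  qed
  define D where "D = {x \<oplus> b | x b. x \<in> A \<and> b \<in> B}"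
  have DI: "left_ideal R D" unfolding D_def by (rule left_ideal_sum[OF A B(1)])
  have AD: "A \<subseteq> D"
  proof
    fix x assume "x \<in> A"
    then show "x \<in> D" unfolding D_def
      using AC left_idealD(2)[OF B(1)] by (intro CollectI exI[of _ x] exI[of _ \<zero>]) auto
  qed
  have BD: "B \<subseteq> D"
  proof
    fix x assume "x \<in> B"
    then show "x \<in> D" unfolding D_def
      using BC left_idealD(2)[OF A] by (intro CollectI exI[of _ \<zero>] exI[of _ x]) auto
  qed
  \<comment> \<open>A left ideal \<open>L\<close> that meets \<open>D\<close> trivially can be added
    to \<open>B\<close> without meeting \<open>A\<close> nontrivially. Maximality of
    \<open>B\<close> then puts \<open>L\<close> inside \<open>B\<close>, hence inside
    \<open>D\<close>.\<close>
  have D: "essential_left_ideal R D"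
    unfolding essential_left_ideal_def
  proof (intro conjI allI impI DI)
    fix L assume L: "left_ideal R L" "L \<inter> D = {\<zero>}"
    note LC = left_idealD(1)[OF L(1)]
    let ?C = "{b \<oplus> l | b l. b \<in> B \<and> l \<in> L}"
    have "?C \<inter> (A - {\<zero>}) = {}"
    proof (rule ccontr)
      assume "?C \<inter> (A - {\<zero>}) \<noteq> {}"
      then obtain b l where bl: "b \<in> B" "l \<in> L" "b \<oplus> l \<in> A" "b \<oplus> l \<noteq> \<zero>" by blast
      have "l = (b \<oplus> l) \<ominus> b"
        using BC[OF bl(1)] LC[OF bl(2)] a_comm[of b l] by (simp add: a_minus_def a_assoc r_neg)
      then have "l \<in> D" using left_ideal_minus[OF DI] bl AD BD by (metis subsetD)
      then have "l = \<zero>" using L(2) bl by blast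
      then show False using bl B(2) BC by auto
    qed
    then have "?C = B"
    proof (intro max left_ideal_sum B(1) L(1))
      show "B \<subseteq> ?C"
      proof
        fix x assume "x \<in> B"
        then show "x \<in> ?C"
          using BC left_idealD(2)[OF L(1)] by (intro CollectI exI[of _ x] exI[of _ \<zero>]) auto
      qed
    qed
    moreover have "L \<subseteq> ?C"
    proof
      fix x assume "x \<in> L"
      then show "x \<in> ?C"
        using LC left_idealD(2)[OF B(1)] by (intro CollectI exI[of _ \<zero>] exI[of _ x]) auto
    qed
    ultimately have "L \<subseteq> B" by simp
    then show "L = {\<zero>}" using L(2) BD by blast
  qed
  define H where "H = {(x \<oplus> b, y \<oplus> b) | x y b. (x, y) \<in> G \<and> b \<in> B}"
  have H: "partial_hom R (regular_module R) (regular_module R) H"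
  proof (rule partial_hom_regularI)
    show "x \<in> carrier R \<and> y \<in> carrier R" if "(x, y) \<in> H" for x y
      using that GD(1,2) BC unfolding H_def by auto
    have "(\<zero> \<oplus> \<zero>, \<zero> \<oplus> \<zero>) \<in> H"
      using GD(3) left_idealD(2)[OF B(1)] unfolding H_def by blast
    then show "(\<zero>, \<zero>) \<in> H" by simp
    show "(z \<oplus> z', w \<oplus> w') \<in> H" if "(z, w) \<in> H" "(z', w') \<in> H" for z w z' w'
    proof -
      from that obtain x y b x' y' b' where *: "(x, y) \<in> G" "(x', y') \<in> G" "b \<in> B" "b' \<in> B"
        "z = x \<oplus> b" "w = y \<oplus> b" "z' = x' \<oplus> b'" "w' = y' \<oplus> b'" unfolding H_def by blast
      have "z \<oplus> z' = (x \<oplus> x') \<oplus> (b \<oplus> b')" "w \<oplus> w' = (y \<oplus> y') \<oplus> (b \<oplus> b')"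
        using * GD(1,2)[OF *(1)] GD(1,2)[OF *(2)] BC[OF *(3)] BC[OF *(4)] by (simp_all add: a_ac)
      then show ?thesis
        unfolding H_def using GD(4)[OF *(1,2)] left_idealD(3)[OF B(1) *(3,4)] by blast
    qed
    show "(a \<otimes> z, a \<otimes> w) \<in> H" if az: "a \<in> carrier R" "(z, w) \<in> H" for a z w
    proof -
      from az obtain x y b where *: "(x, y) \<in> G" "b \<in> B" "z = x \<oplus> b" "w = y \<oplus> b"
        unfolding H_def by blast
      have "a \<otimes> z = a \<otimes> x \<oplus> a \<otimes> b" "a \<otimes> w = a \<otimes> y \<oplus> a \<otimes> b"
        using * GD(1,2)[OF *(1)] BC[OF *(2)] az by (simp_all add: r_distr)
      then show ?thesis
        unfolding H_def using GD(5)[OF az(1) *(1)] left_idealD(4)[OF B(1) az(1) *(2)] by blast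
    qed
    show "w = \<zero>" if zw: "(\<zero>, w) \<in> H" for w
    proof -
      from zw obtain x y b where *: "(x, y) \<in> G" "b \<in> B" "\<zero> = x \<oplus> b" "w = y \<oplus> b"
        unfolding H_def by blast
      then have "x = \<zero> \<and> b = \<zero>" using AB[of x b] by (auto simp: A_def)
      then show ?thesis using * GD(6)[of y] by simp
    qed
  qed
  obtain f where "left_module R ((regular_module R)\<lparr>carrier := Domain H\<rparr>)"
    and f: "f \<in> module_hom R ((regular_module R)\<lparr>carrier := Domain H\<rparr>) (regular_module R)"
    and fH: "\<And>x y. (x, y) \<in> H \<Longrightarrow> f x = y"
    using partial_hom_function[OF RM RM H] by blast
  have domH: "Domain H = D"
    unfolding H_def D_def A_def by blast
  have ranH: "Range H = D"
    unfolding H_def D_def A_def using range by blast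
  have "f ` D = Range H" unfolding domH[symmetric] using fH by force
  then have fD: "f ` D = D" using ranH by simp
  note DC = left_idealD(1)[OF DI]
  note fM = module_homD[OF f, unfolded domH, simplified]
  have fz: "d = \<zero>" if "d \<in> D" "f d = \<zero>" for d
  proof -
    obtain w where "(d, w) \<in> H" using domH \<open>d \<in> D\<close> by blast
    then have "(d, \<zero>) \<in> H" using fH \<open>f d = \<zero>\<close> by metis
    then obtain x y b where *: "(x, y) \<in> G" "b \<in> B" "d = x \<oplus> b" "\<zero> = y \<oplus> b"
      unfolding H_def by blast
    then have "y = \<zero> \<and> b = \<zero>" using AB[of y b] range by (auto simp: A_def)
    then show ?thesis using * inj[of x] by simp
  qed
  have M: "left_module R ((regular_module R)\<lparr>carrier := D\<rparr>)"
    using \<open>left_module R ((regular_module R)\<lparr>carrier := Domain H\<rparr>)\<close> domH by simp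
  let ?k = "\<lambda>d. i (f d)"
  have kh: "?k \<in> module_hom R ((regular_module R)\<lparr>carrier := D\<rparr>) E"
    using fM DC by (auto simp: module_hom_def i_add i_mult)
  have "inj_on ?k (carrier ((regular_module R)\<lparr>carrier := D\<rparr>))"
  proof (rule module_hom_inj[OF M E(1) kh])
    fix d assume "d \<in> carrier ((regular_module R)\<lparr>carrier := D\<rparr>)" "i (f d) = \<zero>\<^bsub>E\<^esub>"
    then show "d = \<zero>\<^bsub>(regular_module R)\<lparr>carrier := D\<rparr>\<^esub>"
      using fz[of d] i_inj[of "f d" \<zero>] fM(1) by simp
  qed
  then have "?k \<in> module_mono R ((regular_module R)\<lparr>carrier := D\<rparr>) E"
    using kh by (simp add: module_mono_def)
  \<comment> \<open>Here \<open>Range G = Domain G\<close> enters: the new embedding of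
    \<open>D\<close> has the same image as the old one, which is essential in
    \<open>E\<close>.\<close>
  moreover have "?k ` D = i ` D" using fD by (metis image_image)
  ultimately obtain r where r: "r \<in> carrier R" "\<And>d. d \<in> D \<Longrightarrow> i (f d) = d \<odot>\<^bsub>E\<^esub> i r"
    using monomorphism_right_mult[OF D] essential_submodule_image[OF D] by metis
  have fr: "f d = d \<otimes> r" if "d \<in> D" for d
    using r that DC fM(1) i_inj[of "f d" "d \<otimes> r"] by (simp add: i_mult)
  have "y = x \<otimes> r" if "(x, y) \<in> G" for x y
  proof -
    have "(x \<oplus> \<zero>, y \<oplus> \<zero>) \<in> H" unfolding H_def using that left_idealD(2)[OF B(1)] by blast
    then have "(x, y) \<in> H" using GD(1,2)[OF that] by simp
    then show ?thesis using fH fr domH by blast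
  qed
  then show ?thesis using r(1) by blast
qed

text \<open>Equal relations make \<open>x \<mapsto> x'\<close>, \<open>y \<mapsto> y'\<close> well
  defined and injective, and the four memberships say that both pairs generate the same left ideal,
  so this is an automorphism. The choice \<open>y = y' = \<zero>\<close> covers a single
  generator.\<close>

lemma two_generated_right_mult:
  assumes C: "x \<in> carrier R" "y \<in> carrier R" "x' \<in> carrier R" "y' \<in> carrier R"
    and iso: "\<And>a b. \<lbrakk>a \<in> carrier R; b \<in> carrier R\<rbrakk> \<Longrightarrow>
      a \<otimes> x \<oplus> b \<otimes> y = \<zero> \<longleftrightarrow> a \<otimes> x' \<oplus> b \<otimes> y' = \<zero>"
    and range: "x' \<in> span2 x y" "y' \<in> span2 x y" "x \<in> span2 x' y'" "y \<in> span2 x' y'"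
  shows "\<exists>r\<in>carrier R. x' = x \<otimes> r \<and> y' = y \<otimes> r"
proof -
  define G where "G = {(a \<otimes> x \<oplus> b \<otimes> y, a \<otimes> x' \<oplus> b \<otimes> y') | a b. a \<in> carrier R \<and> b \<in> carrier R}"
  have GI: "(a \<otimes> x \<oplus> b \<otimes> y, a \<otimes> x' \<oplus> b \<otimes> y') \<in> G" if "a \<in> carrier R" "b \<in> carrier R" for a b
    unfolding G_def using that by blast
  have "partial_hom R (regular_module R) (regular_module R) G"
  proof (rule partial_hom_regularI)
    show "z \<in> carrier R \<and> w \<in> carrier R" if "(z, w) \<in> G" for z w
      using that C unfolding G_def by auto
    show "(\<zero>, \<zero>) \<in> G" using GI[of \<zero> \<zero>] C by simp
    show "(z \<oplus> z', w \<oplus> w') \<in> G" if "(z, w) \<in> G" "(z', w') \<in> G" for z w z' w'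
    proof -
      from that obtain a b a' b' where *: "a \<in> carrier R" "b \<in> carrier R" "a' \<in> carrier R" "b' \<in> carrier R"
        "z = a \<otimes> x \<oplus> b \<otimes> y" "w = a \<otimes> x' \<oplus> b \<otimes> y'" "z' = a' \<otimes> x \<oplus> b' \<otimes> y" "w' = a' \<otimes> x' \<oplus> b' \<otimes> y'"
        unfolding G_def by blast
      then show ?thesis using GI[of "a \<oplus> a'" "b \<oplus> b'"] C by (simp add: l_distr a_ac)
    qed
    show "(c \<otimes> z, c \<otimes> w) \<in> G" if cz: "c \<in> carrier R" "(z, w) \<in> G" for c z w
    proof -
      from cz obtain a b where *: "a \<in> carrier R" "b \<in> carrier R"
        "z = a \<otimes> x \<oplus> b \<otimes> y" "w = a \<otimes> x' \<oplus> b \<otimes> y'"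
        unfolding G_def by blast
      then show ?thesis using GI[of "c \<otimes> a" "c \<otimes> b"] C cz by (simp add: r_distr m_assoc)
    qed
    show "w = \<zero>" if "(\<zero>, w) \<in> G" for w
      using that iso unfolding G_def by force
  qed
  moreover have "z = \<zero>" if "(z, \<zero>) \<in> G" for z
    using that iso unfolding G_def by force
  moreover have "Range G = Domain G"
  proof -
    have "Range G = span2 x' y'" "Domain G = span2 x y" unfolding G_def by blast+
    moreover have "span2 x' y' = span2 x y"
      by (intro subset_antisym span2_subset left_ideal_span2 C range)
    ultimately show ?thesis by simp
  qed
  ultimately obtain r where r: "r \<in> carrier R" "\<And>z w. (z, w) \<in> G \<Longrightarrow> w = z \<otimes> r"
    using left_ideal_automorphism_right_mult by blast
  have "(x, x') \<in> G" using GI[of \<one> \<zero>] C by simp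
  moreover have "(y, y') \<in> G" using GI[of \<zero> \<one>] C by simp
  ultimately show ?thesis using r by blast
qed

end

section \<open>The left socle\<close>

context semiprimary
begin

lemma J_carrier: "x \<in> J \<Longrightarrow> x \<in> carrier R"
  using left_idealD(1)[OF left_ideal_J] .

lemma J_left: "\<lbrakk>a \<in> carrier R; x \<in> J\<rbrakk> \<Longrightarrow> a \<otimes> x \<in> J"
  using left_idealD(4)[OF left_ideal_J] .

lemma es_closed [simp]: "e \<in> es \<Longrightarrow> e \<in> carrier R"
  and es_idem: "e \<in> es \<Longrightarrow> e \<otimes> e = e"
  and es_not_J: "e \<in> es \<Longrightarrow> e \<notin> J"
  and es_left: "\<lbrakk>e \<in> es; x \<in> carrier R; x \<otimes> e \<notin> J\<rbrakk> \<Longrightarrow> \<exists>b\<in>carrier R. b \<otimes> (x \<otimes> e) = e"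
  and es_right: "\<lbrakk>e \<in> es; x \<in> carrier R; e \<otimes> x \<notin> J\<rbrakk> \<Longrightarrow> \<exists>b\<in>carrier R. e \<otimes> x \<otimes> b = e"
  using local_es by (auto simp: local_idempotent_def)

lemma finsum_mem:
  assumes "finite F" "A \<subseteq> carrier R" "\<zero> \<in> A" "\<And>x y. \<lbrakk>x \<in> A; y \<in> A\<rbrakk> \<Longrightarrow> x \<oplus> y \<in> A"
    "\<And>e. e \<in> F \<Longrightarrow> g e \<in> A"
  shows "finsum R g F \<in> A"
  using assms(1,5)
proof (induction F)
  case (insert e F)
  then have "finsum R g (insert e F) = g e \<oplus> finsum R g F"
    using assms(2) by (intro finsum_insert) auto
  then show ?case using insert assms(4) by simp
qed (simp add: assms(3))

text \<open>Since \<open>x\<close> is the sum of its components \<open>ex\<close>, membership in an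
  additively closed set is tested one row at a time; \<open>sum_right_mem\<close> does the same for
  columns.\<close>

lemma sum_left_mem:
  assumes A: "A \<subseteq> carrier R" "\<zero> \<in> A" "\<And>x y. \<lbrakk>x \<in> A; y \<in> A\<rbrakk> \<Longrightarrow> x \<oplus> y \<in> A"
    and x: "x \<in> carrier R" "\<And>e. e \<in> es \<Longrightarrow> e \<otimes> x \<in> A"
  shows "x \<in> A"
proof -
  have "x = (\<Oplus>e\<in>es. e) \<otimes> x" using x sum_es by simp
  also have "\<dots> = (\<Oplus>e\<in>es. e \<otimes> x)" using x by (intro finsum_ldistr finite_es) auto
  finally show ?thesis using finsum_mem[OF finite_es A, of "\<lambda>e. e \<otimes> x"] x(2) by simp
qed

lemma sum_right_mem:
  assumes A: "A \<subseteq> carrier R" "\<zero> \<in> A" "\<And>x y. \<lbrakk>x \<in> A; y \<in> A\<rbrakk> \<Longrightarrow> x \<oplus> y \<in> A"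
    and x: "x \<in> carrier R" "\<And>e. e \<in> es \<Longrightarrow> x \<otimes> e \<in> A"
  shows "x \<in> A"
proof -
  have "x = x \<otimes> (\<Oplus>e\<in>es. e)" using x sum_es by simp
  also have "\<dots> = (\<Oplus>e\<in>es. x \<otimes> e)" using x by (intro finsum_rdistr finite_es) auto
  finally show ?thesis using finsum_mem[OF finite_es A, of "\<lambda>e. x \<otimes> e"] x(2) by simp
qed

lemma left_component_nonzero:
  assumes "x \<in> carrier R" "x \<noteq> \<zero>"
  shows "\<exists>e\<in>es. e \<otimes> x \<noteq> \<zero>"
  using sum_left_mem[of "{\<zero>}" x] assms by auto

text \<open>Orthogonality allows the rows \<open>f \<otimes> r\<close> to be prescribed
  independently; each induction step exchanges one row of \<open>r\<close>. This combines
  multipliers found separately on the columns \<open>Sf\<close>.\<close>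

lemma glue_right:
  assumes "\<And>f. f \<in> es \<Longrightarrow> \<rho> f \<in> carrier R"
  shows "\<exists>r\<in>carrier R. \<forall>f\<in>es. f \<otimes> r = f \<otimes> \<rho> f"
proof -
  have "\<exists>r\<in>carrier R. \<forall>f\<in>F. f \<otimes> r = f \<otimes> \<rho> f" if "finite F" "F \<subseteq> es" for F
    using that
  proof (induction F)
    case (insert f F)
    then obtain r where r: "r \<in> carrier R" "\<And>g. g \<in> F \<Longrightarrow> g \<otimes> r = g \<otimes> \<rho> g" by blast
    have f[simp]: "f \<in> carrier R" "\<rho> f \<in> carrier R" "f \<otimes> f = f" and fes: "f \<in> es"
      using insert assms es_idem by auto
    let ?r = "(r \<ominus> f \<otimes> r) \<oplus> f \<otimes> \<rho> f"
    have "f \<otimes> ?r = f \<otimes> \<rho> f"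
      using r(1) by (simp add: r_distr r_distr_minus m_assoc[symmetric])
    moreover have "g \<otimes> ?r = g \<otimes> \<rho> g" if g: "g \<in> F" for g
    proof -
      have "g \<in> es" "g \<noteq> f" using g insert by auto
      then have "g \<otimes> f = \<zero>" "g \<in> carrier R" "\<rho> g \<in> carrier R" using orthogonal fes assms by auto
      then show ?thesis using r(1) r(2)[OF g] by (simp add: r_distr r_distr_minus m_assoc[symmetric])
    qed
    ultimately show ?case using r(1) by (intro bexI[of _ ?r]) auto
  qed auto
  then show ?thesis using finite_es by blast
qed

lemma J_nilpotent_element:
  assumes "j \<in> J"
  shows "\<exists>k::nat. j [^] k = \<zero>"
  using nilpotent nat_pow_products[OF _ assms] J_carrier by blast

lemma J_right_fixed:
  assumes "j \<in> J" "x \<in> carrier R" "x = x \<otimes> j"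
  shows "x = \<zero>"
proof -
  have [simp]: "j \<in> carrier R" using assms J_carrier by blast
  have "x \<otimes> j [^] k = x" for k :: nat
    by (induction k) (use assms in \<open>simp_all add: m_assoc[symmetric] flip: assms(3)\<close>)
  then show ?thesis using J_nilpotent_element[OF assms(1)] assms(2) by (metis r_null)
qed

text \<open>Since \<open>R/J\<close> is semisimple, the elements killed by \<open>J\<close> from the
  left form the sum of all simple left ideals.\<close>

definition socle :: "'a set" where
  "socle = {x \<in> carrier R. \<forall>j\<in>J. j \<otimes> x = \<zero>}"

lemma socle_carrier: "x \<in> socle \<Longrightarrow> x \<in> carrier R"
  by (simp add: socle_def)

lemma left_ideal_socle: "left_ideal R socle"
  by (rule left_idealI) (use J_carrier J_right in \<open>auto simp: socle_def r_distr simp flip: m_assoc\<close>)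

lemma socle_right: "\<lbrakk>x \<in> socle; r \<in> carrier R\<rbrakk> \<Longrightarrow> x \<otimes> r \<in> socle"
  using J_carrier by (auto simp: socle_def simp flip: m_assoc)

text \<open>Take the greatest length \<open>m\<close> for which some \<open>m\<close>-fold product
  \<open>p\<close> of elements of \<open>J\<close> does not kill \<open>x\<close>, as found by the
  search for the first length that does; one more factor from \<open>J\<close> on the left then
  kills \<open>px\<close>.\<close>

lemma socle_essential_element:
  assumes x: "x \<in> carrier R" "x \<noteq> \<zero>"
  shows "\<exists>a\<in>carrier R. a \<otimes> x \<in> socle \<and> a \<otimes> x \<noteq> \<zero>"
proof -
  have J: "J \<subseteq> carrier R" using J_carrier by blast
  let ?P = "\<lambda>k. \<forall>p\<in>products R J k. p \<otimes> x = \<zero>"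
  obtain k where "products R J k \<subseteq> {\<zero>}" using nilpotent by blast
  then have "?P k" using x by auto
  moreover have "\<not> ?P 0" using x by simp
  ultimately obtain m where k: "\<not> ?P m" "?P (Suc m)"
    using ex_least_nat_less[of ?P k] by blast
  then obtain p where p: "p \<in> products R J m" "p \<otimes> x \<noteq> \<zero>" by auto
  have pc: "p \<in> carrier R" using products_carrier[OF J p(1)] .
  have "j \<otimes> (p \<otimes> x) = \<zero>" if j: "j \<in> J" for j
  proof -
    have "j \<otimes> p \<in> products R J (Suc m)" unfolding products_Suc_left[OF J] using j p by blast
    then have "j \<otimes> p \<otimes> x = \<zero>" using k(2) by blast
    then show ?thesis using J_carrier[OF j] pc x by (simp add: m_assoc)
  qed
  then show ?thesis using pc p x by (intro bexI[of _ p]) (auto simp: socle_def)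
qed

lemma essential_socle: "essential_left_ideal R socle"
  unfolding essential_left_ideal_def
proof (intro conjI allI impI left_ideal_socle)
  fix L assume L: "left_ideal R L" "L \<inter> socle = {\<zero>}"
  have "x = \<zero>" if "x \<in> L" for x
    using socle_essential_element[of x] left_idealD(1,4)[OF L(1)] that L(2) by blast
  then show "L = {\<zero>}" using left_idealD(2)[OF L(1)] by blast
qed

text \<open>The map \<open>ae \<mapsto> ax\<close> identifies \<open>Rx\<close> with the simple
  module \<open>Re/Je\<close>. The annihilator of \<open>x\<close> thus depends on \<open>e\<close>
  alone, which makes \<open>Rx\<close> and \<open>Ry\<close> interchangeable for two such
  elements.\<close>

lemma socle_annihilator:
  assumes e: "e \<in> es" and x: "x \<in> socle" "e \<otimes> x = x" "x \<noteq> \<zero>" and a: "a \<in> carrier R"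
  shows "a \<otimes> x = \<zero> \<longleftrightarrow> a \<otimes> e \<in> J"
proof -
  have xc: "x \<in> carrier R" using x socle_carrier by blast
  have *: "a \<otimes> x = a \<otimes> e \<otimes> x" using x e a xc by (simp add: m_assoc)
  show ?thesis
  proof
    assume ax: "a \<otimes> x = \<zero>"
    show "a \<otimes> e \<in> J"
    proof (rule ccontr)
      assume "a \<otimes> e \<notin> J"
      then obtain b where "b \<in> carrier R" "b \<otimes> (a \<otimes> e) = e" using es_left[OF e a] by blast
      then have "x = b \<otimes> (a \<otimes> e \<otimes> x)" using x(2) e a xc by (metis es_closed m_assoc m_closed)
      then show False using ax * \<open>b \<in> carrier R\<close> x(3) by simp
    qed
  next
    assume "a \<otimes> e \<in> J"
    then show "a \<otimes> x = \<zero>" using x(1) * by (simp add: socle_def)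
  qed
qed

lemma socle_simple:
  assumes e: "e \<in> es" and x: "x \<in> carrier R" "e \<otimes> x = x" and a: "a \<in> carrier R" "a \<otimes> e \<notin> J"
  shows "\<exists>b\<in>carrier R. b \<otimes> (a \<otimes> x) = x"
proof -
  obtain b where "b \<in> carrier R" "b \<otimes> (a \<otimes> e) = e" using es_left[OF e a] by blast
  then have "b \<otimes> (a \<otimes> x) = x" using x e a by (metis es_closed m_assoc m_closed)
  then show ?thesis using \<open>b \<in> carrier R\<close> by blast
qed

text \<open>\<open>Ry\<close> is simple and not contained in \<open>Rx\<close>, so
  \<open>Rx + Ry\<close> is direct and has the relations of two copies of
  \<open>Re/Je\<close>.\<close>

lemma socle_independent:
  assumes e: "e \<in> es" and x: "x \<in> socle" "e \<otimes> x = x" "x \<noteq> \<zero>"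
    and y: "y \<in> socle" "e \<otimes> y = y" "y \<noteq> \<zero>" "y \<notin> (\<lambda>a. a \<otimes> x) ` carrier R"
    and ab: "a \<in> carrier R" "b \<in> carrier R"
  shows "a \<otimes> x \<oplus> b \<otimes> y = \<zero> \<longleftrightarrow> a \<otimes> e \<in> J \<and> b \<otimes> e \<in> J"
proof
  have xc: "x \<in> carrier R" "y \<in> carrier R" using x y socle_carrier by auto
  assume z: "a \<otimes> x \<oplus> b \<otimes> y = \<zero>"
  have "b \<otimes> e \<in> J"
  proof (rule ccontr)
    assume "b \<otimes> e \<notin> J"
    then obtain c where c: "c \<in> carrier R" "c \<otimes> (b \<otimes> y) = y"
      using socle_simple[OF e xc(2) y(2) ab(2)] by blast
    have "b \<otimes> y = \<ominus> (a \<otimes> x)" using z xc ab by (metis a_comm m_closed minus_equality)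
    then have "y = (\<ominus> (c \<otimes> a)) \<otimes> x" using c xc ab by (metis l_minus m_assoc m_closed r_minus)
    then show False using y(4) c(1) ab by blast
  qed
  moreover from this have "b \<otimes> y = \<zero>" using socle_annihilator[OF e y(1-3) ab(2)] by simp
  ultimately show "a \<otimes> e \<in> J \<and> b \<otimes> e \<in> J"
    using z xc ab socle_annihilator[OF e x ab(1)] by simp
next
  assume "a \<otimes> e \<in> J \<and> b \<otimes> e \<in> J"
  then show "a \<otimes> x \<oplus> b \<otimes> y = \<zero>"
    using socle_annihilator[OF e x ab(1)] socle_annihilator[OF e y(1-3) ab(2)] by simp
qed

end

section \<open>Rows and blocks of the socle under automorphism-invariance\<close>

locale semiprimary_automorphism_invariant =
  semiprimary R J es + automorphism_invariant_ring R E i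
  for R :: "('a, 'r) ring_scheme" (structure) and J es and E :: "('a, 'e) module" and i
begin

text \<open>If \<open>y\<close> lies in \<open>Rx\<close>, then \<open>x \<mapsto> y\<close> is an
  automorphism of the simple left ideal \<open>Rx\<close>; otherwise \<open>Rx + Ry\<close> is
  direct and swapping \<open>x\<close> and \<open>y\<close> is an automorphism. Either way a right
  multiplication takes \<open>x\<close> to \<open>y\<close>, so \<open>eS\<close> is simple or zero
  as a right module.\<close>

lemma socle_row_transitive:
  assumes e: "e \<in> es" and x: "x \<in> socle" "e \<otimes> x = x" "x \<noteq> \<zero>"
    and y: "y \<in> socle" "e \<otimes> y = y" "y \<noteq> \<zero>"
  shows "\<exists>r\<in>carrier R. y = x \<otimes> r"
proof (cases "y \<in> (\<lambda>a. a \<otimes> x) ` carrier R")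
  have [simp]: "x \<in> carrier R" "y \<in> carrier R" using x y socle_carrier by auto
  case True
  then obtain c where c: "c \<in> carrier R" "y = c \<otimes> x" by blast
  then have "c \<otimes> e \<notin> J" using socle_annihilator[OF e x] y(3) by auto
  then obtain d where d: "d \<in> carrier R" "d \<otimes> y = x"
    using socle_simple[OF e _ x(2) c(1)] c by auto
  have "\<exists>r\<in>carrier R. y = x \<otimes> r \<and> \<zero> = \<zero> \<otimes> r"
  proof (rule two_generated_right_mult)
    show "a \<otimes> x \<oplus> b \<otimes> \<zero> = \<zero> \<longleftrightarrow> a \<otimes> y \<oplus> b \<otimes> \<zero> = \<zero>" if "a \<in> carrier R" "b \<in> carrier R" for a b
      using that socle_annihilator[OF e x] socle_annihilator[OF e y] by simp
    show "y \<in> span2 x \<zero>" by (rule span2I[of _ _ c \<zero>]) (use c in auto)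
    show "x \<in> span2 y \<zero>" by (rule span2I[of _ _ d \<zero>]) (use d in auto)
    show "\<zero> \<in> span2 x \<zero>" by (rule span2I[of _ _ \<zero> \<zero>]) auto
    show "\<zero> \<in> span2 y \<zero>" by (rule span2I[of _ _ \<zero> \<zero>]) auto
  qed auto
  then show ?thesis by blast
next
  have [simp]: "x \<in> carrier R" "y \<in> carrier R" using x y socle_carrier by auto
  case False
  note ind = socle_independent[OF e x y False]
  have "\<exists>r\<in>carrier R. y = x \<otimes> r \<and> x = y \<otimes> r"
  proof (rule two_generated_right_mult)
    show "a \<otimes> x \<oplus> b \<otimes> y = \<zero> \<longleftrightarrow> a \<otimes> y \<oplus> b \<otimes> x = \<zero>" if "a \<in> carrier R" "b \<in> carrier R" for a b
      using ind[OF that] ind[OF that(2,1)] that by (simp add: a_comm[of "a \<otimes> y"] conj_commute)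
    show "x \<in> span2 x y" "y \<in> span2 y x" by (rule span2I[of _ _ \<one> \<zero>]; simp)+
    show "y \<in> span2 x y" "x \<in> span2 y x" by (rule span2I[of _ _ \<zero> \<one>]; simp)+
  qed auto
  then show ?thesis by blast
qed

text \<open>If \<open>xj\<close> had a nonzero component \<open>exj\<close>, row transitivity would
  recover \<open>ex\<close> as \<open>(ex)jr\<close>, although \<open>jr\<close> is
  nilpotent.\<close>

lemma socle_J:
  assumes "x \<in> socle" "j \<in> J"
  shows "x \<otimes> j = \<zero>"
proof (rule ccontr)
  assume n: "x \<otimes> j \<noteq> \<zero>"
  have [simp]: "x \<in> carrier R" "j \<in> carrier R" using assms socle_carrier J_carrier by auto
  obtain e where e: "e \<in> es" "e \<otimes> (x \<otimes> j) \<noteq> \<zero>" using left_component_nonzero[OF _ n] by auto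
  let ?x = "e \<otimes> x"
  have xs: "?x \<in> socle" "e \<otimes> ?x = ?x" "?x \<noteq> \<zero>"
    using e left_idealD(4)[OF left_ideal_socle] assms(1) es_idem[OF e(1)]
    by (auto simp: m_assoc[symmetric])
  have "?x \<otimes> j \<in> socle" "e \<otimes> (?x \<otimes> j) = ?x \<otimes> j" "?x \<otimes> j \<noteq> \<zero>"
    using e socle_right[OF xs(1)] es_idem[OF e(1)] by (auto simp: m_assoc[symmetric])
  then obtain r where r: "r \<in> carrier R" "?x = ?x \<otimes> j \<otimes> r"
    using socle_row_transitive[OF e(1) _ _ _ xs] by blast
  have "?x \<otimes> j \<otimes> r = ?x \<otimes> (j \<otimes> r)" using e r(1) by (simp add: m_assoc)
  then have "?x = ?x \<otimes> (j \<otimes> r)" using r(2) by simp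
  then show False using J_right_fixed[OF J_right[OF assms(2) r(1)]] xs(3) e by simp
qed

text \<open>If \<open>x\<close> and \<open>y\<close> were independent, the automorphisms \<open>(x, y) \<mapsto> (y, x + y)\<close> and
  \<open>(x, y) \<mapsto> (y, x)\<close> of \<open>Rx + Ry\<close> would be induced by elements of the local ring \<open>fRf\<close> whose
  difference kills \<open>x\<close> and fixes \<open>y\<close>, hence is neither a unit nor in the radical.\<close>

lemma socle_block_transitive:
  assumes e: "e \<in> es" and f: "f \<in> es"
    and x: "x \<in> socle" "e \<otimes> x = x" "x \<otimes> f = x" "x \<noteq> \<zero>"
    and y: "y \<in> socle" "e \<otimes> y = y" "y \<otimes> f = y" "y \<noteq> \<zero>"
  shows "y \<in> (\<lambda>a. a \<otimes> x) ` carrier R"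
proof (rule ccontr)
  assume n: "y \<notin> (\<lambda>a. a \<otimes> x) ` carrier R"
  have [simp]: "x \<in> carrier R" "y \<in> carrier R" "f \<in> carrier R" "e \<in> carrier R"
    using x y e f socle_carrier by auto
  note ind = socle_independent[OF e x(1,2,4) y(1,2,4) n]
  have "\<exists>r\<in>carrier R. y = x \<otimes> r \<and> x = y \<otimes> r"
  proof (rule two_generated_right_mult)
    show "a \<otimes> x \<oplus> b \<otimes> y = \<zero> \<longleftrightarrow> a \<otimes> y \<oplus> b \<otimes> x = \<zero>" if "a \<in> carrier R" "b \<in> carrier R" for a b
      using ind[OF that] ind[OF that(2,1)] that by (simp add: a_comm[of "a \<otimes> y"] conj_commute)
    show "x \<in> span2 x y" "y \<in> span2 y x" by (rule span2I[of _ _ \<one> \<zero>]; simp)+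
    show "y \<in> span2 x y" "x \<in> span2 y x" by (rule span2I[of _ _ \<zero> \<one>]; simp)+
  qed auto
  then obtain r where r: "r \<in> carrier R" "y = x \<otimes> r" "x = y \<otimes> r" by blast
  have "\<exists>r\<in>carrier R. y = x \<otimes> r \<and> x \<oplus> y = y \<otimes> r"
  proof (rule two_generated_right_mult)
    fix a b assume ab [simp]: "a \<in> carrier R" "b \<in> carrier R"
    \<comment> \<open>The substitution \<open>(a, b) \<mapsto> (b, a + b)\<close> is invertible over
      the integers, so both pairs of generators have the same relations in every
      characteristic.\<close>
    have "a \<otimes> y \<oplus> b \<otimes> (x \<oplus> y) = b \<otimes> x \<oplus> (a \<oplus> b) \<otimes> y" by (simp add: r_distr l_distr a_ac)
    then have "a \<otimes> y \<oplus> b \<otimes> (x \<oplus> y) = \<zero> \<longleftrightarrow> b \<otimes> e \<in> J \<and> (a \<oplus> b) \<otimes> e \<in> J"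
      using ind[of b "a \<oplus> b"] by simp
    also have "\<dots> \<longleftrightarrow> a \<otimes> e \<in> J \<and> b \<otimes> e \<in> J"
    proof -
      have "a \<otimes> e = (a \<oplus> b) \<otimes> e \<ominus> b \<otimes> e"
        by (simp add: l_distr a_minus_def a_assoc r_neg)
      moreover have "(a \<oplus> b) \<otimes> e = a \<otimes> e \<oplus> b \<otimes> e" by (simp add: l_distr)
      ultimately show ?thesis
        using left_ideal_minus[OF left_ideal_J] left_idealD(3)[OF left_ideal_J] by metis
    qed
    finally show "a \<otimes> x \<oplus> b \<otimes> y = \<zero> \<longleftrightarrow> a \<otimes> y \<oplus> b \<otimes> (x \<oplus> y) = \<zero>"
      using ind[OF ab] by simp
  next
    show "y \<in> span2 x y" by (rule span2I[of _ _ \<zero> \<one>]) simp_all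
    show "x \<oplus> y \<in> span2 x y" by (rule span2I[of _ _ \<one> \<one>]) simp_all
    show "y \<in> span2 y (x \<oplus> y)" by (rule span2I[of _ _ \<one> \<zero>]) simp_all
    show "x \<in> span2 y (x \<oplus> y)"
      by (rule span2I[of _ _ "\<ominus> \<one>" \<one>]) (simp_all add: l_minus a_lcomm[of "\<ominus> y"] l_neg)
  qed auto
  then obtain s where s: "s \<in> carrier R" "y = x \<otimes> s" "x \<oplus> y = y \<otimes> s" by blast
  define d where "d = s \<ominus> r"
  have [simp]: "d \<in> carrier R" using r(1) s(1) by (simp add: d_def)
  have "x \<otimes> d = x \<otimes> s \<ominus> x \<otimes> r" using r(1) s(1) by (simp add: d_def r_distr_minus)
  then have xd: "x \<otimes> d = \<zero>" unfolding r(2)[symmetric] s(2)[symmetric] by simp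
  have yd: "y \<otimes> d = y"
  proof -
    have "y \<otimes> d = y \<otimes> s \<ominus> y \<otimes> r" using r(1) s(1) by (simp add: d_def r_distr_minus)
    also have "\<dots> = (x \<oplus> y) \<ominus> x" unfolding r(3)[symmetric] s(3)[symmetric] ..
    also have "\<dots> = y" by (simp add: a_minus_def a_comm[of x] a_assoc r_neg)
    finally show ?thesis .
  qed
  show False
  \<comment> \<open>Inside \<open>J\<close> the element \<open>fdf\<close> would kill
    \<open>y\<close> because \<open>SJ = 0\<close>, although it fixes \<open>y\<close>. Outside
    \<open>J\<close> it could be multiplied on the right to give \<open>f\<close>, although it kills
    \<open>x = xf\<close>.\<close>
  proof (cases "f \<otimes> d \<otimes> f \<in> J")
    case True
    have "y \<otimes> (f \<otimes> d \<otimes> f) = y" using y(3) yd by (simp add: m_assoc[symmetric])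
    then show False using socle_J[OF y(1) True] y(4) by simp
  next
    case False
    then have "f \<otimes> (d \<otimes> f) \<notin> J" by (simp add: m_assoc)
    then obtain b where b: "b \<in> carrier R" "f \<otimes> (d \<otimes> f) \<otimes> b = f" using es_right[OF f, of "d \<otimes> f"] by auto
    have "x = x \<otimes> (f \<otimes> (d \<otimes> f) \<otimes> b)" using b x(3) by simp
    also have "\<dots> = x \<otimes> f \<otimes> d \<otimes> f \<otimes> b" using b(1) by (simp add: m_assoc)
    also have "\<dots> = \<zero>" using x(3) xd b(1) by simp
    finally show False using x(4) by simp
  qed
qed

end

text \<open>The counting argument behind the Nakayama permutation of the isomorphism classes of
  indecomposable projective modules.\<close>

lemma finite_class_permutation:
  assumes fin: "finite I"
    and refl: "\<And>e. e \<in> I \<Longrightarrow> link e e"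
    and sym: "\<And>e f. \<lbrakk>e \<in> I; f \<in> I; link e f\<rbrakk> \<Longrightarrow> link f e"
    and trans: "\<And>e f g. \<lbrakk>e \<in> I; f \<in> I; g \<in> I; link e f; link f g\<rbrakk> \<Longrightarrow> link e g"
    and surj: "\<And>f. f \<in> I \<Longrightarrow> \<exists>e\<in>I. N e f"
    and single: "\<And>e f f'. \<lbrakk>e \<in> I; f \<in> I; f' \<in> I; N e f; N e f'\<rbrakk> \<Longrightarrow> link f f'"
    and cong: "\<And>e e' f. \<lbrakk>e \<in> I; e' \<in> I; f \<in> I; link e e'; N e f\<rbrakk> \<Longrightarrow> N e' f"
  shows "\<And>e. e \<in> I \<Longrightarrow> \<exists>f\<in>I. N e f"
    and "\<And>e e' f. \<lbrakk>e \<in> I; e' \<in> I; f \<in> I; N e f; N e' f\<rbrakk> \<Longrightarrow> link e e'"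
proof -
  define cls where "cls e = {e' \<in> I. link e e'}" for e
  have cls: "cls e = cls f \<longleftrightarrow> link e f" if "e \<in> I" "f \<in> I" for e f
    using that refl sym trans unfolding cls_def by blast
  define \<sigma> where "\<sigma> f = (SOME e. e \<in> I \<and> N e f)" for f
  have \<sigma>: "\<sigma> f \<in> I" "N (\<sigma> f) f" if "f \<in> I" for f
    using someI_ex[of "\<lambda>e. e \<in> I \<and> N e f"] surj[OF that] unfolding \<sigma>_def by blast+
  define \<rho> where "\<rho> C = (SOME e. e \<in> I \<and> cls e = C)" for C
  have \<rho>: "\<rho> C \<in> I" "cls (\<rho> C) = C" if "C \<in> cls ` I" for C
    using someI_ex[of "\<lambda>e. e \<in> I \<and> cls e = C"] that unfolding \<rho>_def by blast+
  \<comment> \<open>\<open>\<tau>\<close> sends the class of \<open>f\<close> to the class of some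
    \<open>e\<close> with \<open>N e f\<close>. By \<open>cong\<close> and \<open>single\<close> it
    is injective, hence onto, because there are finitely many classes.\<close>
  define \<tau> where "\<tau> C = cls (\<sigma> (\<rho> C))" for C
  have "inj_on \<tau> (cls ` I)"
  proof (rule inj_onI)
    fix C C' assume C: "C \<in> cls ` I" "C' \<in> cls ` I" "\<tau> C = \<tau> C'"
    then have "link (\<sigma> (\<rho> C)) (\<sigma> (\<rho> C'))" using cls \<sigma> \<rho> by (simp add: \<tau>_def)
    then have "N (\<sigma> (\<rho> C')) (\<rho> C)"
      using cong[of "\<sigma> (\<rho> C)" "\<sigma> (\<rho> C')" "\<rho> C"] \<sigma> \<rho>(1) C(1,2) by simp
    then have "link (\<rho> C) (\<rho> C')"
      using single[of "\<sigma> (\<rho> C')" "\<rho> C" "\<rho> C'"] \<sigma> \<rho>(1) C(1,2) by simp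
    then have "cls (\<rho> C) = cls (\<rho> C')" using cls \<rho>(1) C(1,2) by simp
    then show "C = C'" using \<rho>(2) C(1,2) by simp
  qed
  moreover have "\<tau> ` cls ` I \<subseteq> cls ` I" using \<sigma>(1) \<rho>(1) unfolding \<tau>_def by blast
  ultimately have \<tau>: "\<tau> ` cls ` I = cls ` I" by (intro endo_inj_surj finite_imageI fin)
  have key: "\<exists>C\<in>cls ` I. link (\<sigma> (\<rho> C)) e" if "e \<in> I" for e
  proof -
    have "cls e \<in> \<tau> ` cls ` I" unfolding \<tau> using that by (rule imageI)
    then obtain C where C: "C \<in> cls ` I" "cls e = \<tau> C" by (rule imageE)
    then have "link (\<sigma> (\<rho> C)) e"
      using cls[of "\<sigma> (\<rho> C)" e] \<sigma>(1) \<rho>(1) that by (simp add: \<tau>_def)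
    then show ?thesis using C by blast
  qed
  show "\<exists>f\<in>I. N e f" if "e \<in> I" for e
  proof -
    obtain C where "C \<in> cls ` I" "link (\<sigma> (\<rho> C)) e" using key \<open>e \<in> I\<close> by blast
    then have "N e (\<rho> C)" using cong[of "\<sigma> (\<rho> C)" e "\<rho> C"] \<sigma> \<rho>(1) that by simp
    then show ?thesis using \<rho>(1) \<open>C \<in> cls ` I\<close> by blast
  qed
  show "link e e'" if e: "e \<in> I" "e' \<in> I" "f \<in> I" "N e f" "N e' f" for e e' f
  proof -
    obtain C where C: "C \<in> cls ` I" "link (\<sigma> (\<rho> C)) e" using key e by blast
    obtain C' where C': "C' \<in> cls ` I" "link (\<sigma> (\<rho> C')) e'" using key e by blast
    have "N e (\<rho> C)" using cong[of "\<sigma> (\<rho> C)" e "\<rho> C"] \<sigma> \<rho>(1) C e by simp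
    then have "link (\<rho> C) f" using single[of e "\<rho> C" f] \<rho>(1) C(1) e by simp
    have "N e' (\<rho> C')" using cong[of "\<sigma> (\<rho> C')" e' "\<rho> C'"] \<sigma> \<rho>(1) C' e by simp
    then have "link (\<rho> C') f" using single[of e' "\<rho> C'" f] \<rho>(1) C'(1) e by simp
    then have "cls (\<rho> C) = cls (\<rho> C')"
      using \<open>link (\<rho> C) f\<close> cls[of "\<rho> C" f] cls[of "\<rho> C'" f] \<rho>(1) C(1) C'(1) e(3) by simp
    then have "C = C'" using \<rho>(2) C(1) C'(1) by simp
    then show ?thesis
      using C C' e sym[of "\<sigma> (\<rho> C)" e] trans[of e "\<sigma> (\<rho> C)" e'] \<sigma>(1) \<rho>(1) by simp
  qed
qed

section \<open>Isomorphic local idempotents and the nonzero blocks of the socle\<close>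

context semiprimary
begin

text \<open>That is, \<open>Re\<close> and \<open>Rf\<close> are isomorphic, when \<open>e\<close> and \<open>f\<close> are local idempotents.\<close>

definition linked :: "'a \<Rightarrow> 'a \<Rightarrow> bool" where
  "linked e f \<longleftrightarrow> (\<exists>u\<in>carrier R. \<exists>v\<in>carrier R. e \<otimes> u \<otimes> f \<otimes> v \<otimes> e = e)"

lemma linked_refl:
  assumes "e \<in> es"
  shows "linked e e"
  unfolding linked_def using assms by (intro bexI[of _ e]) (simp_all add: es_idem)

text \<open>The element \<open>fveuf\<close> is outside \<open>J\<close>, since inserting it between
  \<open>eu\<close> and \<open>ve\<close> gives \<open>e\<close>. Locality of \<open>f\<close> then
  supplies a left multiple of it equal to \<open>f\<close>.\<close>

lemma linked_sym:
  assumes ef: "e \<in> es" "f \<in> es" and "linked e f"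
  shows "linked f e"
proof -
  obtain u v where [simp]: "u \<in> carrier R" "v \<in> carrier R" and uv: "e \<otimes> u \<otimes> f \<otimes> v \<otimes> e = e"
    using assms(3) unfolding linked_def by blast
  note [simp] = es_closed[OF ef(1)] es_closed[OF ef(2)]
  have "e \<otimes> u \<otimes> (f \<otimes> v \<otimes> e \<otimes> u \<otimes> f) \<otimes> v \<otimes> e = (e \<otimes> u \<otimes> f \<otimes> v \<otimes> e) \<otimes> u \<otimes> f \<otimes> v \<otimes> e"
    by (simp add: m_assoc)
  also have "\<dots> = e" by (simp only: uv)
  finally have "e = e \<otimes> u \<otimes> (f \<otimes> v \<otimes> e \<otimes> u \<otimes> f) \<otimes> v \<otimes> e" ..
  then have "f \<otimes> v \<otimes> e \<otimes> u \<otimes> f \<notin> J"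
    using J_left[of "e \<otimes> u"] J_right[of _ v] J_right[of _ e] es_not_J[OF ef(1)] by (metis \<open>e \<in> carrier R\<close> \<open>u \<in> carrier R\<close> \<open>v \<in> carrier R\<close> m_closed)
  then obtain b where b [simp]: "b \<in> carrier R" and "b \<otimes> (f \<otimes> v \<otimes> e \<otimes> u \<otimes> f) = f"
    using es_left[OF ef(2), of "f \<otimes> v \<otimes> e \<otimes> u"] by auto
  then have "f \<otimes> (b \<otimes> (f \<otimes> v \<otimes> e \<otimes> u \<otimes> f)) = f" using es_idem[OF ef(2)] by simp
  then have "f \<otimes> (b \<otimes> f \<otimes> v) \<otimes> e \<otimes> u \<otimes> f = f" by (simp add: m_assoc)
  then show ?thesis unfolding linked_def by (intro bexI[of _ "b \<otimes> f \<otimes> v"] bexI[of _ u]) auto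
qed

lemma linked_trans:
  assumes e: "e \<in> es" "f \<in> es" "g \<in> es" and "linked e f" "linked f g"
  shows "linked e g"
proof -
  note [simp] = es_closed[OF e(1)] es_closed[OF e(2)] es_closed[OF e(3)]
  obtain u v where [simp]: "u \<in> carrier R" "v \<in> carrier R" and uv: "e \<otimes> u \<otimes> f \<otimes> v \<otimes> e = e"
    using assms(4) unfolding linked_def by blast
  obtain p q where [simp]: "p \<in> carrier R" "q \<in> carrier R" and pq: "f \<otimes> p \<otimes> g \<otimes> q \<otimes> f = f"
    using assms(5) unfolding linked_def by blast
  have "e \<otimes> (u \<otimes> f \<otimes> p) \<otimes> g \<otimes> (q \<otimes> f \<otimes> v) \<otimes> e = e \<otimes> u \<otimes> (f \<otimes> p \<otimes> g \<otimes> q \<otimes> f) \<otimes> v \<otimes> e"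
    by (simp add: m_assoc)
  also have "\<dots> = e" by (simp only: uv pq)
  finally show ?thesis unfolding linked_def
    by (intro bexI[of _ "u \<otimes> f \<otimes> p"] bexI[of _ "q \<otimes> f \<otimes> v"]) auto
qed

end

context semiprimary_automorphism_invariant
begin

lemma socle_component:
  assumes "e \<in> es" "f \<in> es" "s \<in> socle"
  shows "e \<otimes> s \<otimes> f \<in> socle" "e \<otimes> (e \<otimes> s \<otimes> f) = e \<otimes> s \<otimes> f" "e \<otimes> s \<otimes> f \<otimes> f = e \<otimes> s \<otimes> f"
proof -
  have [simp]: "s \<in> carrier R" "e \<in> carrier R" "f \<in> carrier R" using assms socle_carrier by auto
  show "e \<otimes> s \<otimes> f \<in> socle"
    using socle_right[OF left_idealD(4)[OF left_ideal_socle _ assms(3)]] by simp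
  show "e \<otimes> (e \<otimes> s \<otimes> f) = e \<otimes> s \<otimes> f" using es_idem[OF assms(1)] by (simp add: m_assoc[symmetric])
  show "e \<otimes> s \<otimes> f \<otimes> f = e \<otimes> s \<otimes> f" using es_idem[OF assms(2)] by (simp add: m_assoc)
qed

text \<open>Let \<open>N e f\<close> mean \<open>eSf \<noteq> 0\<close>. Every column is nonzero
  since \<open>Rf\<close> meets the essential socle; a row determines its columns up to isomorphism
  by row transitivity and \<open>SJ = 0\<close>; linked rows are nonzero in the same columns. The
  counting lemma then makes every row nonzero, so that each \<open>Re/Je\<close> embeds into
  \<open>R\<close>, and shows that a column determines its rows up to isomorphism.\<close>

lemma socle_blocks:
  shows kasch: "\<And>e. e \<in> es \<Longrightarrow> \<exists>f\<in>es. \<exists>s\<in>socle. e \<otimes> s \<otimes> f \<noteq> \<zero>"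
    and socle_column_linked: "\<And>e e' f. \<lbrakk>e \<in> es; e' \<in> es; f \<in> es; \<exists>s\<in>socle. e \<otimes> s \<otimes> f \<noteq> \<zero>;
      \<exists>s\<in>socle. e' \<otimes> s \<otimes> f \<noteq> \<zero>\<rbrakk> \<Longrightarrow> linked e e'"
proof -
  let ?N = "\<lambda>e f. \<exists>s\<in>socle. e \<otimes> s \<otimes> f \<noteq> \<zero>"
  have surj: "\<exists>e\<in>es. ?N e f" if f: "f \<in> es" for f
  proof -
    have fc: "f \<in> carrier R" "f \<noteq> \<zero>"
      using f es_not_J left_idealD(2)[OF left_ideal_J] by auto
    then obtain a where a: "a \<in> carrier R" "a \<otimes> f \<in> socle" "a \<otimes> f \<noteq> \<zero>"
      using socle_essential_element by blast
    then obtain e where e: "e \<in> es" "e \<otimes> (a \<otimes> f) \<noteq> \<zero>"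
      using left_component_nonzero fc by (metis m_closed)
    have "e \<otimes> (a \<otimes> f) \<otimes> f = e \<otimes> (a \<otimes> f)" using a e fc es_idem[OF f] by (simp add: m_assoc)
    then show ?thesis using a e by metis
  qed
  have single: "linked f f'" if e: "e \<in> es" "f \<in> es" "f' \<in> es" "?N e f" "?N e f'" for e f f'
  proof -
    obtain s t where st: "s \<in> socle" "t \<in> socle" "e \<otimes> s \<otimes> f \<noteq> \<zero>" "e \<otimes> t \<otimes> f' \<noteq> \<zero>"
      using e by blast
    let ?x = "e \<otimes> s \<otimes> f" and ?y = "e \<otimes> t \<otimes> f'"
    note x = socle_component[OF e(1,2) st(1)] and y = socle_component[OF e(1,3) st(2)]
    note [simp] = socle_carrier[OF x(1)] socle_carrier[OF y(1)] es_closed[OF e(2)] es_closed[OF e(3)]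
    obtain r where r [simp]: "r \<in> carrier R" and yr: "?y = ?x \<otimes> r"
      using socle_row_transitive[OF e(1) x(1,2) st(3) y(1,2) st(4)] by blast
    \<comment> \<open>Otherwise \<open>?y\<close>, which is \<open>?x\<close> times this element,
      would lie in \<open>SJ = 0\<close>. Outside \<open>J\<close>, the element links
      \<open>f\<close> to \<open>f'\<close>.\<close>
    have "f \<otimes> (r \<otimes> f') \<notin> J"
    proof
      assume j: "f \<otimes> (r \<otimes> f') \<in> J"
      have "?y = ?x \<otimes> f \<otimes> r \<otimes> f'" using y(3) yr x(3) by simp
      also have "\<dots> = ?x \<otimes> (f \<otimes> (r \<otimes> f'))" by (simp add: m_assoc del: x)
      also have "\<dots> = \<zero>" by (rule socle_J[OF x(1) j])
      finally show False using st(4) by simp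
    qed
    then obtain b where b [simp]: "b \<in> carrier R" and "f \<otimes> (r \<otimes> f') \<otimes> b = f"
      using es_right[OF e(2), of "r \<otimes> f'"] by auto
    then have "f \<otimes> (r \<otimes> f') \<otimes> b \<otimes> f = f" using es_idem[OF e(2)] by simp
    then have "f \<otimes> r \<otimes> f' \<otimes> b \<otimes> f = f" by (simp add: m_assoc)
    then show ?thesis unfolding linked_def using r b by blast
  qed
  have cong: "?N e' f" if e: "e \<in> es" "e' \<in> es" "f \<in> es" "linked e e'" "?N e f" for e e' f
  proof -
    obtain s where s: "s \<in> socle" "e \<otimes> s \<otimes> f \<noteq> \<zero>" using e by blast
    obtain u v where [simp]: "u \<in> carrier R" "v \<in> carrier R" and uv: "e \<otimes> u \<otimes> e' \<otimes> v \<otimes> e = e"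
      using e(4) unfolding linked_def by blast
    note [simp] = socle_carrier[OF s(1)] es_closed[OF e(1)] es_closed[OF e(2)] es_closed[OF e(3)]
    have "e \<otimes> s \<otimes> f = e \<otimes> u \<otimes> e' \<otimes> v \<otimes> e \<otimes> s \<otimes> f" by (simp only: uv)
    also have "\<dots> = e \<otimes> u \<otimes> (e' \<otimes> (v \<otimes> e \<otimes> s) \<otimes> f)" by (simp add: m_assoc)
    finally have "e' \<otimes> (v \<otimes> e \<otimes> s) \<otimes> f \<noteq> \<zero>" using s(2) by auto
    moreover have "v \<otimes> e \<otimes> s \<in> socle" using left_idealD(4)[OF left_ideal_socle _ s(1)] by simp
    ultimately show ?thesis by blast
  qed
  note facts = linked_refl linked_sym linked_trans surj single cong
  show "\<exists>f\<in>es. ?N e f" if "e \<in> es" for e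
    by (rule finite_class_permutation(1)[of es linked ?N, OF finite_es]; fact facts that)
  show "linked e e'" if "e \<in> es" "e' \<in> es" "f \<in> es" "?N e f" "?N e' f" for e e' f
    by (rule finite_class_permutation(2)[of es linked ?N, OF finite_es]; fact facts that)
qed

end

section \<open>Endomorphisms of the socle and left self-injectivity\<close>

context semiprimary_automorphism_invariant
begin

text \<open>The rows that are nonzero in column \<open>f\<close> are all linked to \<open>e\<close>,
  so a component \<open>e'y\<close> can be carried into the block \<open>eSf\<close>, where
  \<open>socle_block_transitive\<close> applies, and carried back by the linking identity.\<close>

lemma socle_column_simple:
  assumes e: "e \<in> es" and f: "f \<in> es"
    and x: "x \<in> socle" "e \<otimes> x = x" "x \<otimes> f = x" "x \<noteq> \<zero>"
    and y: "y \<in> socle" "y \<otimes> f = y"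
  shows "y \<in> (\<lambda>a. a \<otimes> x) ` carrier R"
proof -
  have [simp]: "x \<in> carrier R" "y \<in> carrier R" "e \<in> carrier R" "f \<in> carrier R"
    using x y e f socle_carrier by auto
  have L: "left_ideal R ((\<lambda>a. a \<otimes> x) ` carrier R)"
    by (intro left_ideal_mult_right left_ideal_carrier) simp
  have "e' \<otimes> y \<in> (\<lambda>a. a \<otimes> x) ` carrier R" if e': "e' \<in> es" for e'
  proof (cases "e' \<otimes> y = \<zero>")
    case True
    then show ?thesis using left_idealD(2)[OF L] by simp
  next
    case False
    have [simp]: "e' \<in> carrier R" using e' by simp
    have "e \<otimes> x \<otimes> f \<noteq> \<zero>" using x by simp
    moreover have "e' \<otimes> y \<otimes> f \<noteq> \<zero>" using False y by (simp add: m_assoc)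
    ultimately have "linked e' e"
      using socle_column_linked[OF e' e f] x(1) y(1) by blast
    then obtain u v where [simp]: "u \<in> carrier R" "v \<in> carrier R" and uv: "e' \<otimes> u \<otimes> e \<otimes> v \<otimes> e' = e'"
      unfolding linked_def by blast
    let ?z = "e \<otimes> v \<otimes> e' \<otimes> y"
    have "e' \<otimes> u \<otimes> ?z = e' \<otimes> u \<otimes> e \<otimes> v \<otimes> e' \<otimes> y" by (simp add: m_assoc)
    then have z: "e' \<otimes> u \<otimes> ?z = e' \<otimes> y" by (simp only: uv)
    then have "?z \<noteq> \<zero>" using False by auto
    moreover have "?z \<in> socle" using left_idealD(4)[OF left_ideal_socle _ y(1)] by simp
    moreover have "e \<otimes> ?z = ?z" using es_idem[OF e] by (simp add: m_assoc[symmetric])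
    moreover have "?z \<otimes> f = ?z" using y(2) by (simp add: m_assoc)
    ultimately have "?z \<in> (\<lambda>a. a \<otimes> x) ` carrier R"
      using socle_block_transitive[OF e f x] by blast
    then show ?thesis using left_idealD(4)[OF L, of "e' \<otimes> u" ?z] z by simp
  qed
  note * = this
  show ?thesis
    by (rule sum_left_mem[OF _ left_idealD(2)[OF L] left_idealD(3)[OF L] _ *])
      (use left_idealD(1)[OF L] in simp_all, blast)
qed

text \<open>A nonzero column \<open>Sf\<close> is generated by one element \<open>x\<close> of a row
  \<open>eS\<close>. Since \<open>\<psi> x\<close> stays in that row, row transitivity writes it as
  \<open>xr\<close>, and linearity extends this to the column; \<open>glue_right\<close> then
  combines the columns.\<close>

lemma socle_endomorphism_right_mult:
  assumes closed: "\<And>s. s \<in> socle \<Longrightarrow> \<psi> s \<in> socle"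
    and add: "\<And>s t. \<lbrakk>s \<in> socle; t \<in> socle\<rbrakk> \<Longrightarrow> \<psi> (s \<oplus> t) = \<psi> s \<oplus> \<psi> t"
    and mult: "\<And>a s. \<lbrakk>a \<in> carrier R; s \<in> socle\<rbrakk> \<Longrightarrow> \<psi> (a \<otimes> s) = a \<otimes> \<psi> s"
  shows "\<exists>r\<in>carrier R. \<forall>s\<in>socle. \<psi> s = s \<otimes> r"
proof -
  note SD = left_idealD[OF left_ideal_socle]
  have z: "\<psi> \<zero> = \<zero>" using mult[of \<zero> \<zero>] SD(2) closed[OF SD(2)] SD(1) by simp
  have "\<exists>r\<in>carrier R. \<forall>s\<in>socle. s \<otimes> f = s \<longrightarrow> \<psi> s = s \<otimes> r" if f: "f \<in> es" for f
  proof (cases "\<exists>s\<in>socle. s \<otimes> f \<noteq> \<zero>")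
    case False
    have "s = \<zero>" if "s \<in> socle" "s \<otimes> f = s" for s using False that by force
    then have "\<psi> s = s \<otimes> \<zero>" if "s \<in> socle" "s \<otimes> f = s" for s using z that by force
    then show ?thesis by blast
  next
    case True
    then obtain s where s: "s \<in> socle" "s \<otimes> f \<noteq> \<zero>" by blast
    have [simp]: "s \<in> carrier R" "f \<in> carrier R" using s(1) socle_carrier f by auto
    obtain e where e: "e \<in> es" "e \<otimes> (s \<otimes> f) \<noteq> \<zero>" using left_component_nonzero[OF _ s(2)] by auto
    define x where "x = e \<otimes> s \<otimes> f"
    have x: "x \<in> socle" "e \<otimes> x = x" "x \<otimes> f = x" "x \<noteq> \<zero>"
      using socle_component[OF e(1) f s(1)] e by (simp_all add: x_def m_assoc)
    have [simp]: "x \<in> carrier R" using x(1) socle_carrier by simp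
    have \<psi>x: "\<psi> x \<in> socle" "e \<otimes> \<psi> x = \<psi> x"
      using closed[OF x(1)] mult[of e x] x e(1) by auto
    have "\<exists>r\<in>carrier R. \<psi> x = x \<otimes> r"
    proof (cases "\<psi> x = \<zero>")
      case True
      then show ?thesis by (intro bexI[of _ \<zero>]) simp_all
    next
      case False
      then show ?thesis using socle_row_transitive[OF e(1) x(1,2,4) \<psi>x] by blast
    qed
    then obtain r where r: "r \<in> carrier R" "\<psi> x = x \<otimes> r" by blast
    have "\<psi> t = t \<otimes> r" if t: "t \<in> socle" "t \<otimes> f = t" for t
    proof -
      obtain a where a: "a \<in> carrier R" "t = a \<otimes> x"
        using socle_column_simple[OF e(1) f x t] by blast
      then show ?thesis using mult[OF a(1) x(1)] r by (simp add: m_assoc)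
    qed
    then show ?thesis using r(1) by blast
  qed
  then obtain \<rho> where \<rho>: "\<And>f. f \<in> es \<Longrightarrow> \<rho> f \<in> carrier R"
    "\<And>f s. \<lbrakk>f \<in> es; s \<in> socle; s \<otimes> f = s\<rbrakk> \<Longrightarrow> \<psi> s = s \<otimes> \<rho> f" by metis
  obtain r where r [simp]: "r \<in> carrier R" and rf: "\<And>f. f \<in> es \<Longrightarrow> f \<otimes> r = f \<otimes> \<rho> f"
    using glue_right[of \<rho>] \<rho>(1) by blast
  let ?A = "{s \<in> socle. \<psi> s = s \<otimes> r}"
  have "s \<in> ?A" if s: "s \<in> socle" for s
  proof (rule sum_right_mem[of ?A s])
    show "?A \<subseteq> carrier R" using socle_carrier by blast
    show "\<zero> \<in> ?A" using z SD(2) by simp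
    show "x \<oplus> y \<in> ?A" if "x \<in> ?A" "y \<in> ?A" for x y
      using that SD(1,3) add by (simp add: l_distr)
    show "s \<otimes> f \<in> ?A" if f: "f \<in> es" for f
    proof -
      have c [simp]: "s \<in> carrier R" "f \<in> carrier R" "\<rho> f \<in> carrier R" using s socle_carrier f \<rho>(1) by auto
      have sf: "s \<otimes> f \<in> socle" "s \<otimes> f \<otimes> f = s \<otimes> f"
        using socle_right[OF s c(2)] es_idem[OF f] by (simp_all add: m_assoc)
      then have "\<psi> (s \<otimes> f) = s \<otimes> f \<otimes> \<rho> f" using \<rho>(2)[OF f] by simp
      also have "\<dots> = s \<otimes> f \<otimes> r" using rf[OF f] by (simp add: m_assoc)
      finally show ?thesis using sf by simp
    qed
  qed (use s socle_carrier in auto)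
  then show ?thesis using r by blast
qed

text \<open>\<open>E\<close> has no socle beyond that of \<open>R\<close>: for nonzero
  \<open>w = esv\<close> the module \<open>Rw\<close> is simple and meets the image of
  \<open>R\<close> by essentiality, so it lies in that image.\<close>

lemma socle_smult_envelope:
  assumes v: "v \<in> carrier E" and s: "s \<in> socle"
  shows "\<exists>t\<in>socle. i t = s \<odot>\<^bsub>E\<^esub> v"
proof -
  note SD = left_idealD[OF left_ideal_socle]
  let ?A = "{s \<in> socle. \<exists>t\<in>socle. i t = s \<odot>\<^bsub>E\<^esub> v}"
  have "s \<in> ?A"
  proof (rule sum_left_mem)
    show "?A \<subseteq> carrier R" using socle_carrier by blast
    show "\<zero> \<in> ?A" using SD(2) v by (auto intro!: bexI[of _ \<zero>])
    show "x \<oplus> y \<in> ?A" if xy: "x \<in> ?A" "y \<in> ?A" for x y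
    proof -
      obtain t u where "t \<in> socle" "i t = x \<odot>\<^bsub>E\<^esub> v" "u \<in> socle" "i u = y \<odot>\<^bsub>E\<^esub> v"
        using xy by blast
      then show ?thesis
        using xy SD(1,3) v by (auto intro!: bexI[of _ "t \<oplus> u"] simp: i_add E.smult_l_distr)
    qed
    show "s \<in> carrier R" using s socle_carrier by blast
    show "e \<otimes> s \<in> ?A" if e: "e \<in> es" for e
    proof -
      have [simp]: "s \<in> carrier R" "e \<in> carrier R" using s socle_carrier e by auto
      have es: "e \<otimes> s \<in> socle" using SD(4)[OF _ s] by simp
      define w where "w = (e \<otimes> s) \<odot>\<^bsub>E\<^esub> v"
      have [simp]: "w \<in> carrier E" using v by (simp add: w_def)
      have "\<exists>t\<in>socle. i t = w"
      proof (cases "w = \<zero>\<^bsub>E\<^esub>")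
        case True
        then show ?thesis using SD(2) by (intro bexI[of _ \<zero>]) simp_all
      next
        case False
        let ?K = "(\<lambda>a. a \<odot>\<^bsub>E\<^esub> w) ` carrier R"
        have "submodule ?K R E"
        proof (rule E.left_submoduleI)
          show "\<zero>\<^bsub>E\<^esub> \<in> ?K" by (rule image_eqI[of _ _ \<zero>]) auto
          show "x \<oplus>\<^bsub>E\<^esub> y \<in> ?K" if "x \<in> ?K" "y \<in> ?K" for x y
          proof -
            have "\<exists>a\<in>carrier R. \<exists>b\<in>carrier R. x = a \<odot>\<^bsub>E\<^esub> w \<and> y = b \<odot>\<^bsub>E\<^esub> w" using that by blast
            then show ?thesis by (auto simp flip: E.smult_l_distr)
          qed
        qed (auto simp flip: E.smult_assoc1)
        moreover have "w \<in> ?K" by (rule image_eqI[of _ _ \<one>]) auto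
        then have "?K \<noteq> {\<zero>\<^bsub>E\<^esub>}" using False by blast
        ultimately obtain x where x: "x \<in> carrier R" "x \<noteq> \<zero>" "i x \<in> ?K" using i_essential by blast
        then obtain a where a [simp]: "a \<in> carrier R" and ia: "i x = a \<odot>\<^bsub>E\<^esub> w" by blast
        \<comment> \<open>Because \<open>aw\<close> is nonzero, \<open>ae\<close> is outside
          \<open>J\<close> and can be undone by some \<open>b\<close>, which puts \<open>w\<close>
          itself into the image of \<open>R\<close>.\<close>
        have "a \<otimes> e \<notin> J"
        proof
          assume "a \<otimes> e \<in> J"
          then have "a \<otimes> e \<otimes> s = \<zero>" using s by (simp add: socle_def)
          then have "i x = \<zero>\<^bsub>E\<^esub>" using ia v by (simp add: w_def m_assoc flip: E.smult_assoc1)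
          then show False using x i_inj[of x \<zero>] by simp
        qed
        then obtain b where b [simp]: "b \<in> carrier R" and bae: "b \<otimes> (a \<otimes> e) = e"
          using es_left[OF e a] by blast
        have "i (b \<otimes> x) = (b \<otimes> (a \<otimes> e) \<otimes> s) \<odot>\<^bsub>E\<^esub> v"
          using x v ia by (simp add: i_mult w_def m_assoc E.smult_assoc1)
        then have ibx: "i (b \<otimes> x) = w" unfolding bae w_def .
        have "j \<otimes> (b \<otimes> x) = \<zero>" if j: "j \<in> J" for j
        proof -
          have jc: "j \<in> carrier R" using j J_carrier by blast
          have "j \<otimes> (e \<otimes> s) = \<zero>" using es j by (simp add: socle_def)
          then have "j \<odot>\<^bsub>E\<^esub> w = \<zero>\<^bsub>E\<^esub>" using jc v by (simp add: w_def flip: E.smult_assoc1)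
          then have "i (j \<otimes> (b \<otimes> x)) = i \<zero>" using jc x ibx by (simp add: i_mult)
          then show ?thesis using i_inj[of "j \<otimes> (b \<otimes> x)" \<zero>] jc x(1) by simp
        qed
        then have "b \<otimes> x \<in> socle" using x by (simp add: socle_def)
        then show ?thesis using ibx by blast
      qed
      then show ?thesis using es by (simp add: w_def)
    qed
  qed
  then show ?thesis by blast
qed

lemma i_surj:
  assumes v: "v \<in> carrier E"
  shows "v \<in> i ` carrier R"
proof -
  note SD = left_idealD[OF left_ideal_socle]
  obtain \<psi> where \<psi>: "\<And>s. s \<in> socle \<Longrightarrow> \<psi> s \<in> socle" "\<And>s. s \<in> socle \<Longrightarrow> i (\<psi> s) = s \<odot>\<^bsub>E\<^esub> v"
    using socle_smult_envelope[OF v] by metis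
  have \<psi>C: "\<psi> s \<in> carrier R" if "s \<in> socle" for s using that \<psi>(1) socle_carrier by blast
  have "\<exists>r\<in>carrier R. \<forall>s\<in>socle. \<psi> s = s \<otimes> r"
  proof (rule socle_endomorphism_right_mult[OF \<psi>(1)])
    show "\<psi> (s \<oplus> t) = \<psi> s \<oplus> \<psi> t" if st: "s \<in> socle" "t \<in> socle" for s t
      using st SD(1,3) \<psi>C v by (intro i_inj) (auto simp: i_add \<psi>(2) E.smult_l_distr)
    show "\<psi> (a \<otimes> s) = a \<otimes> \<psi> s" if "a \<in> carrier R" "s \<in> socle" for a s
      using that SD(1,4) \<psi>C v by (intro i_inj) (auto simp: i_mult \<psi>(2) E.smult_assoc1)
  qed
  then obtain r where r [simp]: "r \<in> carrier R" and \<psi>r: "\<And>s. s \<in> socle \<Longrightarrow> \<psi> s = s \<otimes> r" by blast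
  define w where "w = v \<oplus>\<^bsub>E\<^esub> i (\<ominus> r)"
  \<comment> \<open>As \<open>w\<close> kills the socle, \<open>x \<mapsto> i x + xw\<close> is again an essential embedding of \<open>R\<close> into \<open>E\<close>.\<close>
  have w [simp]: "w \<in> carrier E" using v by (simp add: w_def)
  have sw: "s \<odot>\<^bsub>E\<^esub> w = \<zero>\<^bsub>E\<^esub>" if s: "s \<in> socle" for s
  proof -
    have sc: "s \<in> carrier R" using s SD(1) by blast
    have "s \<odot>\<^bsub>E\<^esub> w = i (\<psi> s) \<oplus>\<^bsub>E\<^esub> i (s \<otimes> \<ominus> r)"
      using sc v by (simp add: w_def E.smult_r_distr \<psi>(2)[OF s] i_mult)
    also have "\<dots> = i (s \<otimes> r \<oplus> s \<otimes> \<ominus> r)" using sc by (simp add: \<psi>r[OF s] i_add)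
    also have "\<dots> = \<zero>\<^bsub>E\<^esub>" using sc by (simp add: r_minus r_neg)
    finally show ?thesis .
  qed
  define k where "k x = i x \<oplus>\<^bsub>E\<^esub> x \<odot>\<^bsub>E\<^esub> w" for x
  have RR: "(regular_module R)\<lparr>carrier := carrier R\<rparr> = regular_module R"
    by (simp add: regular_module_def)
  have RM: "left_module R (regular_module R)" by (rule left_module_regular) (rule ring_axioms)
  have kh: "k \<in> module_hom R (regular_module R) E"
    by (auto simp: module_hom_def k_def i_add i_mult E.smult_l_distr E.smult_r_distr E.smult_assoc1
        E.M.a_ac)
  note kD = module_homD[OF kh, simplified]
  have ks: "k s = i s" if "s \<in> socle" for s
    using that sw SD(1) by (simp add: k_def)
  have "inj_on k (carrier (regular_module R))"
  proof (rule module_hom_inj[OF RM E(1) kh])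
    fix x assume x: "x \<in> carrier (regular_module R)" "k x = \<zero>\<^bsub>E\<^esub>"
    show "x = \<zero>\<^bsub>regular_module R\<^esub>"
    proof (rule ccontr)
      assume "x \<noteq> \<zero>\<^bsub>regular_module R\<^esub>"
      then obtain a where a: "a \<in> carrier R" "a \<otimes> x \<in> socle" "a \<otimes> x \<noteq> \<zero>"
        using socle_essential_element x by auto
      then have "i (a \<otimes> x) = a \<odot>\<^bsub>E\<^esub> k x" using ks[OF a(2)] kD(3)[OF a(1), of x] x(1) by simp
      then show False using a x i_inj[of "a \<otimes> x" \<zero>] by simp
    qed
  qed
  then have km: "k \<in> module_mono R ((regular_module R)\<lparr>carrier := carrier R\<rparr>) E"
    using kh by (simp add: module_mono_def RR)
  have "essential_submodule (k ` carrier R) R E"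
    unfolding essential_submodule_def
  proof (intro conjI allI impI)
    show "submodule (k ` carrier R) R E"
    proof (rule E.left_submoduleI)
      show "k ` carrier R \<subseteq> carrier E" using kD(1) by blast
      show "\<zero>\<^bsub>E\<^esub> \<in> k ` carrier R" by (rule image_eqI[of _ _ \<zero>]) (simp_all add: ks[OF SD(2)])
      show "x \<oplus>\<^bsub>E\<^esub> y \<in> k ` carrier R" if "x \<in> k ` carrier R" "y \<in> k ` carrier R" for x y
      proof -
        have "\<exists>a\<in>carrier R. \<exists>b\<in>carrier R. x = k a \<and> y = k b" using that by blast
        then show ?thesis by (auto simp flip: kD(2))
      qed
      show "a \<odot>\<^bsub>E\<^esub> x \<in> k ` carrier R" if "a \<in> carrier R" "x \<in> k ` carrier R" for a x
        using that by (auto simp flip: kD(3))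
    qed
    fix K assume K: "submodule K R E" "K \<inter> k ` carrier R = {\<zero>\<^bsub>E\<^esub>}"
    \<comment> \<open>On the socle \<open>k\<close> agrees with \<open>i\<close>, so the image of
      \<open>k\<close> contains the image of the socle, which is already essential in
      \<open>E\<close>.\<close>
    have "i ` socle \<subseteq> k ` carrier R"
    proof
      fix z assume "z \<in> i ` socle"
      then obtain s where "s \<in> socle" "z = i s" by blast
      then show "z \<in> k ` carrier R" using ks SD(1) by (intro image_eqI[of _ _ s]) auto
    qed
    moreover have "\<zero>\<^bsub>E\<^esub> \<in> i ` socle" using SD(2) by (intro image_eqI[of _ _ \<zero>]) auto
    ultimately have "K \<inter> i ` socle = {\<zero>\<^bsub>E\<^esub>}" using K(2) by blast
    then show "K = {\<zero>\<^bsub>E\<^esub>}"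
      using essential_submodule_image[OF essential_socle] K(1) by (simp add: essential_submodule_def)
  qed
  moreover have "essential_left_ideal R (carrier R)"
    unfolding essential_left_ideal_def
  proof (intro conjI allI impI left_ideal_carrier)
    fix L assume "left_ideal R L" "L \<inter> carrier R = {\<zero>}"
    then show "L = {\<zero>}" by (auto simp: left_ideal_def)
  qed
  ultimately obtain r' where r': "r' \<in> carrier R" "\<And>d. d \<in> carrier R \<Longrightarrow> k d = d \<odot>\<^bsub>E\<^esub> i r'"
    using monomorphism_right_mult[OF _ km] by blast
  \<comment> \<open>From \<open>k \<one> = i r'\<close> it follows that \<open>w\<close> is the
    image of \<open>r' - 1\<close>, and \<open>v\<close> is \<open>w\<close> plus the image of
    \<open>r\<close>.\<close>
  have "v = w \<oplus>\<^bsub>E\<^esub> i r"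
    using v by (simp add: w_def E.M.a_assoc l_neg flip: i_add)
  also have "w = i (\<ominus> \<one>) \<oplus>\<^bsub>E\<^esub> k \<one>"
    by (simp add: k_def E.M.a_assoc[symmetric] l_neg flip: i_add)
  also have "k \<one> = i r'" using r' by simp
  finally have "v = i (\<ominus> \<one> \<oplus> r' \<oplus> r)" using r'(1) by (simp add: i_add)
  then show ?thesis by (rule image_eqI) (use r'(1) in simp)
qed

text \<open>As \<open>i\<close> is onto, the regular module inherits the extension property of
  \<open>E\<close> through the inverse map \<open>p\<close>.\<close>

lemma left_self_injective: "left_self_injective R"
  unfolding left_self_injective_def injective_module_def extension_property_def
proof (intro conjI allI impI ballI)
  show RM: "left_module R (regular_module R)" by (rule left_module_regular) (rule ring_axioms)
  fix A B :: "('a, 'a) module" and h f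
  assume A: "left_module R A" and B: "left_module R B" and h: "h \<in> module_mono R A B"
    and f: "f \<in> module_hom R A (regular_module R)"
  have "(\<lambda>x. i (f x)) \<in> module_hom R A E"
    using module_homD[OF f] by (auto simp: module_hom_def i_add i_mult)
  from bspec[OF bspec[OF injective_module_extension[OF E(2) A B, unfolded extension_property_def] h] this]
  obtain g where g: "g \<in> module_hom R B E" and gh: "\<forall>x\<in>carrier A. g (h x) = i (f x)" by blast
  define p where "p v = (SOME x. x \<in> carrier R \<and> i x = v)" for v
  have p: "p v \<in> carrier R" "i (p v) = v" if "v \<in> carrier E" for v
    using someI_ex[of "\<lambda>x. x \<in> carrier R \<and> i x = v"] i_surj[OF that] unfolding p_def by blast+
  note gD = module_homD[OF g]
  interpret B: left_module R B by fact
  have "(\<lambda>x. p (g x)) \<in> module_hom R B (regular_module R)"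
    unfolding module_hom_def
  proof (intro CollectI conjI ballI)
    show "(\<lambda>x. p (g x)) \<in> carrier B \<rightarrow> carrier (regular_module R)" using p gD(1) by auto
    fix x y assume "x \<in> carrier B" "y \<in> carrier B"
    then show "p (g (x \<oplus>\<^bsub>B\<^esub> y)) = p (g x) \<oplus>\<^bsub>regular_module R\<^esub> p (g y)"
      using p gD(1,2) by (intro i_inj) (auto simp: i_add)
  next
    fix a x assume "a \<in> carrier R" "x \<in> carrier B"
    then show "p (g (a \<odot>\<^bsub>B\<^esub> x)) = a \<odot>\<^bsub>regular_module R\<^esub> p (g x)"
      using p gD(1,3) by (intro i_inj) (auto simp: i_mult)
  qed
  moreover have "p (g (h x)) = f x" if "x \<in> carrier A" for x
    using that gh p module_homD(1)[OF f that] by (intro i_inj) auto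
  ultimately show "\<exists>g\<in>module_hom R B (regular_module R). \<forall>x\<in>carrier A. g (h x) = f x"
    by (intro bexI[of _ "\<lambda>x. p (g x)"]) auto
qed

end

section \<open>Annihilators and chain conditions\<close>

definition left_acc :: "('a, 'r) ring_scheme \<Rightarrow> bool" where
  "left_acc R \<longleftrightarrow> (\<forall>N :: nat \<Rightarrow> 'a set. (\<forall>n. left_ideal R (N n)) \<and> (\<forall>n. N n \<subseteq> N (Suc n)) \<longrightarrow>
        (\<exists>m. \<forall>n\<ge>m. N n = N m))"

inductive left_fg :: "('a, 'r) ring_scheme \<Rightarrow> 'a set \<Rightarrow> bool" for R where
  zero: "left_fg R {\<zero>\<^bsub>R\<^esub>}"
| add: "\<lbrakk>left_fg R N; x \<in> carrier R\<rbrakk> \<Longrightarrow>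
    left_fg R {a \<otimes>\<^bsub>R\<^esub> x \<oplus>\<^bsub>R\<^esub> n | a n. a \<in> carrier R \<and> n \<in> N}"

context ring
begin

lemma left_fg_left_ideal: "left_fg R N \<Longrightarrow> left_ideal R N"
  by (induction rule: left_fg.induct) (auto intro: left_ideal_zero left_ideal_add_principal)

lemma add_principal_superset:
  assumes "left_ideal R N" "x \<in> carrier R"
  shows "N \<subseteq> {a \<otimes> x \<oplus> n | a n. a \<in> carrier R \<and> n \<in> N}"
    and "x \<in> {a \<otimes> x \<oplus> n | a n. a \<in> carrier R \<and> n \<in> N}"
proof -
  show "N \<subseteq> {a \<otimes> x \<oplus> n | a n. a \<in> carrier R \<and> n \<in> N}"
  proof
    fix n assume "n \<in> N"
    then show "n \<in> {a \<otimes> x \<oplus> n | a n. a \<in> carrier R \<and> n \<in> N}"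
      using assms left_idealD(1)[OF assms(1)] by (intro CollectI exI[of _ \<zero>] exI[of _ n]) auto
  qed
  show "x \<in> {a \<otimes> x \<oplus> n | a n. a \<in> carrier R \<and> n \<in> N}"
    using assms left_idealD(2)[OF assms(1)] by (intro CollectI exI[of _ \<one>] exI[of _ \<zero>]) auto
qed

lemma left_acc_if_fg:
  assumes fg: "\<And>L. left_ideal R L \<Longrightarrow> left_fg R L"
  shows "left_acc R"
  unfolding left_acc_def
proof (intro allI impI, elim conjE)
  fix N :: "nat \<Rightarrow> 'a set" assume N: "\<forall>n. left_ideal R (N n)" "\<forall>n. N n \<subseteq> N (Suc n)"
  have mono: "N m \<subseteq> N n" if "m \<le> n" for m n
    using lift_Suc_mono_le[of N] N(2) that by blast
  note ND = left_idealD[OF N(1)[rule_format]]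
  have "left_ideal R (\<Union>n. N n)"
  proof (rule left_idealI)
    show "(\<Union>n. N n) \<subseteq> carrier R" using ND(1) by blast
    show "\<zero> \<in> (\<Union>n. N n)" using ND(2) by blast
    fix x y assume "x \<in> (\<Union>n. N n)" "y \<in> (\<Union>n. N n)"
    then obtain m n where "x \<in> N m" "y \<in> N n" by blast
    then have "x \<in> N (max m n)" "y \<in> N (max m n)" using mono[of m "max m n"] mono[of n "max m n"] by auto
    then show "x \<oplus> y \<in> (\<Union>n. N n)" using ND(3) by blast
  next
    fix a x assume "a \<in> carrier R" "x \<in> (\<Union>n. N n)"
    then show "a \<otimes> x \<in> (\<Union>n. N n)" using ND(4) by blast
  qed
  then have "left_fg R (\<Union>n. N n)" by (rule fg)
  moreover have "\<exists>m. L \<subseteq> N m" if "left_fg R L" "L \<subseteq> (\<Union>n. N n)" for L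
    using that
  proof (induction rule: left_fg.induct)
    case zero
    then show ?case using ND(2) by blast
  next
    case (add L x)
    note sup = add_principal_superset[OF left_fg_left_ideal[OF add(1)] add(2)]
    obtain m where m: "L \<subseteq> N m" using add.IH[OF subset_trans[OF sup(1) add.prems]] ..
    have "x \<in> (\<Union>n. N n)" by (rule subsetD[OF add.prems sup(2)])
    then obtain n where n: "x \<in> N n" by blast
    have "L \<subseteq> N (max m n)" "x \<in> N (max m n)"
      using m n mono[of m "max m n"] mono[of n "max m n"] by auto
    then have "{a \<otimes> x \<oplus> n | a n. a \<in> carrier R \<and> n \<in> L} \<subseteq> N (max m n)"
      using ND(3,4) by blast
    then show ?case by blast
  qed
  ultimately obtain m where "(\<Union>n. N n) \<subseteq> N m" by blast
  then have "\<forall>n\<ge>m. N n = N m" using mono by blast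
  then show "\<exists>m. \<forall>n\<ge>m. N n = N m" by blast
qed

end

text \<open>Hopkins--Levitzki: a minimal counterexample \<open>M\<close> has a maximal submodule, because
  \<open>M/JM\<close> is a nonzero module over a semisimple ring, and a submodule that is proper is finitely
  generated by minimality.\<close>

lemma (in semiprimary) left_fg_if_dcc:
  assumes dcc: "left_dcc R" and "left_ideal R M"
  shows "left_fg R M"
proof (rule ccontr)
  assume "\<not> left_fg R M"
  from left_dcc_minimal[where P = "\<lambda>L. \<not> left_fg R L", OF dcc this assms(2)]
  obtain M where M: "left_ideal R M" "\<not> left_fg R M"
    and min: "\<And>L. \<lbrakk>left_ideal R L; \<not> left_fg R L; L \<subseteq> M\<rbrakk> \<Longrightarrow> L = M" by blast
  note MD = left_idealD[OF M(1)]
  define JM where "JM = \<Inter>{L. left_ideal R L \<and> (\<forall>j\<in>J. \<forall>m\<in>M. j \<otimes> m \<in> L)}"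
  have JM: "j \<otimes> m \<in> JM" if "j \<in> J" "m \<in> M" for j m using that by (auto simp: JM_def)
  have JMleast: "JM \<subseteq> L" if "left_ideal R L" "\<And>j m. \<lbrakk>j \<in> J; m \<in> M\<rbrakk> \<Longrightarrow> j \<otimes> m \<in> L" for L
    using that by (auto simp: JM_def)
  have JMM: "JM \<subseteq> M" using MD(4) J_carrier by (intro JMleast M(1)) blast
  have JMI: "left_ideal R JM"
  proof (rule left_idealI)
    show "JM \<subseteq> carrier R" using JMM MD(1) by blast
  qed (auto simp: JM_def dest: left_idealD)
  note JMD = left_idealD[OF JMI]
  have "\<not> M \<subseteq> JM"
  proof
    assume MJ: "M \<subseteq> JM"
    let ?Z = "\<lambda>l. \<forall>p\<in>products R J l. \<forall>m\<in>M. p \<otimes> m = \<zero>"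
    have JC: "J \<subseteq> carrier R" using J_carrier by blast
    \<comment> \<open>Nakayama's lemma: if \<open>M\<close> lies in \<open>JM\<close>, vanishing of
      the products of length \<open>Suc l\<close> on \<open>M\<close> descends to length
      \<open>l\<close>, and at length zero \<open>M\<close> itself vanishes.\<close>
    have step: "?Z l" if Z: "?Z (Suc l)" for l
    proof -
      \<comment> \<open>The inserted \<open>a\<close> makes this set a left ideal, so that it
        contains \<open>JM\<close> once it contains the products \<open>jm\<close>.\<close>
      let ?L = "{m \<in> carrier R. \<forall>p\<in>products R J l. \<forall>a\<in>carrier R. p \<otimes> a \<otimes> m = \<zero>}"
      have pc: "\<And>p. p \<in> products R J l \<Longrightarrow> p \<in> carrier R" using products_carrier[OF JC] .
      have "left_ideal R ?L"
      proof (rule left_idealI)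
        fix c m assume "c \<in> carrier R" "m \<in> ?L"
        moreover from this have "p \<otimes> a \<otimes> (c \<otimes> m) = p \<otimes> (a \<otimes> c) \<otimes> m"
          if "p \<in> products R J l" "a \<in> carrier R" for p a
          using that pc by (simp add: m_assoc)
        ultimately show "c \<otimes> m \<in> ?L" by simp
      qed (use pc in \<open>auto simp: r_distr\<close>)
      moreover have "j \<otimes> m \<in> ?L" if jm: "j \<in> J" "m \<in> M" for j m
      proof -
        have c: "j \<in> carrier R" "m \<in> carrier R" using jm J_carrier MD(1) by auto
        have "p \<otimes> a \<otimes> (j \<otimes> m) = \<zero>" if p: "p \<in> products R J l" "a \<in> carrier R" for p a
        proof -
          have "p \<otimes> (a \<otimes> j) \<in> products R J (Suc l)" using p J_left[OF p(2) jm(1)] by auto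
          then have "p \<otimes> (a \<otimes> j) \<otimes> m = \<zero>" using Z jm(2) by blast
          then show ?thesis using p c pc by (simp add: m_assoc)
        qed
        then show ?thesis using c by simp
      qed
      ultimately have "M \<subseteq> ?L" using JMleast[of ?L] MJ by blast
      then have "p \<otimes> m = \<zero>" if "p \<in> products R J l" "m \<in> M" for p m
        using that pc[OF that(1)] by (auto dest!: subsetD bspec[OF _ one_closed])
      then show ?thesis by blast
    qed
    obtain k where "products R J k \<subseteq> {\<zero>}" using nilpotent by blast
    then have "?Z k" using MD(1) by auto
    then have "?Z 0" by (induction k) (use step in blast)+
    then have "M \<subseteq> {\<zero>}" using MD(1) by auto
    then have "M = {\<zero>}" using MD(2) by blast
    then show False using M(2) left_fg.zero by metis
  qed
  then obtain x0 where x0: "x0 \<in> M" "x0 \<notin> JM" by blast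
  then obtain e where e: "e \<in> es" "e \<otimes> x0 \<notin> JM"
    using sum_left_mem[of JM x0] JMD MD(1) by blast
  define x where "x = e \<otimes> x0"
  have x: "x \<in> M" "x \<notin> JM" "x \<in> carrier R" using e x0 MD(1,4) by (auto simp: x_def)
  have "JM \<inter> {x} = {}" using x by blast
  then obtain N where N: "left_ideal R N" "JM \<subseteq> N" "N \<inter> {x} = {}"
    and Nmax: "\<And>C. \<lbrakk>left_ideal R C; N \<subseteq> C; C \<inter> {x} = {}\<rbrakk> \<Longrightarrow> C = N"
    using maximal_left_ideal_disjoint[OF JMI] by metis
  note ND = left_idealD[OF N(1)]
  have NM: "left_ideal R (N \<inter> M)" by (intro left_ideal_Int N(1) M(1))
  have "N \<inter> M \<noteq> M" using x N(3) by blast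
  then have fg: "left_fg R (N \<inter> M)" using min[OF NM] by blast
  let ?A = "{a \<otimes> x \<oplus> n | a n. a \<in> carrier R \<and> n \<in> N \<inter> M}"
  note AD = left_idealD[OF left_ideal_add_principal[OF NM x(3)]]
  have "?A = M"
  proof
    show "?A \<subseteq> M" using MD(3,4) x by blast
    show "M \<subseteq> ?A"
    proof
      fix z assume z: "z \<in> M"
      have zc: "z \<in> carrier R" using z MD(1) by blast
      show "z \<in> ?A"
      proof (rule sum_left_mem[OF _ AD(2) AD(3) zc])
        show "?A \<subseteq> carrier R" using AD(1) by blast
        fix f assume f: "f \<in> es"
        let ?y = "f \<otimes> z"
        have y: "?y \<in> M" "?y \<in> carrier R" using z f MD(1,4) by auto
        let ?C = "{a \<otimes> ?y \<oplus> n | a n. a \<in> carrier R \<and> n \<in> N}"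
        note C = add_principal_superset[OF N(1) y(2)]
        show "?y \<in> ?A"
        \<comment> \<open>Adding \<open>fz\<close> to \<open>N\<close> either keeps \<open>x\<close>
          out, so that \<open>fz\<close> is already in \<open>N\<close>, or yields
          \<open>x = afz + n\<close>. In the second case \<open>af\<close> is outside
          \<open>J\<close>, because \<open>JM\<close> lies in \<open>N\<close>, and undoing it
          expresses \<open>fz\<close> through \<open>x\<close> and \<open>N\<close>.\<close>
        proof (cases "?C \<inter> {x} = {}")
          case True
          have "?C = N" by (rule Nmax[OF left_ideal_add_principal[OF N(1) y(2)] C(1) True])
          then have "?y \<in> N \<inter> M" using C(2) y by simp
          then show ?thesis using add_principal_superset(1)[OF NM x(3)] by blast
        next
          case False
          then obtain a n where a: "a \<in> carrier R" "n \<in> N" "x = a \<otimes> ?y \<oplus> n" by blast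
          have nc: "n \<in> carrier R" using a ND(1) by blast
          have ay: "a \<otimes> ?y = a \<otimes> f \<otimes> z" using a f zc by (simp add: m_assoc)
          have "a \<otimes> f \<notin> J"
          proof
            assume "a \<otimes> f \<in> J"
            then have "a \<otimes> ?y \<in> N" using JM z N(2) ay by auto
            then show False using a N(3) ND(3) by blast
          qed
          then obtain b where b: "b \<in> carrier R" "b \<otimes> (a \<otimes> f) = f" using es_left[OF f a(1)] by blast
          have "b \<otimes> x = b \<otimes> (a \<otimes> f \<otimes> z \<oplus> n)" using a(3) ay by simp
          also have "\<dots> = b \<otimes> (a \<otimes> f) \<otimes> z \<oplus> b \<otimes> n"
            using a(1) b(1) f zc nc by (simp add: r_distr m_assoc)
          finally have bx: "b \<otimes> x = ?y \<oplus> b \<otimes> n" using b(2) by simp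
          have bn: "\<ominus> (b \<otimes> n) \<in> N" by (rule left_ideal_neg[OF N(1) ND(4)[OF b(1) a(2)]])
          have y': "?y = b \<otimes> x \<oplus> \<ominus> (b \<otimes> n)"
            unfolding bx using y(2) b(1) nc by (simp add: a_assoc r_neg)
          have "\<ominus> (b \<otimes> n) = ?y \<ominus> b \<otimes> x"
            using y(2) b(1) nc by (simp add: bx a_minus_def minus_add a_assoc[symmetric] r_neg)
          then have "\<ominus> (b \<otimes> n) \<in> N \<inter> M"
            using bn left_ideal_minus[OF M(1) y(1) MD(4)[OF b(1) x(1)]] by simp
          then show ?thesis using y' b(1) by blast
        qed
      qed
    qed
  qed
  then show False using left_fg.add[OF fg x(3)] M(2) by simp
qed

section \<open>Annihilators over a left self-injective ring containing all simple left
  modules\<close>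

definition left_annihilator :: "('a, 'r) ring_scheme \<Rightarrow> 'a set \<Rightarrow> 'a set" where
  "left_annihilator R K = {a \<in> carrier R. \<forall>x\<in>K. a \<otimes>\<^bsub>R\<^esub> x = \<zero>\<^bsub>R\<^esub>}"

definition right_annihilator :: "('a, 'r) ring_scheme \<Rightarrow> 'a set \<Rightarrow> 'a set" where
  "right_annihilator R L = {x \<in> carrier R. \<forall>a\<in>L. a \<otimes>\<^bsub>R\<^esub> x = \<zero>\<^bsub>R\<^esub>}"

lemma left_annihilator_antimono: "K \<subseteq> K' \<Longrightarrow> left_annihilator R K' \<subseteq> left_annihilator R K"
  and right_annihilator_antimono: "L \<subseteq> L' \<Longrightarrow> right_annihilator R L' \<subseteq> right_annihilator R L"
  by (auto simp: left_annihilator_def right_annihilator_def)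

context ring
begin

lemma left_ideal_left_annihilator: "K \<subseteq> carrier R \<Longrightarrow> left_ideal R (left_annihilator R K)"
  by (rule left_idealI) (auto simp: left_annihilator_def l_distr m_assoc)

lemma right_ideal_right_annihilator: "L \<subseteq> carrier R \<Longrightarrow> right_ideal R (right_annihilator R L)"
  by (rule left_idealI) (auto simp: right_annihilator_def r_distr subset_iff simp flip: m_assoc)

end

text \<open>The condition on \<open>e\<close> says that the simple module \<open>Re/Je\<close>
  embeds into \<open>R\<close>, by \<open>ae \<mapsto> aes\<close>. Together with injectivity it
  carries the annihilator duality.\<close>

locale left_injective_kasch = semiprimary +
  assumes injective: "left_self_injective R"
    and kasch: "e \<in> es \<Longrightarrow> \<exists>s\<in>socle. e \<otimes> s \<noteq> \<zero>"
begin

lemma partial_hom_right_mult: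
  assumes "partial_hom R (regular_module R) (regular_module R) G"
  shows "\<exists>r\<in>carrier R. \<forall>x y. (x, y) \<in> G \<longrightarrow> y = x \<otimes> r"
proof -
  obtain g where g: "g \<in> module_hom R (regular_module R) (regular_module R)"
    "\<And>x y. (x, y) \<in> G \<Longrightarrow> g x = y"
    using injective_partial_hom[OF _ left_module_regular[OF ring_axioms] assms] injective
    unfolding left_self_injective_def by blast
  have "g x = x \<otimes> g \<one>" if "x \<in> carrier R" for x
    using module_homD(3)[OF g(1), of x \<one>] that by simp
  moreover have "g \<one> \<in> carrier R" using module_homD(1)[OF g(1), of \<one>] by simp
  ultimately show ?thesis using g(2) partial_hom_regularD(1)[OF assms] by metis
qed

text \<open>Map \<open>Rx + L\<close> onto a simple quotient that kills \<open>L\<close>, embed this quotient into \<open>R\<close>, and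
  extend by injectivity.\<close>

lemma separating_element:
  assumes L: "left_ideal R L" and x: "x \<in> carrier R" "x \<notin> L"
  shows "\<exists>r\<in>carrier R. (\<forall>l\<in>L. l \<otimes> r = \<zero>) \<and> x \<otimes> r \<noteq> \<zero>"
proof -
  note LD = left_idealD[OF L]
  \<comment> \<open>The quotient of \<open>Rx + L\<close> by \<open>Jx + L\<close> is killed by
    \<open>J\<close>, hence semisimple; it is nonzero by Nakayama's lemma.\<close>
  define L1 where "L1 = {u \<oplus> l | u l. u \<in> (\<lambda>j. j \<otimes> x) ` J \<and> l \<in> L}"
  have L1: "left_ideal R L1"
    unfolding L1_def by (intro left_ideal_sum left_ideal_mult_right left_ideal_J L x)
  note L1D = left_idealD[OF L1]
  have LL1: "L \<subseteq> L1"
  proof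
    fix l assume "l \<in> L"
    then have "l = \<zero> \<otimes> x \<oplus> l" using x LD(1) by simp
    then show "l \<in> L1" unfolding L1_def using \<open>l \<in> L\<close> left_idealD(2)[OF left_ideal_J] by blast
  qed
  have "x \<notin> L1"
  proof
    assume "x \<in> L1"
    then obtain u l where ul: "u \<in> (\<lambda>j. j \<otimes> x) ` J" "l \<in> L" "x = u \<oplus> l"
      unfolding L1_def by (elim CollectE exE conjE)
    from ul(1) obtain j where u: "u = j \<otimes> x" and j: "j \<in> J" by (rule imageE)
    have jl: "x = j \<otimes> x \<oplus> l" using ul(3) unfolding u .
    have c: "j \<in> carrier R" "l \<in> carrier R" using j ul(2) J_carrier LD(1) by auto
    obtain k :: nat where k: "j [^] k = \<zero>" using J_nilpotent_element[OF j] by blast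
    \<comment> \<open>Iterating \<open>x = jx + l\<close> gives this for every \<open>i\<close>; as
      \<open>j\<close> is nilpotent, \<open>x\<close> itself ends up in \<open>L\<close>.\<close>
    have "x \<ominus> j [^] i \<otimes> x \<in> L" for i :: nat
    proof (induction i)
      case 0
      then show ?case using x LD(2) by simp
    next
      case (Suc i)
      have "j [^] i \<otimes> x = j [^] i \<otimes> (j \<otimes> x \<oplus> l)" by (rule arg_cong[OF jl])
      also have "\<dots> = j [^] Suc i \<otimes> x \<oplus> j [^] i \<otimes> l" using c x by (simp add: r_distr m_assoc)
      finally have "j [^] i \<otimes> x = j [^] Suc i \<otimes> x \<oplus> j [^] i \<otimes> l" .
      then have "x \<ominus> j [^] Suc i \<otimes> x = (x \<ominus> j [^] i \<otimes> x) \<oplus> j [^] i \<otimes> l"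
        using c x(1) by (simp add: a_minus_def minus_add a_assoc l_neg)
      then show ?case using Suc LD(3,4) c ul(2) by simp
    qed
    from this[of k] show False using k x by simp
  qed
  then obtain e where e: "e \<in> es" "e \<otimes> x \<notin> L1"
    using sum_left_mem[of L1 x] L1D x(1) by blast
  obtain s where s: "s \<in> socle" "e \<otimes> s \<noteq> \<zero>" using kasch[OF e(1)] by blast
  have c [simp]: "e \<in> carrier R" "s \<in> carrier R" "x \<in> carrier R" using e s x socle_carrier by auto
  define G where "G = {(a \<otimes> (e \<otimes> x) \<oplus> l, a \<otimes> (e \<otimes> s)) | a l. a \<in> carrier R \<and> l \<in> L1}"
  have GI: "(a \<otimes> (e \<otimes> x) \<oplus> l, a \<otimes> (e \<otimes> s)) \<in> G" if "a \<in> carrier R" "l \<in> L1" for a l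
    using that unfolding G_def by blast
  have "partial_hom R (regular_module R) (regular_module R) G"
  proof (rule partial_hom_regularI)
    show "u \<in> carrier R \<and> v \<in> carrier R" if "(u, v) \<in> G" for u v
    proof -
      obtain a l where "a \<in> carrier R" "l \<in> L1" "u = a \<otimes> (e \<otimes> x) \<oplus> l" "v = a \<otimes> (e \<otimes> s)"
        using \<open>(u, v) \<in> G\<close> unfolding G_def by blast
      then show ?thesis using L1D(1) by simp
    qed
    show "(\<zero>, \<zero>) \<in> G" using GI[OF zero_closed L1D(2)] by simp
    show "(u \<oplus> u', v \<oplus> v') \<in> G" if "(u, v) \<in> G" "(u', v') \<in> G" for u v u' v'
    proof -
      obtain a l a' l' where *: "a \<in> carrier R" "l \<in> L1" "a' \<in> carrier R" "l' \<in> L1"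
        "u = a \<otimes> (e \<otimes> x) \<oplus> l" "v = a \<otimes> (e \<otimes> s)" "u' = a' \<otimes> (e \<otimes> x) \<oplus> l'" "v' = a' \<otimes> (e \<otimes> s)"
        using \<open>(u, v) \<in> G\<close> \<open>(u', v') \<in> G\<close> unfolding G_def by blast
      then show ?thesis
        using GI[of "a \<oplus> a'" "l \<oplus> l'"] L1D(3)[OF *(2,4)] L1D(1)[OF *(2)] L1D(1)[OF *(4)]
        by (simp add: l_distr a_ac)
    qed
    show "(b \<otimes> u, b \<otimes> v) \<in> G" if "b \<in> carrier R" "(u, v) \<in> G" for b u v
    proof -
      obtain a l where *: "a \<in> carrier R" "l \<in> L1" "u = a \<otimes> (e \<otimes> x) \<oplus> l" "v = a \<otimes> (e \<otimes> s)"
        using \<open>(u, v) \<in> G\<close> unfolding G_def by blast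
      then show ?thesis
        using GI[of "b \<otimes> a" "b \<otimes> l"] L1D(4)[OF \<open>b \<in> carrier R\<close> *(2)] L1D(1)[OF *(2)] \<open>b \<in> carrier R\<close>
        by (simp add: r_distr m_assoc)
    qed
    \<comment> \<open>If \<open>ae\<close> were outside \<open>J\<close>, then
      \<open>aex \<in> L1\<close> would give \<open>ex \<in> L1\<close>. With \<open>ae\<close> in
      \<open>J\<close> the value \<open>aes\<close> vanishes because \<open>s\<close> is in the
      socle.\<close>
    show "v = \<zero>" if "(\<zero>, v) \<in> G" for v
    proof -
      obtain a l where *: "a \<in> carrier R" "l \<in> L1" "\<zero> = a \<otimes> (e \<otimes> x) \<oplus> l" "v = a \<otimes> (e \<otimes> s)"
        using \<open>(\<zero>, v) \<in> G\<close> unfolding G_def by blast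
      have "a \<otimes> (e \<otimes> x) = \<ominus> l"
        using minus_equality[OF *(3)[symmetric] L1D(1)[OF *(2)]] *(1) by simp
      then have aex: "a \<otimes> (e \<otimes> x) \<in> L1" using left_ideal_neg[OF L1 *(2)] by simp
      have "a \<otimes> e \<in> J"
      proof (rule ccontr)
        assume "a \<otimes> e \<notin> J"
        then obtain b where b: "b \<in> carrier R" "b \<otimes> (a \<otimes> e) = e" using es_left[OF e(1) *(1)] by blast
        have "b \<otimes> (a \<otimes> (e \<otimes> x)) = b \<otimes> (a \<otimes> e) \<otimes> x" using *(1) b(1) by (simp add: m_assoc)
        then have "b \<otimes> (a \<otimes> (e \<otimes> x)) = e \<otimes> x" using b(2) by simp
        then show False using L1D(4)[OF b(1) aex] e(2) by simp
      qed
      then have "a \<otimes> e \<otimes> s = \<zero>" using s(1) by (simp add: socle_def)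
      then show ?thesis using *(1,4) by (simp add: m_assoc)
    qed
  qed
  then obtain r where r: "r \<in> carrier R" "\<And>u v. (u, v) \<in> G \<Longrightarrow> v = u \<otimes> r"
    using partial_hom_right_mult by blast
  have "e \<otimes> s = e \<otimes> x \<otimes> r" using r(2)[OF GI[OF one_closed L1D(2)]] by simp
  then have "x \<otimes> r \<noteq> \<zero>" using s(2) r(1) by (auto simp: m_assoc)
  moreover have "l \<otimes> r = \<zero>" if "l \<in> L" for l
  proof -
    have "l \<in> L1" using LL1 that by blast
    then show ?thesis using r(2)[OF GI[OF zero_closed, of l]] LD(1)[OF that] by simp
  qed
  ultimately show ?thesis using r(1) by blast
qed

lemma left_ideal_double_annihilator:
  assumes "left_ideal R L"
  shows "left_annihilator R (right_annihilator R L) = L"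
proof
  show "left_annihilator R (right_annihilator R L) \<subseteq> L"
  proof (rule ccontr)
    assume "\<not> left_annihilator R (right_annihilator R L) \<subseteq> L"
    then obtain x where x: "x \<in> left_annihilator R (right_annihilator R L)" "x \<notin> L" by blast
    then have "x \<in> carrier R" by (simp add: left_annihilator_def)
    then obtain r where "r \<in> carrier R" "\<forall>l\<in>L. l \<otimes> r = \<zero>" "x \<otimes> r \<noteq> \<zero>"
      using separating_element[OF assms _ x(2)] by blast
    then show False using x by (simp add: left_annihilator_def right_annihilator_def)
  qed
  show "L \<subseteq> left_annihilator R (right_annihilator R L)"
    using left_idealD(1)[OF assms] by (auto simp: left_annihilator_def right_annihilator_def)
qed

text \<open>This is the nontrivial inclusion of the double annihilator condition. For right ideals
  it has to be built up generator by generator.\<close>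

definition right_closed :: "'a set \<Rightarrow> bool" where
  "right_closed K \<longleftrightarrow> (\<forall>y\<in>carrier R. (\<forall>a\<in>left_annihilator R K. a \<otimes> y = \<zero>) \<longrightarrow> y \<in> K)"

lemma right_closed_zero: "right_closed {\<zero>}"
  unfolding right_closed_def left_annihilator_def by (auto dest: bspec[of _ _ \<one>])

text \<open>Let \<open>A\<close> and \<open>B\<close> be the left annihilators of \<open>K\<close>
  and \<open>x\<close>. As \<open>y\<close> is killed by their intersection,
  \<open>a + b \<mapsto> by\<close> is well defined on \<open>A + B\<close>, hence right
  multiplication by some \<open>w\<close>. Now \<open>A\<close> kills \<open>w\<close>, so
  \<open>w\<close> lies in \<open>K\<close>, and \<open>B\<close> kills \<open>y - w\<close>, which
  puts \<open>y - w\<close> into \<open>xR\<close>.\<close>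

lemma right_closed_add_principal:
  assumes K: "right_ideal R K" "right_closed K" and x: "x \<in> carrier R"
  shows "right_closed {x \<otimes> a \<oplus> k | a k. a \<in> carrier R \<and> k \<in> K}"
  unfolding right_closed_def
proof (intro ballI impI)
  let ?K = "{x \<otimes> a \<oplus> k | a k. a \<in> carrier R \<and> k \<in> K}"
  fix y assume y: "y \<in> carrier R" and ann: "\<forall>a\<in>left_annihilator R ?K. a \<otimes> y = \<zero>"
  have KC: "K \<subseteq> carrier R" using left_idealD(1)[OF K(1)] by auto
  let ?A = "left_annihilator R K" and ?B = "left_annihilator R {x}"
  have A: "left_ideal R ?A" and B: "left_ideal R ?B"
    using KC x by (auto intro: left_ideal_left_annihilator)
  note AD = left_idealD[OF A] and BD = left_idealD[OF B]
  have AB: "z \<otimes> y = \<zero>" if z: "z \<in> ?A" "z \<in> ?B" for z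
  proof -
    have zc: "z \<in> carrier R" "z \<otimes> x = \<zero>" using z by (auto simp: left_annihilator_def)
    have "z \<otimes> w = \<zero>" if "w \<in> ?K" for w
    proof -
      obtain a k where w: "a \<in> carrier R" "k \<in> K" "w = x \<otimes> a \<oplus> k" using \<open>w \<in> ?K\<close> by blast
      have kc: "k \<in> carrier R" "z \<otimes> k = \<zero>" using w z KC by (auto simp: left_annihilator_def)
      have "z \<otimes> w = z \<otimes> x \<otimes> a \<oplus> z \<otimes> k" using zc(1) kc(1) w x by (simp add: r_distr m_assoc)
      then show ?thesis using zc kc w by simp
    qed
    then have "z \<in> left_annihilator R ?K" using zc unfolding left_annihilator_def by blast
    then show ?thesis using ann by blast
  qed
  define G where "G = {(a \<oplus> b, b \<otimes> y) | a b. a \<in> ?A \<and> b \<in> ?B}"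
  have GI: "(a \<oplus> b, b \<otimes> y) \<in> G" if "a \<in> ?A" "b \<in> ?B" for a b
    using that unfolding G_def by blast
  have "partial_hom R (regular_module R) (regular_module R) G"
  proof (rule partial_hom_regularI)
    show "u \<in> carrier R \<and> v \<in> carrier R" if "(u, v) \<in> G" for u v
      using that AD(1) BD(1) y unfolding G_def by auto
    show "(\<zero>, \<zero>) \<in> G" using GI[OF AD(2) BD(2)] y by simp
    show "(u \<oplus> u', v \<oplus> v') \<in> G" if "(u, v) \<in> G" "(u', v') \<in> G" for u v u' v'
    proof -
      obtain a b a' b' where *: "a \<in> ?A" "b \<in> ?B" "a' \<in> ?A" "b' \<in> ?B"
        "u = a \<oplus> b" "v = b \<otimes> y" "u' = a' \<oplus> b'" "v' = b' \<otimes> y"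
        using \<open>(u, v) \<in> G\<close> \<open>(u', v') \<in> G\<close> unfolding G_def by blast
      then show ?thesis
        using GI[OF AD(3)[OF *(1,3)] BD(3)[OF *(2,4)]] AD(1) BD(1) y by (simp add: l_distr a_ac)
    qed
    show "(c \<otimes> u, c \<otimes> v) \<in> G" if c: "c \<in> carrier R" and "(u, v) \<in> G" for c u v
    proof -
      obtain a b where *: "a \<in> ?A" "b \<in> ?B" "u = a \<oplus> b" "v = b \<otimes> y"
        using \<open>(u, v) \<in> G\<close> unfolding G_def by blast
      then show ?thesis
        using GI[OF AD(4)[OF c *(1)] BD(4)[OF c *(2)]] AD(1) BD(1) y c by (simp add: r_distr m_assoc)
    qed
    show "v = \<zero>" if "(\<zero>, v) \<in> G" for v
    proof -
      obtain a b where *: "a \<in> ?A" "b \<in> ?B" "\<zero> = a \<oplus> b" "v = b \<otimes> y"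
        using \<open>(\<zero>, v) \<in> G\<close> unfolding G_def by blast
      have "b = \<ominus> a" using * AD(1) BD(1) by (metis a_comm minus_equality)
      then have "b \<in> ?A" using left_ideal_neg[OF A *(1)] by simp
      then show ?thesis using AB * by simp
    qed
  qed
  then obtain w where w: "w \<in> carrier R" "\<And>u v. (u, v) \<in> G \<Longrightarrow> v = u \<otimes> w"
    using partial_hom_right_mult by blast
  have "a \<otimes> w = \<zero>" if a: "a \<in> ?A" for a
    using w(2)[OF GI[OF a BD(2)]] AD(1)[OF a] y by simp
  then have wK: "w \<in> K" using K(2) w(1) by (simp add: right_closed_def)
  define d where "d = y \<ominus> w"
  have dc: "d \<in> carrier R" using y w(1) by (simp add: d_def)
  have Bd: "b \<otimes> d = \<zero>" if b: "b \<in> ?B" for b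
  proof -
    have "b \<otimes> y = b \<otimes> w" using w(2)[OF GI[OF AD(2) b]] BD(1)[OF b] by simp
    then show ?thesis using BD(1)[OF b] y w(1) by (simp add: d_def r_distr_minus)
  qed
  \<comment> \<open>The map \<open>cx \<mapsto> cd\<close> is well defined because the left
    annihilator of \<open>x\<close> kills \<open>d\<close>; its multiplier \<open>r\<close> gives
    \<open>d = xr\<close>.\<close>
  have "partial_hom R (regular_module R) (regular_module R) {(c \<otimes> x, c \<otimes> d) | c. c \<in> carrier R}"
  proof (rule partial_hom_regularI)
    show "(\<zero>, \<zero>) \<in> {(c \<otimes> x, c \<otimes> d) | c. c \<in> carrier R}"
      using x dc by (intro CollectI exI[of _ \<zero>]) simp
    show "(u \<oplus> u', v \<oplus> v') \<in> {(c \<otimes> x, c \<otimes> d) | c. c \<in> carrier R}"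
      if "(u, v) \<in> {(c \<otimes> x, c \<otimes> d) | c. c \<in> carrier R}"
        "(u', v') \<in> {(c \<otimes> x, c \<otimes> d) | c. c \<in> carrier R}" for u v u' v'
    proof -
      have "\<exists>c\<in>carrier R. \<exists>c'\<in>carrier R. u = c \<otimes> x \<and> v = c \<otimes> d \<and> u' = c' \<otimes> x \<and> v' = c' \<otimes> d"
        using that by blast
      then obtain c c' where "c \<in> carrier R" "c' \<in> carrier R"
        "u = c \<otimes> x" "v = c \<otimes> d" "u' = c' \<otimes> x" "v' = c' \<otimes> d" by blast
      then show ?thesis using x dc by (intro CollectI exI[of _ "c \<oplus> c'"]) (simp add: l_distr)
    qed
    show "(a \<otimes> u, a \<otimes> v) \<in> {(c \<otimes> x, c \<otimes> d) | c. c \<in> carrier R}"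
      if a: "a \<in> carrier R" and "(u, v) \<in> {(c \<otimes> x, c \<otimes> d) | c. c \<in> carrier R}" for a u v
    proof -
      obtain c where "c \<in> carrier R" "u = c \<otimes> x" "v = c \<otimes> d"
        using \<open>(u, v) \<in> _\<close> by blast
      then show ?thesis using x dc a by (intro CollectI exI[of _ "a \<otimes> c"]) (simp add: m_assoc)
    qed
    show "v = \<zero>" if "(\<zero>, v) \<in> {(c \<otimes> x, c \<otimes> d) | c. c \<in> carrier R}" for v
    proof -
      obtain c where "c \<in> carrier R" "\<zero> = c \<otimes> x" "v = c \<otimes> d"
        using \<open>(\<zero>, v) \<in> _\<close> by blast
      then show ?thesis using Bd[of c] by (simp add: left_annihilator_def)
    qed
  qed (use x dc in auto)
  then obtain r where r: "r \<in> carrier R"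
    "\<And>u v. (u, v) \<in> {(c \<otimes> x, c \<otimes> d) | c. c \<in> carrier R} \<Longrightarrow> v = u \<otimes> r"
    using partial_hom_right_mult by blast
  have "(\<one> \<otimes> x, \<one> \<otimes> d) \<in> {(c \<otimes> x, c \<otimes> d) | c. c \<in> carrier R}" by blast
  then have "d = x \<otimes> r" using r(2) x dc by fastforce
  moreover have "y = d \<oplus> w" using y w(1) by (simp add: d_def a_minus_def a_assoc l_neg)
  ultimately show "y \<in> ?K" using r(1) wK by blast
qed

end

section \<open>Closedness of right ideals, transfer of chain conditions, right
  self-injectivity\<close>

context left_injective_kasch
begin

lemma right_ideal_add_principal:
  assumes "right_ideal R K" "x \<in> carrier R"
  shows "right_ideal R {x \<otimes> a \<oplus> k | a k. a \<in> carrier R \<and> k \<in> K}"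
    and "K \<subseteq> {x \<otimes> a \<oplus> k | a k. a \<in> carrier R \<and> k \<in> K}"
    and "x \<in> {x \<otimes> a \<oplus> k | a k. a \<in> carrier R \<and> k \<in> K}"
proof -
  interpret O: ring "opposite_ring R" by (rule ring_opposite) (rule ring_axioms)
  show "right_ideal R {x \<otimes> a \<oplus> k | a k. a \<in> carrier R \<and> k \<in> K}"
    using O.left_ideal_add_principal[of K x] assms by simp
  show "K \<subseteq> {x \<otimes> a \<oplus> k | a k. a \<in> carrier R \<and> k \<in> K}"
    using O.add_principal_superset(1)[of K x] assms by simp
  show "x \<in> {x \<otimes> a \<oplus> k | a k. a \<in> carrier R \<and> k \<in> K}"
    using O.add_principal_superset(2)[of K x] assms by simp
qed

lemma right_ideal_carrier: "right_ideal R K \<Longrightarrow> K \<subseteq> carrier R"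
  by (auto dest: left_idealD(1))

lemma right_ideal_zero: "right_ideal R {\<zero>}"
  using ring.left_ideal_zero[OF ring_opposite[OF ring_axioms]] by simp

lemma right_closed_double_annihilator:
  assumes "right_ideal R K" "right_closed K"
  shows "right_annihilator R (left_annihilator R K) = K"
proof
  show "right_annihilator R (left_annihilator R K) \<subseteq> K"
    using assms(2) unfolding right_annihilator_def right_closed_def by blast
  show "K \<subseteq> right_annihilator R (left_annihilator R K)"
    using right_ideal_carrier[OF assms(1)] by (auto simp: right_annihilator_def left_annihilator_def)
qed

lemma right_closed_annihilator_mono:
  assumes "right_closed K" "K \<subseteq> K'" "left_annihilator R K' = left_annihilator R K" "K' \<subseteq> carrier R"
  shows "K' \<subseteq> K"
proof
  fix x assume x: "x \<in> K'"
  have "a \<otimes> x = \<zero>" if "a \<in> left_annihilator R K" for a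
    using that x assms(3) unfolding left_annihilator_def by blast
  then show "x \<in> K" using assms(1,4) x unfolding right_closed_def by blast
qed

text \<open>The left chain condition provides a closed right ideal inside \<open>K\<close> with
  minimal left annihilator. Adding an element of \<open>K\<close> keeps it closed and, by
  minimality, keeps its annihilator; a closed right ideal cannot grow in this way, so it is all of
  \<open>K\<close>.\<close>

lemma right_closed_if_left_dcc:
  assumes dcc: "left_dcc R" and K: "right_ideal R K"
  shows "right_closed K"
proof -
  define P where "P L \<longleftrightarrow> (\<exists>K'. right_ideal R K' \<and> K' \<subseteq> K \<and> right_closed K' \<and> L = left_annihilator R K')" for L
  have "P (left_annihilator R {\<zero>})"
    unfolding P_def using right_ideal_zero right_closed_zero left_idealD(2)[OF K] by auto
  from left_dcc_minimal[where P = P, OF dcc this left_ideal_left_annihilator]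
  obtain L where "P L" and min: "\<And>L'. \<lbrakk>left_ideal R L'; P L'; L' \<subseteq> L\<rbrakk> \<Longrightarrow> L' = L"
    by auto
  then obtain K' where K': "right_ideal R K'" "K' \<subseteq> K" "right_closed K'" and L: "L = left_annihilator R K'"
    unfolding P_def by (elim exE conjE)
  have "K \<subseteq> K'"
  proof
    fix x assume x: "x \<in> K"
    have xc: "x \<in> carrier R" using x right_ideal_carrier[OF K] by blast
    define M where "M = {x \<otimes> a \<oplus> k | a k. a \<in> carrier R \<and> k \<in> K'}"
    note M = right_ideal_add_principal[OF K'(1) xc, folded M_def]
    have "M \<subseteq> K"
      using left_idealD(3,4)[OF K] x K'(2) unfolding M_def by auto
    then have "P (left_annihilator R M)"
      unfolding P_def using M(1) right_closed_add_principal[OF K'(1,3) xc, folded M_def] by blast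
    then have "left_annihilator R M = L"
      using M(1,2) right_ideal_carrier[of M]
      by (intro min left_ideal_left_annihilator) (simp_all add: L left_annihilator_antimono)
    then have "M \<subseteq> K'"
      using right_closed_annihilator_mono[OF K'(3) M(2)] right_ideal_carrier[OF M(1)] L by simp
    then show "x \<in> K'" using M(3) by blast
  qed
  then show ?thesis using K' by (metis subset_antisym)
qed

lemma right_closed_if_fg:
  assumes "left_fg (opposite_ring R) K"
  shows "right_closed K"
  using assms
proof (induction rule: left_fg.induct)
  case zero
  then show ?case using right_closed_zero by simp
next
  case (add N x)
  then show ?case
    using right_closed_add_principal[OF ring.left_fg_left_ideal[OF ring_opposite[OF ring_axioms]]]
    by simp
qed

lemma right_dcc_if_left_acc:
  assumes acc: "left_acc R" and closed: "\<And>K. right_ideal R K \<Longrightarrow> right_closed K"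
  shows "left_dcc (opposite_ring R)"
  unfolding left_dcc_def
proof (intro allI impI, elim conjE)
  fix N :: "nat \<Rightarrow> 'a set" assume N: "\<forall>n. right_ideal R (N n)" "\<forall>n. N (Suc n) \<subseteq> N n"
  have "left_ideal R (left_annihilator R (N n))" for n
    by (rule left_ideal_left_annihilator[OF right_ideal_carrier[OF N(1)[rule_format]]])
  moreover have "left_annihilator R (N n) \<subseteq> left_annihilator R (N (Suc n))" for n
    by (rule left_annihilator_antimono[OF N(2)[rule_format]])
  ultimately obtain m where m: "\<forall>n\<ge>m. left_annihilator R (N n) = left_annihilator R (N m)"
    using acc[unfolded left_acc_def, rule_format, of "\<lambda>n. left_annihilator R (N n)"] by auto
  have "N n = N m" if "n \<ge> m" for n
    using right_closed_double_annihilator[OF N(1)[rule_format] closed[OF N(1)[rule_format]]] m that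
    by metis
  then show "\<exists>m. \<forall>n\<ge>m. N n = N m" by blast
qed

lemma left_dcc_if_right_acc:
  assumes acc: "left_acc (opposite_ring R)"
  shows "left_dcc R"
  unfolding left_dcc_def
proof (intro allI impI, elim conjE)
  fix N :: "nat \<Rightarrow> 'a set" assume N: "\<forall>n. left_ideal R (N n)" "\<forall>n. N (Suc n) \<subseteq> N n"
  have NC: "N n \<subseteq> carrier R" for n using left_idealD(1)[OF N(1)[rule_format]] by blast
  have "right_ideal R (right_annihilator R (N n))" for n
    by (rule right_ideal_right_annihilator[OF NC])
  moreover have "right_annihilator R (N n) \<subseteq> right_annihilator R (N (Suc n))" for n
    by (rule right_annihilator_antimono[OF N(2)[rule_format]])
  ultimately obtain m where m: "\<forall>n\<ge>m. right_annihilator R (N n) = right_annihilator R (N m)"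
    using acc[unfolded left_acc_def, rule_format, of "\<lambda>n. right_annihilator R (N n)"] by auto
  have "N n = N m" if "n \<ge> m" for n
    using left_ideal_double_annihilator[OF N(1)[rule_format]] m that by metis
  then show "\<exists>m. \<forall>n\<ge>m. N n = N m" by blast
qed

text \<open>Multiplication by \<open>c\<close> on \<open>K\<close> and by \<open>c'\<close> on
  \<open>xR\<close> can be combined once \<open>c - c'\<close> lies in the sum of the left
  annihilators of \<open>K\<close> and \<open>x\<close>. An element \<open>r\<close> separating
  \<open>c - c'\<close> from that sum would, by closedness, lie in both \<open>K\<close> and
  \<open>xR\<close>, where \<open>c\<close> and \<open>c'\<close> agree.\<close>

lemma left_mult_extend:
  assumes closed: "\<And>K. right_ideal R K \<Longrightarrow> right_closed K"
    and K: "right_ideal R K" and x: "x \<in> carrier R" and c: "c \<in> carrier R" "c' \<in> carrier R"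
    and agree: "\<And>t. \<lbrakk>t \<in> carrier R; x \<otimes> t \<in> K\<rbrakk> \<Longrightarrow> c \<otimes> (x \<otimes> t) = c' \<otimes> (x \<otimes> t)"
  shows "\<exists>d\<in>carrier R. (\<forall>k\<in>K. d \<otimes> k = c \<otimes> k) \<and> d \<otimes> x = c' \<otimes> x"
proof -
  let ?A = "left_annihilator R K" and ?B = "left_annihilator R {x}"
  have KC: "K \<subseteq> carrier R" using right_ideal_carrier[OF K] .
  have A: "left_ideal R ?A" and B: "left_ideal R ?B"
    using KC x by (auto intro: left_ideal_left_annihilator)
  note AD = left_idealD[OF A] and BD = left_idealD[OF B]
  have "c \<ominus> c' \<in> {u \<oplus> v | u v. u \<in> ?A \<and> v \<in> ?B}"
  proof (rule ccontr)
    assume n: "\<not> ?thesis"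
    have "c \<ominus> c' \<in> carrier R" using c by simp
    from separating_element[OF left_ideal_sum[OF A B] this n]
    obtain r where r: "r \<in> carrier R" "(c \<ominus> c') \<otimes> r \<noteq> \<zero>"
      and ann: "\<forall>l\<in>{u \<oplus> v | u v. u \<in> ?A \<and> v \<in> ?B}. l \<otimes> r = \<zero>" by blast
    have "a \<otimes> r = \<zero>" if "a \<in> ?A" for a
    proof -
      have "a \<oplus> \<zero> \<in> {u \<oplus> v | u v. u \<in> ?A \<and> v \<in> ?B}" using that BD(2) by blast
      then show ?thesis using ann AD(1)[OF that] by fastforce
    qed
    then have rK: "r \<in> K" using closed[OF K] r(1) unfolding right_closed_def by blast
    have "b \<otimes> r = \<zero>" if "b \<in> ?B" for b
    proof -
      have "\<zero> \<oplus> b \<in> {u \<oplus> v | u v. u \<in> ?A \<and> v \<in> ?B}" using that AD(2) by blast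
      then show ?thesis using ann BD(1)[OF that] by fastforce
    qed
    moreover define M where "M = {x \<otimes> a \<oplus> k | a k. a \<in> carrier R \<and> k \<in> {\<zero>}}"
    note M = right_ideal_add_principal[OF right_ideal_zero x, folded M_def]
    have "left_annihilator R M \<subseteq> ?B" using M(3) by (intro left_annihilator_antimono) simp
    ultimately have "r \<in> M" using closed[OF M(1)] r(1) unfolding right_closed_def by blast
    then obtain t where t: "t \<in> carrier R" "r = x \<otimes> t" using x unfolding M_def by auto
    then have "c \<otimes> r = c' \<otimes> r" using agree[OF t(1)] rK by simp
    then show False using r c by (simp add: l_distr_minus)
  qed
  then obtain u v where uv: "u \<in> ?A" "v \<in> ?B" "c \<ominus> c' = u \<oplus> v" by blast
  have [simp]: "u \<in> carrier R" "v \<in> carrier R" using AD(1) BD(1) uv by auto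
  \<comment> \<open>Subtracting the part \<open>u\<close>, which kills \<open>K\<close>, changes
    nothing on \<open>K\<close> and turns \<open>c\<close> into \<open>c' + v\<close>, where
    \<open>v\<close> kills \<open>x\<close>.\<close>
  have "(c \<ominus> u) \<otimes> k = c \<otimes> k" if "k \<in> K" for k
  proof -
    have "u \<otimes> k = \<zero>" "k \<in> carrier R" using uv(1) that KC by (auto simp: left_annihilator_def)
    then show ?thesis using c by (simp add: l_distr_minus)
  qed
  moreover have "(c \<ominus> u) \<otimes> x = c' \<otimes> x"
  proof -
    have "c = c' \<oplus> (c \<ominus> c')" using c a_lcomm[of c' c "\<ominus> c'"] by (simp add: a_minus_def r_neg)
    then have "c = (c' \<oplus> v) \<oplus> u" unfolding uv(3) using c by (simp add: a_ac)
    then have "c \<ominus> u = c' \<oplus> v" using c by (simp add: a_minus_def a_assoc r_neg)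
    moreover have "v \<otimes> x = \<zero>" using uv(2) by (simp add: left_annihilator_def)
    ultimately show ?thesis using c x by (simp add: l_distr)
  qed
  ultimately show ?thesis using c by (intro bexI[of _ "c \<ominus> u"]) auto
qed

text \<open>By Baer's criterion a partial homomorphism \<open>G\<close> has to be a left
  multiplication. Among the right ideals on which it is one, take \<open>K\<close> with minimal left
  annihilator; \<open>left_mult_extend\<close> adds any \<open>x\<close> of the domain to
  \<open>K\<close>, so \<open>K\<close> is the whole domain.\<close>

lemma right_self_injective:
  assumes dcc: "left_dcc R" and closed: "\<And>K. right_ideal R K \<Longrightarrow> right_closed K"
  shows "right_self_injective R"
  unfolding right_self_injective_def
proof (rule baer_criterion)
  have O: "ring (opposite_ring R)" by (rule ring_opposite) (rule ring_axioms)
  show OM: "left_module (opposite_ring R) (regular_module (opposite_ring R))"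
    by (rule left_module_regular[OF O])
  fix G assume G: "partial_hom (opposite_ring R) (regular_module (opposite_ring R))
    (regular_module (opposite_ring R)) G"
  note GD = partial_hom_regularD[OF G, simplified]
  note uniq = partial_hom_unique[OF OM OM G]
  define P where "P L \<longleftrightarrow> (\<exists>K c. right_ideal R K \<and> K \<subseteq> Domain G \<and> c \<in> carrier R \<and>
    (\<forall>x y. (x, y) \<in> G \<longrightarrow> x \<in> K \<longrightarrow> y = c \<otimes> x) \<and> L = left_annihilator R K)" for L
  have "P (left_annihilator R {\<zero>})"
    unfolding P_def
  proof (intro exI conjI allI impI)
    show "right_ideal R {\<zero>}" by (rule right_ideal_zero)
    show "{\<zero>} \<subseteq> Domain G" using GD(3) by blast
    show "\<zero> \<in> carrier R" by simp
    show "y = \<zero> \<otimes> x" if "(x, y) \<in> G" "x \<in> {\<zero>}" for x y using GD(6)[of y] that by simp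
  qed (rule refl)
  from left_dcc_minimal[where P = P, OF dcc this left_ideal_left_annihilator]
  obtain L where "P L" and min: "\<And>L'. \<lbrakk>left_ideal R L'; P L'; L' \<subseteq> L\<rbrakk> \<Longrightarrow> L' = L"
    by auto
  then obtain K c where K: "right_ideal R K" "K \<subseteq> Domain G" and c: "c \<in> carrier R"
    and cK: "\<And>x y. \<lbrakk>(x, y) \<in> G; x \<in> K\<rbrakk> \<Longrightarrow> y = c \<otimes> x" and L: "L = left_annihilator R K"
    unfolding P_def by blast
  have KC: "K \<subseteq> carrier R" by (rule right_ideal_carrier[OF K(1)])
  have "Domain G \<subseteq> K"
  proof
    fix x assume "x \<in> Domain G"
    then obtain b where xb: "(x, b) \<in> G" by blast
    have x: "x \<in> carrier R" and b: "b \<in> carrier R" using GD(1,2)[OF xb] by auto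
    \<comment> \<open>Whatever kills \<open>x\<close> from the right also kills its value
      \<open>b\<close>, so \<open>b\<close> cannot be separated from \<open>Rx\<close>. Hence
      \<open>G\<close> is a left multiplication on \<open>xR\<close>.\<close>
    have "b \<in> (\<lambda>a. a \<otimes> x) ` carrier R"
    proof (rule ccontr)
      assume n: "b \<notin> (\<lambda>a. a \<otimes> x) ` carrier R"
      from separating_element[OF left_ideal_mult_right[OF left_ideal_carrier x] b n]
      obtain r where r: "r \<in> carrier R" "b \<otimes> r \<noteq> \<zero>" "\<forall>l\<in>(\<lambda>a. a \<otimes> x) ` carrier R. l \<otimes> r = \<zero>"
        by blast
      have "x \<in> (\<lambda>a. a \<otimes> x) ` carrier R" using x by (intro image_eqI[of _ _ \<one>]) auto
      then have "x \<otimes> r = \<zero>" using r(3) by blast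
      then have "b \<otimes> r = \<zero>" using GD(5)[OF r(1) xb] GD(6) by simp
      then show False using r(2) by simp
    qed
    then obtain c' where c': "c' \<in> carrier R" "b = c' \<otimes> x" by blast
    have "\<exists>d\<in>carrier R. (\<forall>k\<in>K. d \<otimes> k = c \<otimes> k) \<and> d \<otimes> x = c' \<otimes> x"
    proof (rule left_mult_extend[OF closed K(1) x c c'(1)])
      fix t assume t: "t \<in> carrier R" "x \<otimes> t \<in> K"
      have "b \<otimes> t = c \<otimes> (x \<otimes> t)" using cK[OF GD(5)[OF t(1) xb] t(2)] .
      then show "c \<otimes> (x \<otimes> t) = c' \<otimes> (x \<otimes> t)" using c' x t by (simp add: m_assoc)
    qed
    then obtain d where d: "d \<in> carrier R" "\<And>k. k \<in> K \<Longrightarrow> d \<otimes> k = c \<otimes> k" "d \<otimes> x = b"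
      using c'(2) by auto
    define M where "M = {x \<otimes> a \<oplus> k | a k. a \<in> carrier R \<and> k \<in> K}"
    note M = right_ideal_add_principal[OF K(1) x, folded M_def]
    have Md: "(z, d \<otimes> z) \<in> G" if "z \<in> M" for z
    proof -
      obtain a k where ak: "a \<in> carrier R" "k \<in> K" "z = x \<otimes> a \<oplus> k"
        using \<open>z \<in> M\<close> unfolding M_def by blast
      obtain y where y: "(k, y) \<in> G" using K(2) ak(2) by blast
      have "(x \<otimes> a \<oplus> k, b \<otimes> a \<oplus> y) \<in> G" by (rule GD(4)[OF GD(5)[OF ak(1) xb] y])
      moreover have "y = d \<otimes> k" using cK[OF y ak(2)] d(2)[OF ak(2)] by simp
      moreover have "k \<in> carrier R" using ak(2) KC by blast
      ultimately show ?thesis using ak(1,3) d(1) x by (simp add: r_distr m_assoc flip: d(3))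
    qed
    have "P (left_annihilator R M)"
      unfolding P_def
    proof (intro exI conjI allI impI)
      show "right_ideal R M" by (rule M(1))
      show "M \<subseteq> Domain G" using Md by blast
      show "d \<in> carrier R" by (rule d(1))
      show "y = d \<otimes> z" if "(z, y) \<in> G" "z \<in> M" for z y
        using uniq[OF that(1) Md[OF that(2)]] .
    qed (rule refl)
    then have "left_annihilator R M = L"
      using M(1,2) right_ideal_carrier[of M]
      by (intro min left_ideal_left_annihilator) (simp_all add: L left_annihilator_antimono)
    then have "M \<subseteq> K"
      using right_closed_annihilator_mono[OF closed[OF K(1)] M(2)] right_ideal_carrier[OF M(1)] L
      by simp
    then show "x \<in> K" using M(3) by blast
  qed
  then have "\<forall>x y. (x, y) \<in> G \<longrightarrow> y = c \<otimes> x" using cK by blast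
  then show "\<exists>q\<in>carrier (regular_module (opposite_ring R)).
      \<forall>r y. (r, y) \<in> G \<longrightarrow> y = r \<odot>\<^bsub>regular_module (opposite_ring R)\<^esub> q"
    using c by (intro bexI[of _ c]) simp_all
qed

text \<open>A left chain condition closes all right ideals by minimality, and finite generation of
  left ideals passes through annihilators to a right chain condition. A right chain condition makes
  right ideals finitely generated, hence closed, and their ascending chain condition yields the
  descending one for left ideals.\<close>

lemma quasi_frobenius:
  assumes "left_dcc R \<or> left_dcc (opposite_ring R)"
  shows "quasi_frobenius R"
proof -
  have O: "ring (opposite_ring R)" by (rule ring_opposite) (rule ring_axioms)
  interpret op: semiprimary "opposite_ring R" J es by (rule semiprimary_opposite_ring)
  have "left_dcc R \<and> left_dcc (opposite_ring R) \<and> (\<forall>K. right_ideal R K \<longrightarrow> right_closed K)"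
  proof (cases "left_dcc R")
    case True
    then have "\<And>K. right_ideal R K \<Longrightarrow> right_closed K" by (rule right_closed_if_left_dcc)
    moreover have "left_acc R" using left_fg_if_dcc[OF True] by (rule left_acc_if_fg)
    ultimately show ?thesis using True right_dcc_if_left_acc by blast
  next
    case False
    then have dcc: "left_dcc (opposite_ring R)" using assms by blast
    have fg: "left_fg (opposite_ring R) K" if "right_ideal R K" for K
      using op.left_fg_if_dcc[OF dcc that] .
    then have "left_dcc R" by (intro left_dcc_if_right_acc op.left_acc_if_fg)
    then show ?thesis using dcc fg right_closed_if_fg by blast
  qed
  then show ?thesis
    using injective right_self_injective left_artinian_iff_dcc[OF ring_axioms]
      left_artinian_iff_dcc[OF O] ring_axioms
    by (simp add: quasi_frobenius_def right_artinian_def left_artinian_def)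
qed

end

theorem corollary2p5:
  fixes R :: "('a, 'r) ring_scheme"
  assumes "ring R"
    and "right_artinian R \<or> left_artinian R"
    and "left_automorphism_invariant TYPE('e) R"
  shows "quasi_frobenius R"
proof -
  obtain J es where S: "semiprimary R J es" using semiprimary_if_artinian assms(1,2) by blast
  obtain E :: "('a, 'e) module" and i where E: "injective_envelope R (regular_module R) E i"
    and inv: "\<forall>\<phi> \<in> module_aut R E. \<phi> ` (i ` carrier (regular_module R)) \<subseteq> i ` carrier (regular_module R)"
    using assms(3) unfolding left_automorphism_invariant_def automorphism_invariant_def
    by (elim exE conjE)
  interpret S: semiprimary R J es by (rule S)
  interpret A: semiprimary_automorphism_invariant R J es E i
    by unfold_locales (use E inv in auto)
  interpret K: left_injective_kasch R J es
  proof unfold_locales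
    show "left_self_injective R" by (rule A.left_self_injective)
    fix e assume e: "e \<in> es"
    obtain f s where f: "f \<in> es" and s: "s \<in> S.socle" "e \<otimes>\<^bsub>R\<^esub> s \<otimes>\<^bsub>R\<^esub> f \<noteq> \<zero>\<^bsub>R\<^esub>"
      using A.kasch[OF e] by blast
    then have "e \<otimes>\<^bsub>R\<^esub> s \<noteq> \<zero>\<^bsub>R\<^esub>" using S.es_closed[OF f] by auto
    then show "\<exists>s\<in>S.socle. e \<otimes>\<^bsub>R\<^esub> s \<noteq> \<zero>\<^bsub>R\<^esub>" using s(1) by blast
  qed
  show ?thesis
    using K.quasi_frobenius assms(2) left_artinian_iff_dcc[OF assms(1)]
      left_artinian_iff_dcc[OF ring_opposite[OF assms(1)]]
    by (auto simp: right_artinian_def left_artinian_def)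
qed

end
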